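(* Let $\mathcal{H}$ be a Hilbert space, $H_0,V\in\mathcal{B}(\mathcal{H})$ self-adjoint, $\gamma>0$, $H=\gamma H_0+V$, and $\sigma(H_0)=\bigcup_{k=1}^m\sigma_k$ a decomposition into pairwise disjoint components with spectral gap $\eta=\min_{k\neq l}\operatorname{dist}(\sigma_k,\sigma_l)>0$; let $P_k$ be the spectral projection of $H_0$ onto $\sigma_k$, $Q_k=\mathbb{1}-P_k$. Let $f\in L^1(\mathbb{R})$ with $\hat f(s)=\int f(t)e^{-ist}dt=1/s$ for $|s|\ge\eta$, and define $\Omega_k^{(0)}=P_k$, and for $j\ge1$ $$\Omega_k^{(j)}=\int_{-\infty}^{\infty}e^{-itH_0}Q_kY_k^{(j)}P_ke^{itH_0}f(t)\,dt,\quad Y_k^{(j)}=-V\Omega_k^{(j-1)}+\sum_{i=1}^{j-1}\Omega_k^{(i)}V\Omega_k^{(j-1-i)}.$$ Assume $\gamma>4\pi\|V\|/\eta$, and let $\Omega_k=\sum_{j=0}^\infty\gamma^{-j}\Omega_k^{(j)}$ (a convergent series), $\Omega=\sum_k\Omega_k$ and $H_{\mathrm{Bloch}}=\sum_kP_kH\Omega_k$. Then: (i) $\Omega$ is invertible and $H_{\mathrm{Bloch}}=\Omega^{-1}H\Omega$; (ii) $[H_{\mathrm{Bloch}},P_k]=0$ for all $k$; (iii) for all $t\in\mathbb{R}$, $$\|e^{-itH}-e^{-itH_{\mathrm{Bloch}}}\|\le\varepsilon\!\left(\frac{\|V\|}{\gamma\eta}\right),\qquad \varepsilon(x)=\frac{1}{\sqrt{1-4\pi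 x}}-1.$$
   Context: $\|\cdot\|$ is the operator norm; $\mathcal{B}(\mathcal{H})$ the bounded operators on $\mathcal{H}$. $H_{\mathrm{Bloch}}$ is in general not Hermitian. *)

theory Defs
  imports "HOL-Analysis.Analysis" "HOL-Computational_Algebra.Polynomial"
begin

text \<open>Convention: a complex Hilbert space is modelled as a real Hilbert space
  (type class real_inner + complete_space, real inner product = Re of the complex one)
  together with a complex structure J (multiplication by i): J o J = -1, J orthogonal.
  Bounded operators are blinfuns; complex-linear ones are those commuting with J.\<close>

definition complex_structure :: "('a::real_inner \<Rightarrow>\<^sub>L 'a) \<Rightarrow> bool" where
  "complex_structure J \<longleftrightarrow> J o\<^sub>L J = - id_blinfun \<and> (\<forall>x y. inner (J x) (J y) = inner x y)"

definition clinear_op :: "('a::real_normed_vector \<Rightarrow>\<^sub>L 'a) \<Rightarrow> ('a \<Rightarrow>\<^sub>L 'a) \<Rightarrow> bool" where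
  "clinear_op J A \<longleftrightarrow> A o\<^sub>L J = J o\<^sub>L A"

definition selfadjoint_op :: "('a::real_inner \<Rightarrow>\<^sub>L 'a) \<Rightarrow> ('a \<Rightarrow>\<^sub>L 'a) \<Rightarrow> bool" where
  "selfadjoint_op J A \<longleftrightarrow> clinear_op J A \<and> (\<forall>x y. inner (A x) y = inner x (A y))"

definition cscale :: "('a::real_normed_vector \<Rightarrow>\<^sub>L 'a) \<Rightarrow> complex \<Rightarrow> ('a \<Rightarrow>\<^sub>L 'a) \<Rightarrow> ('a \<Rightarrow>\<^sub>L 'a)" where
  "cscale J c A = Re c *\<^sub>R A + Im c *\<^sub>R (J o\<^sub>L A)"

definition op_invertible :: "('a::real_normed_vector \<Rightarrow>\<^sub>L 'a) \<Rightarrow> bool" where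
  "op_invertible A \<longleftrightarrow> (\<exists>B. A o\<^sub>L B = id_blinfun \<and> B o\<^sub>L A = id_blinfun)"

definition cspec :: "('a::real_normed_vector \<Rightarrow>\<^sub>L 'a) \<Rightarrow> ('a \<Rightarrow>\<^sub>L 'a) \<Rightarrow> complex set" where
  "cspec J A = {z. \<not> op_invertible (A - cscale J z id_blinfun)}"

definition op_pow :: "('a::real_normed_vector \<Rightarrow>\<^sub>L 'a) \<Rightarrow> nat \<Rightarrow> ('a \<Rightarrow>\<^sub>L 'a)" where
  "op_pow A n = (((o\<^sub>L) A) ^^ n) id_blinfun"

definition op_poly :: "real poly \<Rightarrow> ('a::real_normed_vector \<Rightarrow>\<^sub>L 'a) \<Rightarrow> ('a \<Rightarrow>\<^sub>L 'a)" where
  "op_poly p A = (\<Sum>i\<le>degree p. coeff p i *\<^sub>R op_pow A i)"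

definition op_exp :: "('a::real_normed_vector \<Rightarrow>\<^sub>L 'a) \<Rightarrow> ('a \<Rightarrow>\<^sub>L 'a)" where
  "op_exp A = (\<Sum>n. (1 / fact n) *\<^sub>R op_pow A n)"

definition evol :: "('a::real_normed_vector \<Rightarrow>\<^sub>L 'a) \<Rightarrow> ('a \<Rightarrow>\<^sub>L 'a) \<Rightarrow> real \<Rightarrow> ('a \<Rightarrow>\<^sub>L 'a)" where
  "evol J A t = op_exp ((- t) *\<^sub>R (J o\<^sub>L A))"

text \<open>Spectral projection chi_S(A) of a self-adjoint A, via the continuous functional
  calculus: the norm limit of p_n(A) for any real polynomials p_n converging uniformly
  on the spectrum to the indicator of S (which is continuous on the spectrum when S is
  a union of separated components).\<close>
definition spectral_projection ::
  "('a::real_inner \<Rightarrow>\<^sub>L 'a) \<Rightarrow> ('a \<Rightarrow>\<^sub>L 'a) \<Rightarrow> complex set \<Rightarrow> ('a \<Rightarrow>\<^sub>L 'a) \<Rightarrow> bool" where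
  "spectral_projection J A S P \<longleftrightarrow>
     (\<forall>p :: nat \<Rightarrow> real poly.
        ((\<lambda>n. SUP z\<in>cspec J A. \<bar>poly (p n) (Re z) - indicator S z\<bar>) \<longlonglongrightarrow> 0)
        \<longrightarrow> ((\<lambda>n. op_poly (p n) A) \<longlonglongrightarrow> P))"

fun omega_term :: "('a::real_normed_vector \<Rightarrow>\<^sub>L 'a) \<Rightarrow> ('a \<Rightarrow>\<^sub>L 'a) \<Rightarrow> ('a \<Rightarrow>\<^sub>L 'a)
    \<Rightarrow> (real \<Rightarrow> complex) \<Rightarrow> ('a \<Rightarrow>\<^sub>L 'a) \<Rightarrow> nat \<Rightarrow> ('a \<Rightarrow>\<^sub>L 'a)" where
  "omega_term J H0 V f P 0 = P"
| "omega_term J H0 V f P (Suc j) =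
     integral UNIV (\<lambda>t::real. cscale J (f t)
        (evol J H0 t o\<^sub>L (id_blinfun - P)
          o\<^sub>L (- (V o\<^sub>L omega_term J H0 V f P j)
               + (\<Sum>i\<in>{1..j}. omega_term J H0 V f P i o\<^sub>L V o\<^sub>L omega_term J H0 V f P (j - i)))
          o\<^sub>L P o\<^sub>L evol J H0 (- t)))"

end

theory Submission
  imports Defs
begin

text \<open>
Write \<open>T\<^sub>f Z = \<integral> f(t) e\<^bsup>-itH\<^sub>0\<^esup> Z e\<^bsup>itH\<^sub>0\<^esup> dt\<close>. If \<open>Z\<close> maps the spectral subspace of one part of the
spectrum of \<open>H\<^sub>0\<close> into that of another part at distance at least \<open>\<eta>\<close>, then \<open>X = T\<^sub>f Z\<close> solves
\<open>[H\<^sub>0, X] = Z\<close>: approximate \<open>e\<^bsup>-itH\<^sub>0\<^esup>\<close> on each part by \<open>\<Sum>\<^sub>a e\<^bsup>-ity\<^sub>a\<^esup> \<phi>\<^sub>a(H\<^sub>0)\<close> with Bernstein polynomials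
\<open>\<phi>\<^sub>a\<close> and points \<open>y\<^sub>a\<close> of that part; the integral then only sees values \<open>1/(y\<^sub>a - z\<^sub>b)\<close> of the Fourier
transform. The off-diagonal solution is unique, so it does not depend on \<open>f\<close>, and
\<open>\<parallel>X\<parallel> \<le> (\<pi> / 2\<eta>) \<parallel>Z\<parallel>\<close> follows from the extremal kernel
\<open>g(t) = (i/2) sin t \<integral>\<^sub>0\<^sup>\<infinity> e\<^bsup>-x|t|\<^esup> tanh(\<pi>x/2) dx\<close>, rescaled to gap \<open>\<eta>\<close>, whose \<open>L\<^sup>1\<close> norm is \<open>\<pi>/2\<close>.

Summed over the blocks, the order-\<open>j\<close> terms are off-diagonal parts of operators; since pinching is
a contraction, their norms satisfy the Catalan recursion with parameter \<open>y = \<pi>\<parallel>V\<parallel>/(\<gamma>\<eta>)\<close>. Hence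
\<open>\<parallel>\<Omega> - 1\<parallel> \<le> (1 - r) / (1 + r)\<close> with \<open>r = \<surd>(1 - 4y)\<close>. The commutator equations sum up to
\<open>H \<Omega> = \<Omega> H\<^sub>B\<close>, and
\<open>e\<^bsup>-itH\<^esup> - \<Omega>\<^sup>-\<^sup>1 e\<^bsup>-itH\<^esup> \<Omega> = \<Omega>\<^sup>-\<^sup>1 [\<Omega> - 1, e\<^bsup>-itH\<^esup>]\<close> has norm at most
\<open>2 (1 - r)/(1 + r) \<cdot> (1 + r)/(2r) = 1/r - 1\<close>.
\<close>

text \<open>Two obstacles shape the proof. The L1 norm of the given \<open>f\<close> can be
  arbitrarily large, so no estimate may go through it; uniqueness of off-diagonal solutions of the
  commutator equation is what allows another kernel to take its place. And bounds for the single
  \<Omega>_k cannot simply be added, since that would cost a factor depending on m; hence the terms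
  of each order are summed over k before norms are taken. In the constant, the gap contributes pi /
  (2 \<eta>), passing to the off-diagonal part (identity minus pinching) contributes 2, and the
  Catalan series converges for 4 y < 1: together 4 pi. The spectrum of \<open>H0\<close> enters only
  through estimates of polynomials in \<open>H0\<close>. They are extracted from the defining
  property of the spectral projections, and no spectral measure occurs. The norm of the kernel is
  computable because the integral of |sin t| exp(-x t) over the half-line is coth(pi x / 2) / (1 +
  x^2): the weight tanh cancels the coth, and 1 / (1 + x^2) integrates to pi / 2.\<close>

section \<open>An algebra containing the bounded operators\<close>

text \<open>The class of unital normed algebras requires \<open>1\<close> to have norm \<open>1\<close>, which fails for the operators on
  the zero space; the additional summand \<open>\<complex>\<close> repairs this. A new type is needed in any case, because
  the sort \<open>{real_inner, complete_space}\<close> does not make the type of bounded operators an instance of \<open>banach\<close>.\<close>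

typedef (overloaded) ('a::real_normed_vector) bop = "UNIV :: (complex \<times> ('a \<Rightarrow>\<^sub>L 'a)) set"
  by simp

definition Bop :: "complex \<Rightarrow> ('a::real_normed_vector \<Rightarrow>\<^sub>L 'a) \<Rightarrow> 'a bop"
  where "Bop z B = Abs_bop (z, B)"

definition scal :: "'a::real_normed_vector bop \<Rightarrow> complex"
  where "scal x = fst (Rep_bop x)"

definition oper :: "'a::real_normed_vector bop \<Rightarrow> 'a \<Rightarrow>\<^sub>L 'a"
  where "oper x = snd (Rep_bop x)"

lemma Bop_sel [simp]: "scal (Bop z B) = z" "oper (Bop z B) = B"
  by (simp_all add: Bop_def scal_def oper_def Abs_bop_inverse)

lemma bop_eq_iff: "x = y \<longleftrightarrow> scal x = scal y \<and> oper x = oper y"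
  by (simp add: scal_def oper_def prod_eq_iff[symmetric] Rep_bop_inject)

instantiation bop :: (real_normed_vector) real_normed_algebra_1
begin

definition "0 = Bop 0 0"
definition "1 = Bop 1 id_blinfun"
definition "x + y = Bop (scal x + scal y) (oper x + oper y)"
definition "- x = Bop (- scal x) (- oper x)"
definition "x - y = Bop (scal x - scal y) (oper x - oper y)" for x y :: "'a bop"
definition "x * y = Bop (scal x * scal y) (oper x o\<^sub>L oper y)"
definition "r *\<^sub>R x = Bop (r *\<^sub>R scal x) (r *\<^sub>R oper x)"
text \<open>The max norm is that of a direct sum of algebras: products are bounded factorwise,
  \<open>1\<close> keeps norm 1 on the zero space through its scalar part, and a bound on an element
  restricts to its operator part.\<close>

definition "norm x = max (norm (scal x)) (norm (oper x))"
definition "sgn x = scaleR (inverse (norm x)) x" for x :: "'a bop"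
definition "dist x y = norm (x - y)" for x y :: "'a bop"
definition [code del]: "(uniformity :: ('a bop \<times> 'a bop) filter) =
  (INF e\<in>{0<..}. principal {(x, y). dist x y < e})"
definition [code del]: "open (U :: 'a bop set) \<longleftrightarrow>
  (\<forall>x\<in>U. eventually (\<lambda>(x', y). x' = x \<longrightarrow> y \<in> U) uniformity)"

lemmas bop_ops_defs = zero_bop_def one_bop_def plus_bop_def uminus_bop_def minus_bop_def
  times_bop_def scaleR_bop_def

instance
proof
  fix x y z :: "'a bop" and a b :: real
  show "x + y + z = x + (y + z)" "x + y = y + x" "0 + x = x" "- x + x = 0" "x - y = x + - y"
    "a *\<^sub>R (x + y) = a *\<^sub>R x + a *\<^sub>R y" "(a + b) *\<^sub>R x = a *\<^sub>R x + b *\<^sub>R x"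
    "a *\<^sub>R b *\<^sub>R x = (a * b) *\<^sub>R x" "1 *\<^sub>R x = x"
    by (simp_all add: bop_eq_iff bop_ops_defs algebra_simps)
  show "x * y * z = x * (y * z)"
    by (simp add: bop_eq_iff bop_ops_defs blinfun_eqI)
  show "1 * x = x" "x * 1 = x"
    by (simp_all add: bop_eq_iff bop_ops_defs blinfun_eqI)
  show "(x + y) * z = x * z + y * z" "x * (y + z) = x * y + x * z"
    "a *\<^sub>R x * y = a *\<^sub>R (x * y)" "x * a *\<^sub>R y = a *\<^sub>R (x * y)"
    by (simp_all add: bop_eq_iff bop_ops_defs algebra_simps bounded_bilinear.add_left[OF bounded_bilinear_blinfun_compose]
        bounded_bilinear.add_right[OF bounded_bilinear_blinfun_compose]
        bounded_bilinear.scaleR_left[OF bounded_bilinear_blinfun_compose]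
        bounded_bilinear.scaleR_right[OF bounded_bilinear_blinfun_compose])
  show "(0::'a bop) \<noteq> 1"
    by (simp add: bop_eq_iff bop_ops_defs)
  show "sgn x = scaleR (inverse (norm x)) x" "dist x y = norm (x - y)"
    "(uniformity :: ('a bop \<times> 'a bop) filter) = (INF e\<in>{0<..}. principal {(x, y). dist x y < e})"
    by (simp_all add: sgn_bop_def dist_bop_def uniformity_bop_def)
  show "open U \<longleftrightarrow> (\<forall>x\<in>U. eventually (\<lambda>(x', y). x' = x \<longrightarrow> y \<in> U) uniformity)" for U :: "'a bop set"
    by (simp add: open_bop_def)
  show "norm x = 0 \<longleftrightarrow> x = 0"
    by (auto simp: bop_eq_iff norm_bop_def zero_bop_def max_def split: if_splits)
  show "norm (x + y) \<le> norm x + norm y"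
    unfolding norm_bop_def plus_bop_def Bop_sel
    by (smt (verit) norm_triangle_ineq)
  show "norm (a *\<^sub>R x) = \<bar>a\<bar> * norm x"
    by (simp add: norm_bop_def scaleR_bop_def max_mult_distrib_left)
  have "norm (oper x o\<^sub>L oper y) \<le> norm (oper x) * norm (oper y)"
    by (rule norm_blinfun_compose)
  also have "\<dots> \<le> norm x * norm y"
    by (intro mult_mono) (auto simp: norm_bop_def max.coboundedI1)
  finally have 1: "norm (oper x o\<^sub>L oper y) \<le> norm x * norm y" .
  have "norm (scal x) * norm (scal y) \<le> norm x * norm y"
    by (intro mult_mono) (auto simp: norm_bop_def max.coboundedI1)
  with 1 show "norm (x * y) \<le> norm x * norm y"
    unfolding norm_bop_def[of "x * y"] by (simp add: times_bop_def norm_mult)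
  have "norm (id_blinfun :: 'a \<Rightarrow>\<^sub>L 'a) \<le> 1"
    by (rule norm_blinfun_bound) simp_all
  then show "norm (1::'a bop) = 1"
    by (simp add: norm_bop_def one_bop_def)
qed

end

lemma scal_simps [simp]:
  "scal 0 = 0" "scal 1 = 1" "scal (x + y) = scal x + scal y" "scal (- x) = - scal x"
  "scal (x - y) = scal x - scal y" "scal (x * y) = scal x * scal y"
  "scal (r *\<^sub>R x) = r *\<^sub>R scal x"
  by (simp_all add: bop_eq_iff bop_ops_defs blinfun_eqI)

lemma oper_simps [simp]:
  "oper 0 = 0" "oper 1 = id_blinfun" "oper (x + y) = oper x + oper y" "oper (- x) = - oper x"
  "oper (x - y) = oper x - oper y" "oper (x * y) = oper x o\<^sub>L oper y"
  "oper (r *\<^sub>R x) = r *\<^sub>R oper x"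
  by (simp_all add: bop_eq_iff bop_ops_defs blinfun_eqI)

lemma norm_scal_le: "norm (scal x) \<le> norm x" and norm_oper_le: "norm (oper x) \<le> norm x"
  by (simp_all add: norm_bop_def)

lemma bounded_linear_scal: "bounded_linear scal"
  by (rule bounded_linear_intro[where K = 1]) (simp_all add: norm_scal_le)

lemma bounded_linear_oper: "bounded_linear oper"
  by (rule bounded_linear_intro[where K = 1]) (simp_all add: norm_oper_le)

lemma scal_power [simp]: "scal (x ^ n) = scal x ^ n"
  by (induction n) simp_all

lemma oper_power [simp]: "oper (x ^ n) = op_pow (oper x) n"
  by (induction n) (simp_all add: op_pow_def)

section \<open>Completeness of the operator space\<close>

text \<open>Pointwise limits exist by completeness of the codomain, a bound on the norms of the
  sequence bounds the limit, and the Cauchy estimate passes to the limit uniformly on the unit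
  ball.\<close>

lemma Cauchy_blinfun_convergent:
  fixes X :: "nat \<Rightarrow> 'a::real_normed_vector \<Rightarrow>\<^sub>L 'b::{real_normed_vector, complete_space}"
  assumes "Cauchy X"
  shows "convergent X"
proof -
  have diff: "norm (X m x - X n x) \<le> norm (X m - X n) * norm x" for m n x
    by (metis norm_blinfun minus_blinfun.rep_eq)
  have "Cauchy (\<lambda>n. X n x)" for x
  proof (rule CauchyI)
    fix e :: real assume "e > 0"
    \<comment> \<open>The summand 1 avoids a division by zero at \<open>x = 0\<close>.\<close>
    then have "e / (norm x + 1) > 0"
      by (simp add: add_nonneg_pos)
    then obtain M where M: "\<And>m n. m \<ge> M \<Longrightarrow> n \<ge> M \<Longrightarrow> norm (X m - X n) < e / (norm x + 1)"
      using CauchyD[OF assms] by blast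
    show "\<exists>M. \<forall>m\<ge>M. \<forall>n\<ge>M. norm (X m x - X n x) < e"
    proof (intro exI allI impI)
      fix m n assume "m \<ge> M" "n \<ge> M"
      have "norm (X m x - X n x) \<le> norm (X m - X n) * (norm x + 1)"
        using diff[of m x n] by (simp add: distrib_left add_increasing2)
      also have "\<dots> < e"
        using M[OF \<open>m \<ge> M\<close> \<open>n \<ge> M\<close>] by (simp add: pos_less_divide_eq add_nonneg_pos)
      finally show "norm (X m x - X n x) < e" .
    qed
  qed
  then have "convergent (\<lambda>n. X n x)" for x
    by (simp add: Cauchy_convergent_iff)
  then obtain L where L: "\<And>x. (\<lambda>n. X n x) \<longlonglongrightarrow> L x"
    unfolding convergent_def by metis
  obtain K where K: "\<And>n. norm (X n) \<le> K"
    using Cauchy_Bseq[OF assms] unfolding Bseq_def by blast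
  have "bounded_linear L"
  proof (rule bounded_linear_intro[where K = K])
    show "L (x + y) = L x + L y" for x y
      using LIMSEQ_unique[OF L[of "x + y"]] tendsto_add[OF L[of x] L[of y]]
      by (simp add: blinfun.add_right)
    show "L (r *\<^sub>R x) = r *\<^sub>R L x" for r x
      using LIMSEQ_unique[OF L[of "r *\<^sub>R x"]] tendsto_scaleR[OF tendsto_const L[of x], of r]
      by (simp add: blinfun.scaleR_right)
    show "norm (L x) \<le> norm x * K" for x
    proof (rule LIMSEQ_le_const2[OF tendsto_norm[OF L]], intro exI allI impI)
      fix n show "norm (X n x) \<le> norm x * K"
        by (metis K mult.commute mult_right_mono norm_blinfun norm_ge_zero order_trans)
    qed
  qed
  then have app: "blinfun_apply (Blinfun L) = L"
    by (rule bounded_linear_Blinfun_apply)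
  have "X \<longlonglongrightarrow> Blinfun L"
  proof (rule LIMSEQ_I)
    fix e :: real assume "e > 0"
    then obtain M where M: "\<And>m n. m \<ge> M \<Longrightarrow> n \<ge> M \<Longrightarrow> norm (X m - X n) < e / 2"
      using CauchyD[OF assms, of "e / 2"] by auto
    have "norm (X n - Blinfun L) \<le> e / 2" if "n \<ge> M" for n
    proof (rule norm_blinfun_bound)
      show "0 \<le> e / 2" using \<open>e > 0\<close> by simp
      fix x
      have "(\<lambda>m. norm (X n x - X m x)) \<longlonglongrightarrow> norm (X n x - L x)"
        by (intro tendsto_intros L)
      then have "norm (X n x - L x) \<le> e / 2 * norm x"
      proof (rule LIMSEQ_le_const2, intro exI allI impI)
        fix m assume "m \<ge> M"
        then show "norm (X n x - X m x) \<le> e / 2 * norm x"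
          using diff[of n x m] M[OF that \<open>m \<ge> M\<close>]
          by (meson less_imp_le mult_right_mono norm_ge_zero order_trans)
      qed
      then show "norm ((X n - Blinfun L) x) \<le> e / 2 * norm x"
        by (simp add: minus_blinfun.rep_eq app)
    qed
    then show "\<exists>no. \<forall>n\<ge>no. norm (X n - Blinfun L) < e"
      using \<open>e > 0\<close> by (intro exI[of _ M]) force
  qed
  then show ?thesis
    by (auto simp: convergent_def)
qed

instance bop :: ("{real_inner, complete_space}") banach
proof
  fix X :: "nat \<Rightarrow> 'a bop"
  assume "Cauchy X"
  then have "Cauchy (\<lambda>n. scal (X n))" "Cauchy (\<lambda>n. oper (X n))"
    by (simp_all add: bounded_linear.Cauchy bounded_linear_scal bounded_linear_oper)
  then obtain a B where a: "(\<lambda>n. scal (X n)) \<longlonglongrightarrow> a" and B: "(\<lambda>n. oper (X n)) \<longlonglongrightarrow> B"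
    using Cauchy_convergent Cauchy_blinfun_convergent unfolding convergent_def by metis
  have "(\<lambda>n. norm (X n - Bop a B)) \<longlonglongrightarrow> max (norm (a - a)) (norm (B - B))"
    unfolding norm_bop_def scal_simps oper_simps Bop_sel by (intro tendsto_intros a B)
  then have "X \<longlonglongrightarrow> Bop a B"
    by (simp add: tendsto_norm_zero_iff LIM_zero_iff)
  then show "convergent X"
    by (auto simp: convergent_def)
qed

lemma scal_exp: "scal (exp x) = exp (scal x)" for x :: "'a::{real_inner, complete_space} bop"
  unfolding exp_def bounded_linear.suminf[OF bounded_linear_scal summable_exp_generic] by simp

text \<open>Connects the series \<open>op_exp\<close> of the definitions with the class constant
  \<open>exp\<close>, whose differentiation rules then apply to the evolution.\<close>

lemma oper_exp: "oper (exp x) = op_exp (oper x)" for x :: "'a::{real_inner, complete_space} bop"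
  unfolding exp_def op_exp_def bounded_linear.suminf[OF bounded_linear_oper summable_exp_generic]
  by (simp add: inverse_eq_divide)

section \<open>The extremal kernel\<close>

text \<open>Euler's sine product at the imaginary argument i x: the squares change sign, and both
  sides carry a factor i.\<close>

lemma sinh_product_formula:
  assumes "(x::real) \<noteq> 0"
  shows "(\<lambda>n. \<Prod>k=1..n. 1 + x\<^sup>2 / (real k)\<^sup>2) \<longlonglongrightarrow> sinh (pi * x) / (pi * x)"
proof -
  have eq: "of_real pi * (\<i> * of_real x) * (\<Prod>k=1..n. 1 - (\<i> * of_real x)^2 / of_nat k^2) =
      \<i> * complex_of_real (pi * x * (\<Prod>k=1..n. 1 + x\<^sup>2 / (real k)\<^sup>2))" for n
    by (simp add: power_mult_distrib mult_ac)
  have "sin (of_real pi * (\<i> * of_real x)) = \<i> * complex_of_real (sinh (pi * x))"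
    by (simp add: sin_exp_eq sinh_def exp_of_real[symmetric] field_simps)
  then have "(\<lambda>n. \<i> * complex_of_real (pi * x * (\<Prod>k=1..n. 1 + x\<^sup>2 / (real k)\<^sup>2)))
      \<longlonglongrightarrow> \<i> * complex_of_real (sinh (pi * x))"
    using sin_product_formula_complex[of "\<i> * of_real x"] unfolding eq by (simp only:)
  \<comment> \<open>Multiplying by -i removes the common factor and leaves a statement about real
    numbers.\<close>
  from tendsto_mult[OF tendsto_const[of "- \<i>"] this]
  have "(\<lambda>n. complex_of_real (pi * x * (\<Prod>k=1..n. 1 + x\<^sup>2 / (real k)\<^sup>2)))
      \<longlonglongrightarrow> complex_of_real (sinh (pi * x))"
    by (simp flip: mult.assoc)
  then have "(\<lambda>n. pi * x * (\<Prod>k=1..n. 1 + x\<^sup>2 / (real k)\<^sup>2)) \<longlonglongrightarrow> sinh (pi * x)"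
    by (simp only: tendsto_of_real_iff)
  from tendsto_divide[OF this tendsto_const[of "pi * x"]] assms show ?thesis
    by simp
qed

text \<open>From sinh(2u) = 2 sinh(u) cosh(u) with u = pi x / 2: among the first 2n factors for
  sinh(pi x), those of even index are the factors for sinh(pi x / 2), and the quotient leaves the
  odd ones.\<close>

lemma cosh_product_formula:
  assumes "(x::real) > 0"
  shows "(\<lambda>n. \<Prod>k<n. 1 + x\<^sup>2 / (2 * real k + 1)\<^sup>2) \<longlonglongrightarrow> cosh (pi * x / 2)"
proof -
  have split: "(\<Prod>k=1..2*n. 1 + x\<^sup>2 / (real k)\<^sup>2) =
      (\<Prod>k<n. 1 + x\<^sup>2 / (2 * real k + 1)\<^sup>2) * (\<Prod>k=1..n. 1 + (x/2)\<^sup>2 / (real k)\<^sup>2)" for n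
  proof (induction n)
    case (Suc n)
    have "x\<^sup>2 / (2 + 2 * real n)\<^sup>2 = (x/2)\<^sup>2 / (1 + real n)\<^sup>2"
      by (simp add: power_divide power2_eq_square field_simps)
    with Suc show ?case
      by (simp add: add_ac mult_ac)
  qed simp
  have pos: "(\<Prod>k=1..n. 1 + (x/2)\<^sup>2 / (real k)\<^sup>2) > 0" for n
    by (intro prod_pos) (simp add: add_pos_nonneg)
  have "(\<lambda>n. (\<Prod>k=1..2*n. 1 + x\<^sup>2 / (real k)\<^sup>2) / (\<Prod>k=1..n. 1 + (x/2)\<^sup>2 / (real k)\<^sup>2))
      \<longlonglongrightarrow> (sinh (pi * x) / (pi * x)) / (sinh (pi * (x/2)) / (pi * (x/2)))"
  proof (intro tendsto_divide sinh_product_formula)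
    show "(\<lambda>n. \<Prod>k=1..2*n. 1 + x\<^sup>2 / (real k)\<^sup>2) \<longlonglongrightarrow> sinh (pi * x) / (pi * x)"
      using assms LIMSEQ_subseq_LIMSEQ[OF sinh_product_formula[of x], of "(*) 2"]
      by (simp add: strict_mono_def o_def)
  qed (use assms in auto)
  moreover have "(\<Prod>k=1..2*n. 1 + x\<^sup>2 / (real k)\<^sup>2) / (\<Prod>k=1..n. 1 + (x/2)\<^sup>2 / (real k)\<^sup>2) =
      (\<Prod>k<n. 1 + x\<^sup>2 / (2 * real k + 1)\<^sup>2)" for n
    unfolding split by (rule nonzero_mult_div_cancel_right[OF less_imp_neq[OF pos, symmetric]])
  moreover have "(sinh (pi * x) / (pi * x)) / (sinh (pi * (x/2)) / (pi * (x/2))) = cosh (pi * x / 2)"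
    using assms sinh_double[of "pi * x / 2"] by (simp add: field_simps)
  ultimately show ?thesis
    by simp
qed

text \<open>Termwise this is the logarithmic derivative of the product for cosh. For an inequality
  of partial sums no infinite product has to be differentiated: cosh divided by its first n factors
  is a limit of products of increasing factors, so its logarithm \<open>L\<close> is monotone, and
  the claim says that its derivative is nonnegative.\<close>

lemma tanh_partial_fraction_le:
  assumes "(x::real) > 0"
  shows "(\<Sum>k<n. 2 * x / (x\<^sup>2 + (2 * real k + 1)\<^sup>2)) \<le> pi / 2 * tanh (pi * x / 2)"
proof -
  define c where "c n y = (\<Prod>k<n. 1 + y\<^sup>2 / (2 * real k + 1)\<^sup>2)" for n and y :: real
  define L where "L y = ln (cosh (pi * y / 2)) - (\<Sum>k<n. ln (1 + y\<^sup>2 / (2 * real k + 1)\<^sup>2))" for y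
  have fac_pos: "1 + y\<^sup>2 / (2 * real k + 1)\<^sup>2 > 0" for k and y :: real
    by (simp add: add_pos_nonneg)
  have c_pos: "c n y > 0" for n y
    unfolding c_def by (intro prod_pos) (simp add: fac_pos)
  have L_eq: "L y = ln (cosh (pi * y / 2) / c n y)" for y
  proof -
    have "ln (c n y) = (\<Sum>k<n. ln (1 + y\<^sup>2 / (2 * real k + 1)\<^sup>2))"
      unfolding c_def by (rule ln_prod) (use fac_pos in \<open>auto simp: less_imp_neq[symmetric]\<close>)
    then show ?thesis
      using c_pos[of n y] by (simp add: L_def ln_div)
  qed
  \<comment> \<open>The factors from n to M increase with a nonnegative argument. The comparison is
    stated without division, so that M can tend to infinity on both sides.\<close>
  have ratio: "c M y * c n z \<le> c M z * c n y" if "0 \<le> y" "y \<le> z" "n \<le> M" for M y z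
  proof -
    have "c M w = c n w * (\<Prod>k=n..<M. 1 + w\<^sup>2 / (2 * real k + 1)\<^sup>2)" for w
      unfolding c_def lessThan_atLeast0 by (subst prod.atLeastLessThan_concat) (use that in auto)
    moreover have "(\<Prod>k=n..<M. 1 + y\<^sup>2 / (2 * real k + 1)\<^sup>2) \<le> (\<Prod>k=n..<M. 1 + z\<^sup>2 / (2 * real k + 1)\<^sup>2)"
      using that by (intro prod_mono conjI add_left_mono divide_right_mono power_mono) (auto intro: less_imp_le[OF fac_pos])
    ultimately show ?thesis
      using c_pos[of n y] c_pos[of n z] by (simp add: mult_ac mult_left_mono)
  qed
  have mono: "L y \<le> L z" if "0 < y" "y \<le> z" for y z
  proof -
    have "cosh (pi * y / 2) * c n z \<le> cosh (pi * z / 2) * c n y"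
    proof (rule LIMSEQ_le)
      show "(\<lambda>M. c M y * c n z) \<longlonglongrightarrow> cosh (pi * y / 2) * c n z"
        unfolding c_def[of _ y] using that by (intro tendsto_mult_right cosh_product_formula)
      show "(\<lambda>M. c M z * c n y) \<longlonglongrightarrow> cosh (pi * z / 2) * c n y"
        unfolding c_def[of _ z] using that by (intro tendsto_mult_right cosh_product_formula) auto
    qed (use ratio[of y z] that in auto)
    then have "cosh (pi * y / 2) / c n y \<le> cosh (pi * z / 2) / c n z"
      using c_pos[of n y] c_pos[of n z] by (simp add: field_simps)
    then show ?thesis
      unfolding L_eq using c_pos[of n y] c_pos[of n z] by (subst ln_le_cancel_iff) auto
  qed
  have "mono_on {0<..} L"
    using mono by (intro mono_onI) auto
  moreover have "(L has_real_derivative (pi / 2 * tanh (pi * x / 2)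
      - (\<Sum>k<n. 2 * x / (x\<^sup>2 + (2 * real k + 1)\<^sup>2)))) (at x)"
  proof -
    have "2 * x / (2 * real k + 1)\<^sup>2 / (1 + x\<^sup>2 / (2 * real k + 1)\<^sup>2) = 2 * x / (x\<^sup>2 + (2 * real k + 1)\<^sup>2)" for k
    proof -
      have "(2 * real k + 1)\<^sup>2 > 0" by (simp add: add_nonneg_pos)
      moreover from this have "x\<^sup>2 + (2 * real k + 1)\<^sup>2 > 0" by (simp add: add_nonneg_pos)
      ultimately show ?thesis by (simp add: field_simps)
    qed
    note eq = this
    have ln': "((\<lambda>y. ln (1 + y\<^sup>2 / c)) has_real_derivative 2 * x / c / (1 + x\<^sup>2 / c)) (at x)"
      if "c > 0" for c
    proof -
      have "((\<lambda>y. 1 + y\<^sup>2 / c) has_real_derivative 2 * x / c) (at x)"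
        using that by (auto intro!: derivative_eq_intros)
      moreover have "1 + x\<^sup>2 / c > 0"
        using that by (simp add: add_pos_nonneg)
      ultimately have "((\<lambda>y. ln (1 + y\<^sup>2 / c)) has_real_derivative 1 / (1 + x\<^sup>2 / c) * (2 * x / c)) (at x)"
        by (intro DERIV_chain2[OF DERIV_ln_divide])
      then show ?thesis by (simp add: mult.commute)
    qed
    have "((\<lambda>y. \<Sum>k<n. ln (1 + y\<^sup>2 / (2 * real k + 1)\<^sup>2)) has_real_derivative
        (\<Sum>k<n. 2 * x / (x\<^sup>2 + (2 * real k + 1)\<^sup>2))) (at x)"
      unfolding eq[symmetric] by (intro DERIV_sum ln') (simp add: add_nonneg_pos)
    moreover have "((\<lambda>y. ln (cosh (pi * y / 2))) has_real_derivative pi / 2 * tanh (pi * x / 2)) (at x)"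
      by (auto intro!: derivative_eq_intros simp: tanh_def mult_ac)
    ultimately show ?thesis
      unfolding L_def[abs_def] by (rule DERIV_diff[rotated])
  qed
  ultimately have "pi / 2 * tanh (pi * x / 2) - (\<Sum>k<n. 2 * x / (x\<^sup>2 + (2 * real k + 1)\<^sup>2)) \<ge> 0"
    by (rule mono_on_imp_deriv_nonneg) (use assms in \<open>simp add: interior_open\<close>)
  then show ?thesis by simp
qed

section \<open>Integrals over the half-line and the line\<close>

lemma FTC_halfline_nonneg:
  fixes f F :: "real \<Rightarrow> real"
  assumes "\<And>t. t > 0 \<Longrightarrow> (F has_real_derivative f t) (at t)" "\<And>t. t > 0 \<Longrightarrow> isCont f t"
    and "\<And>t. t > 0 \<Longrightarrow> 0 \<le> f t" "(F \<longlongrightarrow> A) (at_right 0)" "(F \<longlongrightarrow> B) at_top"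
  shows "set_integrable lborel {0<..} f" "(LINT t:{0<..}|lborel. f t) = B - A"
proof -
  have ein: "einterval (ereal 0) \<infinity> = {0<..}"
    by (auto simp: einterval_def)
  have lim: "((F \<circ> real_of_ereal) \<longlongrightarrow> A) (at_right (ereal 0))"
    "((F \<circ> real_of_ereal) \<longlongrightarrow> B) (at_left \<infinity>)"
    using assms by (simp_all add: ereal_tendsto_simps)
  show "set_integrable lborel {0<..} f"
    using interval_integral_FTC_nonneg(1)[OF _ _ _ _ lim, of f] assms by (simp add: ein)
  show "(LINT t:{0<..}|lborel. f t) = B - A"
    using interval_integral_FTC_nonneg(2)[OF _ _ _ _ lim, of f] assms
    by (simp add: interval_lebesgue_integral_def ein)
qed

lemma FTC_halfline_integrable:
  fixes f F :: "real \<Rightarrow> 'b::euclidean_space"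
  assumes "\<And>t. t > 0 \<Longrightarrow> (F has_vector_derivative f t) (at t)" "\<And>t. t > 0 \<Longrightarrow> isCont f t"
    and "set_integrable lborel {0<..} f" "(F \<longlongrightarrow> A) (at_right 0)" "(F \<longlongrightarrow> B) at_top"
  shows "(LINT t:{0<..}|lborel. f t) = B - A"
proof -
  have ein: "einterval (ereal 0) \<infinity> = {0<..}"
    by (auto simp: einterval_def)
  have lim: "((F \<circ> real_of_ereal) \<longlongrightarrow> A) (at_right (ereal 0))"
    "((F \<circ> real_of_ereal) \<longlongrightarrow> B) (at_left \<infinity>)"
    using assms by (simp_all add: ereal_tendsto_simps)
  show ?thesis
    using interval_integral_FTC_integrable[OF _ _ _ _ lim, of f] assms
    by (simp add: interval_lebesgue_integral_def ein)
qed

lemma integral_line_halfline: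
  fixes f :: "real \<Rightarrow> 'b::euclidean_space"
  assumes "set_integrable lborel {0<..} f" "set_integrable lborel {0<..} (\<lambda>t. f (- t))"
    and [measurable]: "f \<in> borel_measurable borel"
  shows "integrable lborel f"
    and "(LINT t|lborel. f t) = (LINT t:{0<..}|lborel. f t) + (LINT t:{0<..}|lborel. f (- t))"
proof -
  let ?g = "\<lambda>t. indicator {0<..} t *\<^sub>R f t" and ?h = "\<lambda>t. indicator {0<..} t *\<^sub>R f (- t)"
  have g: "integrable lborel ?g" and h: "integrable lborel ?h"
    using assms by (simp_all add: set_integrable_def)
  have h': "integrable lborel (\<lambda>t. ?h (- t))"
    using lborel_integrable_real_affine[OF h, of "-1" 0] by simp
  have ih: "(LINT t|lborel. ?h (- t)) = (LINT t|lborel. ?h t)"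
    using lborel_integral_real_affine[of "-1" ?h 0] by simp
  \<comment> \<open>The point 0 lies in neither half-line, so the two pieces add up to
    \<open>f\<close> only almost everywhere.\<close>
  have "AE t in lborel. t \<noteq> (0::real)"
    by (rule AE_lborel_singleton)
  then have ae: "AE t in lborel. ?g t + ?h (- t) = f t"
    by eventually_elim (auto simp: indicator_def)
  show "integrable lborel f"
    by (rule integrable_cong_AE_imp[OF Bochner_Integration.integrable_add[OF g h'] _ ae]) simp
  have "(LINT t|lborel. f t) = (LINT t|lborel. ?g t + ?h (- t))"
    by (rule integral_cong_AE) (use ae in \<open>auto elim: eventually_mono\<close>)
  then show "(LINT t|lborel. f t) = (LINT t:{0<..}|lborel. f t) + (LINT t:{0<..}|lborel. f (- t))"
    using g h' ih by (simp add: set_lebesgue_integral_def)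
qed

lemma exp_mult_neg_tendsto_0: "x > 0 \<Longrightarrow> ((\<lambda>t::real. exp (- x * t)) \<longlongrightarrow> 0) at_top"
  by (rule filterlim_compose[OF exp_at_bot], rule filterlim_tendsto_neg_mult_at_bot[OF tendsto_const])
    (auto intro: filterlim_ident)

lemma set_integrable_exp_halfline: "x > 0 \<Longrightarrow> set_integrable lborel {0<..} (\<lambda>t::real. exp (- x * t))"
proof (rule FTC_halfline_nonneg(1)[where F = "\<lambda>t. - exp (- x * t) / x" and A = "- 1 / x" and B = 0])
  assume x: "x > 0"
  show "((\<lambda>t. - exp (- x * t) / x) \<longlongrightarrow> 0) at_top"
    using tendsto_divide[OF tendsto_minus[OF exp_mult_neg_tendsto_0[OF x]] tendsto_const[of x]] x by simp
qed (auto intro!: derivative_eq_intros tendsto_eq_intros)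

lemma laplace_exp:
  fixes z :: complex
  assumes "Re z > 0"
  shows "set_integrable lborel {0<..} (\<lambda>t. exp (- z * of_real t))"
    and "(LINT t:{0<..}|lborel. exp (- z * of_real t)) = 1 / z"
proof -
  show int: "set_integrable lborel {0<..} (\<lambda>t. exp (- z * of_real t))"
  proof -
    have "integrable lborel (\<lambda>t. indicator {0<..} t *\<^sub>R exp (- z * complex_of_real t))"
    proof (rule Bochner_Integration.integrable_bound)
      show "integrable lborel (\<lambda>t. indicator {0<..} t *\<^sub>R exp (- Re z * t))"
        using set_integrable_exp_halfline[OF assms] by (simp add: set_integrable_def)
    qed (auto simp: indicator_def norm_exp_eq_Re)
    then show ?thesis by (simp add: set_integrable_def)
  qed
  have z: "z \<noteq> 0" using assms by auto
  have "(LINT t:{0<..}|lborel. exp (- z * of_real t)) = 0 - (- 1 / z)"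
  proof (rule FTC_halfline_integrable[where F = "\<lambda>t. - exp (- z * of_real t) / z"])
    show "((\<lambda>t. - exp (- z * of_real t) / z) has_vector_derivative exp (- z * of_real t)) (at t)" for t
      using z by (auto intro!: derivative_eq_intros has_vector_derivative_real_field)
    have "((\<lambda>t. norm (- exp (- z * complex_of_real t) / z)) \<longlongrightarrow> 0) at_top"
    proof -
      have "((\<lambda>t. exp (- Re z * t) / norm z) \<longlongrightarrow> 0 / norm z) at_top"
        using assms z by (intro tendsto_divide exp_mult_neg_tendsto_0 tendsto_const) auto
      then show ?thesis by (simp add: norm_divide norm_exp_eq_Re)
    qed
    then show "((\<lambda>t. - exp (- z * of_real t) / z) \<longlongrightarrow> 0) at_top"
      by (rule tendsto_norm_zero_cancel)
  qed (use int z in \<open>auto intro!: tendsto_eq_intros continuous_intros\<close>)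
  then show "(LINT t:{0<..}|lborel. exp (- z * of_real t)) = 1 / z" by simp
qed

text \<open>Each half-line is a Laplace integral, so the value is 1/(x + ia) + 1/(x - ia).\<close>

lemma fourier_exp_abs:
  fixes x a :: real
  assumes "x > 0"
  shows "integrable lborel (\<lambda>t. exp (- x * \<bar>t\<bar>) * exp (- \<i> * of_real (a * t)) :: complex)"
    and "(LINT t|lborel. exp (- x * \<bar>t\<bar>) * exp (- \<i> * of_real (a * t))) =
      complex_of_real (2 * x / (x\<^sup>2 + a\<^sup>2))"
proof -
  let ?f = "\<lambda>t. exp (- x * \<bar>t\<bar>) * exp (- \<i> * of_real (a * t)) :: complex"
  have c: "?f t = exp (- (Complex x a) * of_real t)" "?f (- t) = exp (- (Complex x (- a)) * of_real t)"
    if "t > 0" for t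
  proof -
    have "- of_real (x * t) + - \<i> * of_real (a * t) = - (Complex x a) * of_real t"
      "- of_real (x * t) + - \<i> * of_real (a * (- t)) = - (Complex x (- a)) * of_real t"
      by (simp_all add: complex_eq_iff)
    from this[symmetric, THEN arg_cong[of _ _ exp]] that
    show "?f t = exp (- (Complex x a) * of_real t)" "?f (- t) = exp (- (Complex x (- a)) * of_real t)"
      by (simp_all only: exp_add) (simp_all add: exp_of_real[symmetric])
  qed
  have ReC: "Re (Complex x a) > 0" "Re (Complex x (- a)) > 0"
    using assms by simp_all
  have int: "set_integrable lborel {0<..} ?f" "set_integrable lborel {0<..} (\<lambda>t. ?f (- t))"
    using laplace_exp(1)[OF ReC(1)] laplace_exp(1)[OF ReC(2)]
    by (auto intro: set_integrable_cong[OF refl refl, THEN iffD2] simp only: c greaterThan_iff)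
  have val: "(LINT t:{0<..}|lborel. ?f t) = 1 / Complex x a"
    unfolding laplace_exp(2)[OF ReC(1), symmetric]
    by (rule set_lebesgue_integral_cong) (simp, intro allI impI c, simp)
  have val': "(LINT t:{0<..}|lborel. ?f (- t)) = 1 / Complex x (- a)"
    unfolding laplace_exp(2)[OF ReC(2), symmetric]
    by (rule set_lebesgue_integral_cong) (simp, intro allI impI c, simp)
  show "integrable lborel ?f"
    by (rule integral_line_halfline(1)[OF int]) simp
  have "(LINT t|lborel. ?f t) = 1 / Complex x a + 1 / Complex x (- a)"
    unfolding val[symmetric] val'[symmetric] by (rule integral_line_halfline(2)[OF int]) simp
  also have "\<dots> = complex_of_real (2 * x / (x\<^sup>2 + a\<^sup>2))"
  proof -
    have "x\<^sup>2 + a\<^sup>2 \<noteq> 0" using assms by simp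
    then show ?thesis
      by (simp add: complex_eq_iff Re_divide Im_divide add_divide_distrib[symmetric])
        (simp add: power2_eq_square[of "x\<^sup>2 + a\<^sup>2"])
  qed
  finally show "(LINT t|lborel. ?f t) = complex_of_real (2 * x / (x\<^sup>2 + a\<^sup>2))" .
qed

text \<open>The function |sin| has period pi, so a shift by pi gives I = (integral over one period)
  + exp(-pi x) I. Solving for I produces coth(pi x / 2) / (1 + x^2).\<close>

lemma integral_abs_sin_exp_halfline:
  assumes "(x::real) > 0"
  shows "set_integrable lborel {0<..} (\<lambda>t. \<bar>sin t\<bar> * exp (- x * t))"
    and "tanh (pi * x / 2) * (LINT t:{0<..}|lborel. \<bar>sin t\<bar> * exp (- x * t)) = 1 / (1 + x\<^sup>2)"
proof -
  define g where "g t = \<bar>sin t\<bar> * exp (- x * t)" for t :: real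
  have [measurable]: "g \<in> borel_measurable borel"
    unfolding g_def by measurable
  have int: "set_integrable lborel {0<..} g"
    unfolding g_def
  proof (rule set_integrable_bound[OF set_integrable_exp_halfline[OF assms]])
    show "set_borel_measurable lborel {0<..} (\<lambda>t. \<bar>sin t\<bar> * exp (- x * t))"
      unfolding set_borel_measurable_def by measurable
  qed (auto simp: abs_mult mult_le_cancel_right1)
  define I where "I = (LINT t:{0<..}|lborel. g t)"
  let ?F = "\<lambda>t. - exp (- x * t) * (x * sin t + cos t) / (1 + x\<^sup>2)"
  have pos: "1 + x\<^sup>2 > 0" by (simp add: add_pos_nonneg)
  have FTC: "(LBINT t=ereal 0..ereal pi. exp (- x * t) * sin t) = ?F pi - ?F 0"
  proof (rule interval_integral_FTC_nonneg(2))
    show "(?F has_real_derivative exp (- x * t) * sin t) (at t)" for t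
    proof -
      have "(?F has_real_derivative (x * exp (- x * t) * (x * sin t + cos t)
          - exp (- x * t) * (x * cos t - sin t)) / (1 + x\<^sup>2)) (at t)"
        by (rule DERIV_cdivide) (auto intro!: derivative_eq_intros simp: algebra_simps)
      also have "(x * exp (- x * t) * (x * sin t + cos t) - exp (- x * t) * (x * cos t - sin t)) / (1 + x\<^sup>2)
          = exp (- x * t) * sin t * (1 + x\<^sup>2) / (1 + x\<^sup>2)"
        by (simp add: algebra_simps power2_eq_square)
      finally show ?thesis using pos by simp
    qed
    show "((?F \<circ> real_of_ereal) \<longlongrightarrow> ?F 0) (at_right (ereal 0))"
      unfolding ereal_tendsto_simps using pos by (auto intro!: tendsto_eq_intros)
    show "((?F \<circ> real_of_ereal) \<longlongrightarrow> ?F pi) (at_left (ereal pi))"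
      unfolding ereal_tendsto_simps using pos by (auto intro!: tendsto_eq_intros)
  qed (auto simp: sin_ge_zero)
  have period: "(LINT t:{0<..<pi}|lborel. g t) = (1 + exp (- pi * x)) / (1 + x\<^sup>2)"
  proof -
    have "(LINT t:{0<..<pi}|lborel. g t) = (LINT t:{0<..<pi}|lborel. exp (- x * t) * sin t)"
      unfolding g_def set_lebesgue_integral_def
      by (intro Bochner_Integration.integral_cong) (auto simp: indicator_def abs_of_pos sin_gt_zero)
    also have "\<dots> = ?F pi - ?F 0"
      using FTC by (simp add: interval_lebesgue_integral_def einterval_def greaterThanLessThan_def
          greaterThan_def lessThan_def Collect_conj_eq)
    also have "\<dots> = (1 + exp (- pi * x)) / (1 + x\<^sup>2)"
      by (simp add: mult.commute add_divide_distrib)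
    finally show ?thesis .
  qed
  have shift: "(LINT t:{pi<..}|lborel. g t) = exp (- pi * x) * I"
  proof -
    have "(LINT t:{pi<..}|lborel. g t) = (LINT t|lborel. indicator {pi<..} (pi + t) *\<^sub>R g (pi + t))"
      unfolding set_lebesgue_integral_def
      using lborel_integral_real_affine[of 1 "\<lambda>t. indicator {pi<..} t *\<^sub>R g t" pi] by simp
    also have "\<dots> = (LINT t|lborel. exp (- pi * x) * (indicator {0<..} t *\<^sub>R g t))"
      by (intro Bochner_Integration.integral_cong)
        (auto simp: indicator_def g_def exp_add[symmetric] algebra_simps)
    finally show ?thesis
      by (simp add: I_def set_lebesgue_integral_def)
  qed
  have "I = (LINT t:{0<..<pi}|lborel. g t) + (LINT t:{pi<..}|lborel. g t)"
  proof -
    have "indicator {0<..} t *\<^sub>R g t = indicator {0<..<pi} t *\<^sub>R g t + indicator {pi<..} t *\<^sub>R g t" for t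
      using pi_gt_zero by (auto simp: indicator_def g_def not_less order_le_less simp del: pi_gt_zero)
    moreover have "set_integrable lborel {0<..<pi} g" "set_integrable lborel {pi<..} g"
      by (rule set_integrable_subset[OF int]; use pi_gt_zero in \<open>auto simp del: pi_gt_zero\<close>)+
    ultimately show ?thesis
      by (simp add: I_def set_lebesgue_integral_def set_integrable_def)
  qed
  then have "I * (1 - exp (- pi * x)) = (1 + exp (- pi * x)) / (1 + x\<^sup>2)"
    by (simp add: period shift algebra_simps)
  then have "tanh (pi * x / 2) * I = 1 / (1 + x\<^sup>2)"
    using pos add_pos_pos[OF zero_less_one exp_gt_zero, of "- (pi * x)"]
    by (simp add: tanh_real_altdef divide_simps mult_ac)
  then show "tanh (pi * x / 2) * (LINT t:{0<..}|lborel. \<bar>sin t\<bar> * exp (- x * t)) = 1 / (1 + x\<^sup>2)"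
    by (simp add: I_def g_def)
  show "set_integrable lborel {0<..} (\<lambda>t. \<bar>sin t\<bar> * exp (- x * t))"
    using int by (simp add: g_def[abs_def])
qed

text \<open>Partial fractions reduce the integrand to the derivatives b^2 / (x^2 + b^2) of b
  arctan(x / b) for b = a and b = c; at a = c the poles coincide and another antiderivative is
  required.\<close>

lemma integral_square_over_quadratics:
  fixes a c :: real
  assumes "a \<ge> 0" "c > 0"
  shows "set_integrable lborel {0<..} (\<lambda>x. x\<^sup>2 / ((x\<^sup>2 + c\<^sup>2) * (x\<^sup>2 + a\<^sup>2)))"
    and "(LINT x:{0<..}|lborel. x\<^sup>2 / ((x\<^sup>2 + c\<^sup>2) * (x\<^sup>2 + a\<^sup>2))) = pi / 2 / (a + c)"
proof -
  let ?f = "\<lambda>x::real. x\<^sup>2 / ((x\<^sup>2 + c\<^sup>2) * (x\<^sup>2 + a\<^sup>2))"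
  have arctan': "((\<lambda>x. b * arctan (x / b)) has_real_derivative b\<^sup>2 / (x\<^sup>2 + b\<^sup>2)) (at x)" if "x > 0" for b x :: real
  proof (cases "b = 0")
    case False
    have "((\<lambda>x. b * arctan (x / b)) has_real_derivative b * (1 / b * inverse (1 + (x / b)\<^sup>2))) (at x)"
      using False by (auto intro!: derivative_eq_intros)
    also have "b * (1 / b * inverse (1 + (x / b)\<^sup>2)) = b\<^sup>2 / (x\<^sup>2 + b\<^sup>2)"
      using False that by (simp add: divide_simps power2_eq_square add_pos_nonneg)
    finally show ?thesis .
  qed simp
  have arctan_top: "((\<lambda>x. b * arctan (x / b)) \<longlongrightarrow> b * (pi / 2)) at_top" if "b \<ge> 0" for b :: real
  proof (cases "b = 0")
    case False
    with that show ?thesis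
      by (intro tendsto_mult_left filterlim_compose[OF tendsto_arctan_at_top]
          filterlim_tendsto_pos_mult_at_top[OF tendsto_const, of "1 / b", simplified]) (auto intro: filterlim_ident)
  qed simp
  have arctan_0: "((\<lambda>x. b * arctan (x / b)) \<longlongrightarrow> 0) (at_right 0)" for b :: real
    by (cases "b = 0") (auto intro!: tendsto_eq_intros)
  obtain F where F: "\<And>x. x > 0 \<Longrightarrow> (F has_real_derivative ?f x) (at x)"
    "(F \<longlongrightarrow> 0) (at_right 0)" "(F \<longlongrightarrow> pi / 2 / (a + c)) at_top"
  proof (cases "a = c")
    case True
    \<comment> \<open>Integration by parts, with x as one factor and x / (x^2 + c^2)^2 as the
      other.\<close>
    define F where "F x = 1 / (2 * c\<^sup>2) * (c * arctan (x / c)) - 1 / 2 * (x / (x\<^sup>2 + c\<^sup>2))" for x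
    have "(F has_real_derivative ?f x) (at x)" if "x > 0" for x
    proof -
      have pos: "x\<^sup>2 + c\<^sup>2 > 0" using that by (simp add: add_pos_nonneg)
      have "((\<lambda>x. x / (x\<^sup>2 + c\<^sup>2)) has_real_derivative (c\<^sup>2 - x\<^sup>2) / (x\<^sup>2 + c\<^sup>2)\<^sup>2) (at x)"
        using pos by (auto intro!: derivative_eq_intros simp: power2_eq_square algebra_simps)
      from DERIV_diff[OF DERIV_cmult[OF arctan'[OF that, of c], of "1 / (2 * c\<^sup>2)"] DERIV_cmult[OF this, of "1/2"]]
      have "(F has_real_derivative (1 / (2 * c\<^sup>2) * (c\<^sup>2 / (x\<^sup>2 + c\<^sup>2))
          - 1 / 2 * ((c\<^sup>2 - x\<^sup>2) / (x\<^sup>2 + c\<^sup>2)\<^sup>2))) (at x)"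
        by (simp add: F_def[abs_def])
      also have "1 / (2 * c\<^sup>2) * (c\<^sup>2 / (x\<^sup>2 + c\<^sup>2)) - 1 / 2 * ((c\<^sup>2 - x\<^sup>2) / (x\<^sup>2 + c\<^sup>2)\<^sup>2)
          = ((x\<^sup>2 + c\<^sup>2) - (c\<^sup>2 - x\<^sup>2)) / (2 * (x\<^sup>2 + c\<^sup>2)\<^sup>2)"
        using assms pos by (simp add: divide_simps) (simp add: power2_eq_square algebra_simps)
      also have "\<dots> = ?f x"
        using True by (simp add: power2_eq_square)
      finally show ?thesis .
    qed
    moreover have "(F \<longlongrightarrow> 1 / (2 * c\<^sup>2) * 0 - 1 / 2 * (0 / (0\<^sup>2 + c\<^sup>2))) (at_right 0)"
      unfolding F_def using assms by (intro tendsto_intros arctan_0) auto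
    moreover have "(F \<longlongrightarrow> 1 / (2 * c\<^sup>2) * (c * (pi / 2)) - 1 / 2 * 0) at_top"
    proof -
      have "((\<lambda>x. x / (x\<^sup>2 + c\<^sup>2)) \<longlongrightarrow> 0) at_top"
      proof (rule tendsto_sandwich[OF _ _ tendsto_const])
        show "((\<lambda>x::real. 1 / x) \<longlongrightarrow> 0) at_top"
          using tendsto_inverse_0_at_top[OF filterlim_ident] by (simp add: inverse_eq_divide)
        show "\<forall>\<^sub>F x in at_top. x / (x\<^sup>2 + c\<^sup>2) \<le> 1 / x"
          using eventually_gt_at_top[of 0]
          by eventually_elim (simp add: divide_simps power2_eq_square add_pos_nonneg)
        show "\<forall>\<^sub>F x in at_top. 0 \<le> x / (x\<^sup>2 + c\<^sup>2)"
          using eventually_gt_at_top[of 0] by eventually_elim simp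
      qed
      then show ?thesis
        unfolding F_def using assms by (intro tendsto_diff tendsto_mult_left arctan_top) auto
    qed
    moreover have "1 / (2 * c\<^sup>2) * (c * (pi / 2)) - 1 / 2 * 0 = pi / 2 / (a + c)"
      using True assms by (simp add: power2_eq_square)
    ultimately show ?thesis
      using that[of F] by simp
  next
    case False
    define F where "F x = 1 / (c\<^sup>2 - a\<^sup>2) * (c * arctan (x / c) - a * arctan (x / a))" for x
    have ne: "c\<^sup>2 - a\<^sup>2 \<noteq> 0"
      using False assms by simp
    have "(F has_real_derivative ?f x) (at x)" if "x > 0" for x
    proof -
      have pos: "x\<^sup>2 + c\<^sup>2 > 0" "x\<^sup>2 + a\<^sup>2 > 0" using that by (simp_all add: add_pos_nonneg)
      have "(F has_real_derivative 1 / (c\<^sup>2 - a\<^sup>2) * (c\<^sup>2 / (x\<^sup>2 + c\<^sup>2) - a\<^sup>2 / (x\<^sup>2 + a\<^sup>2))) (at x)"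
        unfolding F_def[abs_def] by (intro DERIV_cmult DERIV_diff arctan' that)
      also have "c\<^sup>2 / (x\<^sup>2 + c\<^sup>2) - a\<^sup>2 / (x\<^sup>2 + a\<^sup>2) = (c\<^sup>2 - a\<^sup>2) * ?f x"
        using pos that by (simp add: divide_simps) (simp add: algebra_simps)
      finally show ?thesis using ne by simp
    qed
    moreover have "(F \<longlongrightarrow> 1 / (c\<^sup>2 - a\<^sup>2) * (0 - 0)) (at_right 0)"
      unfolding F_def by (intro tendsto_mult_left tendsto_diff arctan_0)
    moreover have "(F \<longlongrightarrow> 1 / (c\<^sup>2 - a\<^sup>2) * (c * (pi / 2) - a * (pi / 2))) at_top"
      unfolding F_def using assms by (intro tendsto_mult_left tendsto_diff arctan_top) auto
    moreover have "1 / (c\<^sup>2 - a\<^sup>2) * (c * (pi / 2) - a * (pi / 2)) = pi / 2 / (a + c)"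
    proof -
      have "c\<^sup>2 - a\<^sup>2 = (c - a) * (a + c)" "c - a \<noteq> 0" "a + c \<noteq> 0"
        using False assms by (auto simp: power2_eq_square algebra_simps)
      then show ?thesis by (simp add: divide_simps) (simp add: algebra_simps)
    qed
    ultimately show ?thesis
      using that[of F] by simp
  qed
  have pos: "x\<^sup>2 + c\<^sup>2 > 0" "x\<^sup>2 + a\<^sup>2 > 0" if "x > 0" for x :: real
    using that by (simp_all add: add_pos_nonneg)
  have cont: "isCont ?f x" if "x > 0" for x
    using pos[OF that] by (intro continuous_intros) auto
  show "set_integrable lborel {0<..} ?f"
    by (rule FTC_halfline_nonneg(1)[OF F(1) cont _ F(2,3)]) auto
  show "(LINT x:{0<..}|lborel. ?f x) = pi / 2 / (a + c)"
    using FTC_halfline_nonneg(2)[OF F(1) cont _ F(2,3)] by simp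
qed

section \<open>The partial fraction series and the kernel\<close>

text \<open>This is the partial fraction expansion of \<open>tanh (pi * x / 2)\<close>, of which only the inequality
  \<open>\<le>\<close> is needed.\<close>

definition tanh_pf :: "real \<Rightarrow> real"
  where "tanh_pf x = (\<Sum>k. 4 / pi * x / (x\<^sup>2 + (2 * real k + 1)\<^sup>2))"

lemma tanh_pf_measurable [measurable]: "tanh_pf \<in> borel_measurable borel"
  unfolding tanh_pf_def[abs_def] by measurable

lemma summable_tanh_pf: "x > 0 \<Longrightarrow> summable (\<lambda>k. 4 / pi * x / (x\<^sup>2 + (2 * real k + 1)\<^sup>2))"
  and tanh_pf_le: "x > 0 \<Longrightarrow> tanh_pf x \<le> tanh (pi * x / 2)"
  and tanh_pf_nonneg: "x > 0 \<Longrightarrow> 0 \<le> tanh_pf x"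
proof -
  assume x: "x > 0"
  have partial: "(\<Sum>k<n. 4 / pi * x / (x\<^sup>2 + (2 * real k + 1)\<^sup>2)) \<le> tanh (pi * x / 2)" for n
  proof -
    have "(\<Sum>k<n. 4 / pi * x / (x\<^sup>2 + (2 * real k + 1)\<^sup>2)) =
        2 / pi * (\<Sum>k<n. 2 * x / (x\<^sup>2 + (2 * real k + 1)\<^sup>2))"
      by (simp add: sum_distrib_left)
    also have "\<dots> \<le> 2 / pi * (pi / 2 * tanh (pi * x / 2))"
      by (intro mult_left_mono tanh_partial_fraction_le x) simp
    finally show ?thesis by simp
  qed
  have nonneg: "0 \<le> 4 / pi * x / (x\<^sup>2 + (2 * real k + 1)\<^sup>2)" for k
    using x by simp
  show sm: "summable (\<lambda>k. 4 / pi * x / (x\<^sup>2 + (2 * real k + 1)\<^sup>2))"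
    using partial nonneg by (intro summableI_nonneg_bounded) auto
  show "tanh_pf x \<le> tanh (pi * x / 2)"
    unfolding tanh_pf_def by (rule suminf_le_const[OF sm]) (use partial in auto)
  show "0 \<le> tanh_pf x"
    unfolding tanh_pf_def by (rule suminf_nonneg[OF sm nonneg])
qed

text \<open>Integrated term by term, term k contributes 2/(s + 2k) - 2/(s + 2k + 2): the odd numbers
  2k + 1 of the partial fractions, added to s - 1 and s + 1, give neighbouring terms of a
  telescoping sum.\<close>

lemma integral_tanh_pf:
  assumes "s \<ge> 1"
  shows "(LINT x:{0<..}|lborel. tanh_pf x * (x / (x\<^sup>2 + (s - 1)\<^sup>2) - x / (x\<^sup>2 + (s + 1)\<^sup>2))) = 2 / s"
proof -
  define q where "q k x = 4 / pi * (x\<^sup>2 / ((x\<^sup>2 + (2 * real k + 1)\<^sup>2) * (x\<^sup>2 + (s - 1)\<^sup>2))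
    - x\<^sup>2 / ((x\<^sup>2 + (2 * real k + 1)\<^sup>2) * (x\<^sup>2 + (s + 1)\<^sup>2)))" for k x
  define d where "d x = x / (x\<^sup>2 + (s - 1)\<^sup>2) - x / (x\<^sup>2 + (s + 1)\<^sup>2)" for x
  note sq1 = integral_square_over_quadratics[of "s - 1" "2 * real k + 1" for k]
  note sq2 = integral_square_over_quadratics[of "s + 1" "2 * real k + 1" for k]
  have q_eq: "q k x = (4 / pi * x / (x\<^sup>2 + (2 * real k + 1)\<^sup>2)) * d x" for k x
  proof -
    have "4 / pi * (x\<^sup>2 / (C * B) - x\<^sup>2 / (C * B')) = (4 / pi * x / C) * (x / B - x / B')" for B B' C :: real
      by (simp add: right_diff_distrib power2_eq_square mult_ac diff_divide_distrib)
    then show ?thesis unfolding q_def d_def .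
  qed
  have d_nonneg: "0 \<le> d x" if "x > 0" for x
  proof -
    have "x\<^sup>2 + (s - 1)\<^sup>2 \<le> x\<^sup>2 + (s + 1)\<^sup>2"
      using assms by (simp add: power2_eq_square algebra_simps)
    then show ?thesis
      using that by (simp add: d_def divide_left_mono add_pos_nonneg)
  qed
  have q_nonneg: "0 \<le> q k x" if "x > 0" for k x
    unfolding q_eq using d_nonneg[OF that] that by simp
  have q_sums: "(\<lambda>k. q k x) sums (tanh_pf x * d x)" if "x > 0" for x
    unfolding q_eq tanh_pf_def by (intro sums_mult2 summable_sums summable_tanh_pf that)
  have q_int: "set_integrable lborel {0<..} (q k)" for k
    unfolding q_def using assms by (intro set_integrable_mult_right set_integral_diff(1) sq1(1) sq2(1)) auto
  have q_val: "(LINT x:{0<..}|lborel. q k x) = 2 / (s + 2 * real k) - 2 / (s + 2 * real (Suc k))" for k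
  proof -
    have "(LINT x:{0<..}|lborel. q k x) = 4 / pi * (pi / 2 / (s - 1 + (2 * real k + 1)) - pi / 2 / (s + 1 + (2 * real k + 1)))"
      unfolding q_def using assms
      by (subst set_integral_mult_right, subst set_integral_diff(2)) (auto simp: sq1 sq2)
    also have "4 / pi * (pi / 2 / u - pi / 2 / w) = 2 / u - 2 / w" for u w
      by (simp add: right_diff_distrib)
    also have "s - 1 + (2 * real k + 1) = s + 2 * real k"
      by simp
    also have "s + 1 + (2 * real k + 1) = s + 2 * real (Suc k)"
      by simp
    finally show ?thesis .
  qed
  have tele: "(\<lambda>k. 2 / (s + 2 * real k) - 2 / (s + 2 * real (Suc k))) sums (2 / (s + 2 * real 0) - 0)"
  proof (rule telescope_sums')
    have "filterlim (\<lambda>k. s + 2 * real k) at_top sequentially"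
      by (rule filterlim_tendsto_add_at_top[OF tendsto_const],
          rule filterlim_tendsto_pos_mult_at_top[OF tendsto_const])
        (auto intro: filterlim_real_sequentially)
    then show "(\<lambda>k. 2 / (s + 2 * real k)) \<longlonglongrightarrow> 0"
      by (intro tendsto_divide_0[OF tendsto_const] filterlim_at_top_imp_at_infinity)
  qed
  let ?q = "\<lambda>k x. indicator {0<..} x *\<^sub>R q k x"
  \<comment> \<open>The terms are nonnegative, so the convergent telescoping sum of their integrals
    justifies exchanging sum and integral.\<close>
  have "(\<lambda>k. LINT x|lborel. ?q k x) sums (LINT x|lborel. (\<Sum>k. ?q k x))"
  proof (rule sums_integral)
    show "integrable lborel (?q k)" for k
      using q_int[of k] by (simp add: set_integrable_def)
    show "AE x in lborel. summable (\<lambda>k. norm (?q k x))"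
      using q_sums q_nonneg by (auto simp: indicator_def sums_iff)
    have "(LINT x|lborel. norm (?q k x)) = (LINT x|lborel. ?q k x)" for k
      by (rule Bochner_Integration.integral_cong) (auto simp: indicator_def q_nonneg)
    then show "summable (\<lambda>k. LINT x|lborel. norm (?q k x))"
      using tele q_val by (simp add: set_lebesgue_integral_def sums_iff)
  qed
  moreover have "(\<Sum>k. ?q k x) = indicator {0<..} x *\<^sub>R (tanh_pf x * d x)" for x
    using q_sums[of x] by (auto simp: indicator_def sums_iff)
  ultimately have "(\<lambda>k. LINT x|lborel. ?q k x) sums (LINT x:{0<..}|lborel. tanh_pf x * d x)"
    by (simp add: set_lebesgue_integral_def)
  with tele have "(LINT x:{0<..}|lborel. tanh_pf x * d x) = 2 / s"
    using q_val by (simp add: set_lebesgue_integral_def sums_iff)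
  then show ?thesis by (simp add: d_def)
qed

lemma integral_inverse_one_plus_square_halfline:
  "set_integrable lborel {0<..} (\<lambda>x::real. 1 / (1 + x\<^sup>2))"
  "(LINT x:{0<..}|lborel. 1 / (1 + x\<^sup>2)) = pi / 2"
proof -
  have D: "(arctan has_real_derivative 1 / (1 + x\<^sup>2)) (at x)" for x
    using DERIV_arctan[of x] by (simp add: inverse_eq_divide)
  have cont: "isCont (\<lambda>x. 1 / (1 + x\<^sup>2)) x" for x :: real
    using power2_eq_square[of x] by (intro continuous_intros) (simp add: add_nonneg_eq_0_iff)
  have A: "(arctan \<longlongrightarrow> 0) (at_right 0)"
    by (auto intro!: tendsto_eq_intros)
  show "set_integrable lborel {0<..} (\<lambda>x::real. 1 / (1 + x\<^sup>2))"
    by (rule FTC_halfline_nonneg(1)[OF D cont _ A tendsto_arctan_at_top]) simp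
  show "(LINT x:{0<..}|lborel. 1 / (1 + x\<^sup>2)) = pi / 2"
    using FTC_halfline_nonneg(2)[OF D cont _ A tendsto_arctan_at_top] by simp
qed

text \<open>The series \<open>tanh_pf\<close> takes the place of tanh: for the norm its bound by
  tanh suffices, and for the transform it can be integrated term by term. In both computations the
  integrals over x and t are exchanged. The factor i sin(t) / 2 shifts the transform of exp(-x |t|)
  by 1 to either side, and s \<le> -1 is covered because the result is odd in s.\<close>

lemma exists_reciprocal_kernel_unit:
  "\<exists>g::real \<Rightarrow> complex. integrable lborel g \<and> (LINT t|lborel. norm (g t)) \<le> pi / 2 \<and>
    (\<forall>s. \<bar>s\<bar> \<ge> 1 \<longrightarrow> (LINT t|lborel. g t * exp (- \<i> * of_real (s * t))) = 1 / of_real s)"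
proof -
  \<comment> \<open>With the phase inside \<open>G\<close>, one proof of joint integrability covers
    the kernel (s = 0) and its transform at every s, since the phase does not change the
    norm.\<close>
  define G where "G s x t = indicator {0<..} x *\<^sub>R
    (\<i> / 2 * of_real (tanh_pf x * (exp (- x * \<bar>t\<bar>) * sin t)) * exp (- \<i> * of_real (s * t)))"
    for s x t :: real
  define N where "N x = (LINT t|lborel. norm (G 0 x t))" for x
  have G_meas [measurable]: "(\<lambda>(x, t). G s x t) \<in> borel_measurable (lborel \<Otimes>\<^sub>M lborel)" for s
    unfolding G_def by measurable
  have norm_G: "norm (G s x t) = indicator {0<..} x * (tanh_pf x / 2 * (\<bar>sin t\<bar> * exp (- x * \<bar>t\<bar>)))" for s x t
    by (auto simp: G_def indicator_def norm_mult norm_exp_eq_Re tanh_pf_nonneg abs_mult)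
  have sin_exp: "integrable lborel (\<lambda>t. \<bar>sin t\<bar> * exp (- x * \<bar>t\<bar>))"
    "tanh_pf x / 2 * (LINT t|lborel. \<bar>sin t\<bar> * exp (- x * \<bar>t\<bar>)) \<le> 1 / (1 + x\<^sup>2)"
    if x: "x > 0" for x
  proof -
    let ?f = "\<lambda>t. \<bar>sin t\<bar> * exp (- x * \<bar>t\<bar>)"
    let ?I = "LINT t:{0<..}|lborel. \<bar>sin t\<bar> * exp (- x * t)"
    have eq: "?f t = \<bar>sin t\<bar> * exp (- x * t)" "?f (- t) = \<bar>sin t\<bar> * exp (- x * t)" if "t \<in> {0<..}" for t
      using that by simp_all
    have int: "set_integrable lborel {0<..} ?f" "set_integrable lborel {0<..} (\<lambda>t. ?f (- t))"
      using integral_abs_sin_exp_halfline(1)[OF x] eq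
      by (auto intro: set_integrable_cong[OF refl refl, THEN iffD2])
    show "integrable lborel ?f"
      by (rule integral_line_halfline(1)[OF int]) simp
    have "(LINT t:{0<..}|lborel. ?f t) = ?I" "(LINT t:{0<..}|lborel. ?f (- t)) = ?I"
      by (auto intro!: set_lebesgue_integral_cong)
    then have "(LINT t|lborel. ?f t) = 2 * ?I"
      using integral_line_halfline(2)[OF int] by simp
    moreover have "tanh_pf x * ?I \<le> tanh (pi * x / 2) * ?I"
      by (intro mult_right_mono tanh_pf_le x) (auto simp: set_lebesgue_integral_def intro!: integral_nonneg_AE)
    ultimately show "tanh_pf x / 2 * (LINT t|lborel. ?f t) \<le> 1 / (1 + x\<^sup>2)"
      using integral_abs_sin_exp_halfline(2)[OF x] by simp
  qed
  have N_eq: "N x = indicator {0<..} x * (tanh_pf x / 2 * (LINT t|lborel. \<bar>sin t\<bar> * exp (- x * \<bar>t\<bar>)))" for x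
    by (simp add: N_def norm_G)
  have N_bounds: "0 \<le> N x" "N x \<le> indicator {0<..} x *\<^sub>R (1 / (1 + x\<^sup>2))" for x
  proof -
    show "0 \<le> N x" unfolding N_def by (rule integral_nonneg_AE) simp
    show "N x \<le> indicator {0<..} x *\<^sub>R (1 / (1 + x\<^sup>2))"
      using sin_exp(2)[of x] by (auto simp: N_eq indicator_def)
  qed
  have N_int: "integrable lborel N"
  proof (rule Bochner_Integration.integrable_bound)
    show "integrable lborel (\<lambda>x. indicator {0<..} x *\<^sub>R (1 / (1 + x\<^sup>2)) :: real)"
      using integral_inverse_one_plus_square_halfline(1) by (simp only: set_integrable_def)
    show "N \<in> borel_measurable lborel"
      unfolding N_def by measurable
  qed (use N_bounds in \<open>auto simp: abs_of_nonneg intro: order_trans[OF _ abs_ge_self]\<close>)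
  have G_int: "integrable (lborel \<Otimes>\<^sub>M lborel) (\<lambda>(x, t). G s x t)" for s
  proof (rule lborel_pair.Fubini_integrable[OF G_meas])
    have "(LINT t|lborel. norm (case (x, t) of (x, t) \<Rightarrow> G s x t)) = N x" for x
      by (simp add: N_def norm_G)
    then show "integrable lborel (\<lambda>x. LINT t|lborel. norm (case (x, t) of (x, t) \<Rightarrow> G s x t))"
      using N_int by simp
    have "integrable lborel (\<lambda>t. G s x t)" for x
    proof (rule Bochner_Integration.integrable_bound)
      show "integrable lborel (\<lambda>t. indicator {0<..} x * (tanh_pf x / 2 * (\<bar>sin t\<bar> * exp (- x * \<bar>t\<bar>))))"
        using sin_exp(1)[of x] by (cases "x > 0") auto
      show "(\<lambda>t. G s x t) \<in> borel_measurable lborel"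
        unfolding G_def by measurable
    qed (intro AE_I2, simp only: norm_G real_norm_def abs_ge_self)
    then show "AE x in lborel. integrable lborel (\<lambda>t. case (x, t) of (x, t) \<Rightarrow> G s x t)"
      by simp
  qed
  define g where "g t = (LINT x|lborel. G 0 x t)" for t
  have g_int: "integrable lborel g"
    unfolding g_def by (rule lborel_pair.integrable_snd[OF G_int])
  have normG_int: "integrable (lborel \<Otimes>\<^sub>M lborel) (\<lambda>(x, t). norm (G 0 x t))"
    using integrable_norm[OF G_int[of 0]] by (simp add: case_prod_unfold)
  have "(LINT t|lborel. norm (g t)) \<le> (LINT t|lborel. LINT x|lborel. norm (G 0 x t))"
    unfolding g_def
    by (intro integral_mono integrable_norm lborel_pair.integrable_snd[OF G_int]
        lborel_pair.integrable_snd[OF normG_int] integral_norm_bound)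
  also have "\<dots> = (LINT x|lborel. N x)"
    unfolding N_def using lborel_pair.Fubini_integral[OF normG_int] .
  also have "\<dots> \<le> (LINT x|lborel. indicator {0<..} x *\<^sub>R (1 / (1 + x\<^sup>2)))"
    using integral_inverse_one_plus_square_halfline(1) N_bounds(2)
    by (intro integral_mono N_int) (auto simp: set_integrable_def)
  also have "\<dots> = pi / 2"
    using integral_inverse_one_plus_square_halfline(2) by (simp only: set_lebesgue_integral_def)
  finally have g_norm: "(LINT t|lborel. norm (g t)) \<le> pi / 2" .
  define W where "W s = (LINT x:{0<..}|lborel. tanh_pf x * (x / (x\<^sup>2 + (s - 1)\<^sup>2) - x / (x\<^sup>2 + (s + 1)\<^sup>2)))" for s
  have fourier: "(LINT t|lborel. g t * exp (- \<i> * of_real (s * t))) = of_real (W s / 2)" for s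
  proof -
    have "g t * exp (- \<i> * of_real (s * t)) = (LINT x|lborel. G s x t)" for t
      unfolding g_def G_def
      by (subst integral_mult_left_zero[symmetric], rule Bochner_Integration.integral_cong) (auto simp: mult_ac)
    then have "(LINT t|lborel. g t * exp (- \<i> * of_real (s * t))) = (LINT x|lborel. LINT t|lborel. G s x t)"
      using lborel_pair.Fubini_integral[OF G_int[of s]] by simp
    also have "\<dots> = (LINT x|lborel. of_real (indicator {0<..} x *\<^sub>R (tanh_pf x *
        (x / (x\<^sup>2 + (s - 1)\<^sup>2) - x / (x\<^sup>2 + (s + 1)\<^sup>2))) / 2))"
    proof (rule Bochner_Integration.integral_cong[OF refl])
      fix x :: real
      show "(LINT t|lborel. G s x t) = of_real (indicator {0<..} x *\<^sub>R (tanh_pf x *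
        (x / (x\<^sup>2 + (s - 1)\<^sup>2) - x / (x\<^sup>2 + (s + 1)\<^sup>2))) / 2)"
      proof (cases "x > 0")
        case True
        have quarter: "complex_of_real T / 4 * of_real (2 * x / A - 2 * x / B) = of_real (T * (x / A - x / B) / 2)"
          for A B T :: real
        proof -
          have "complex_of_real T / 4 * of_real (2 * x / A - 2 * x / B) = of_real (T / 4 * (2 * x / A - 2 * x / B))"
            by simp
          also have "T / 4 * (2 * x / A - 2 * x / B) = T * (x / A - x / B) / 2"
            by (simp add: right_diff_distrib diff_divide_distrib)
          finally show ?thesis .
        qed
        let ?e = "\<lambda>a t. exp (- x * \<bar>t\<bar>) * exp (- \<i> * of_real (a * t)) :: complex"
        have "G s x t = of_real (tanh_pf x) / 4 * (?e (s - 1) t - ?e (s + 1) t)" for t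
        proof -
          have "\<i> / 2 * of_real (sin t) * exp (- \<i> * of_real (s * t)) =
              1 / 4 * (exp (\<i> * of_real t) * exp (- \<i> * of_real (s * t))
                - exp (- \<i> * of_real t) * exp (- \<i> * of_real (s * t)))"
            by (simp add: sin_of_real[symmetric] sin_exp_eq field_simps)
          also have "\<dots> = 1 / 4 * (exp (- \<i> * of_real ((s - 1) * t)) - exp (- \<i> * of_real ((s + 1) * t)))"
            by (simp add: exp_add[symmetric] algebra_simps)
          finally have *: "\<i> / 2 * of_real (sin t) * exp (- \<i> * of_real (s * t)) = \<dots>" .
          have "G s x t = of_real (tanh_pf x) * of_real (exp (- x * \<bar>t\<bar>)) *
              (\<i> / 2 * of_real (sin t) * exp (- \<i> * of_real (s * t)))"
            using True by (simp add: G_def mult_ac)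
          then show ?thesis
            unfolding * by (simp add: algebra_simps)
        qed
        then have "(LINT t|lborel. G s x t) = of_real (tanh_pf x) / 4 *
            ((LINT t|lborel. ?e (s - 1) t) - (LINT t|lborel. ?e (s + 1) t))"
          by (simp only: integral_mult_right_zero Bochner_Integration.integral_diff[OF fourier_exp_abs(1)[OF True] fourier_exp_abs(1)[OF True]])
        then show ?thesis
          unfolding fourier_exp_abs(2)[OF True] using True
          by (simp only: of_real_diff[symmetric] quarter) simp
      qed (simp add: G_def)
    qed
    also have "\<dots> = of_real (W s / 2)"
      unfolding W_def set_lebesgue_integral_def by (simp only: integral_complex_of_real integral_divide_zero)
    finally show ?thesis .
  qed
  have W_pos: "W s = 2 / s" if "s \<ge> 1" for s
    unfolding W_def using integral_tanh_pf[OF that] .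
  have W_neg: "W s = 2 / s" if "s \<le> -1" for s
  proof -
    have "W s = - W (- s)"
    proof -
      have sq: "(- s - 1)\<^sup>2 = (s + 1)\<^sup>2" "(- s + 1)\<^sup>2 = (s - 1)\<^sup>2"
        by (simp_all add: power2_eq_square algebra_simps)
      show ?thesis
        unfolding W_def set_lebesgue_integral_def Bochner_Integration.integral_minus[symmetric] sq
        by (rule Bochner_Integration.integral_cong) (auto simp: algebra_simps)
    qed
    then show ?thesis using W_pos[of "- s"] that by simp
  qed
  have "W s / 2 = 1 / s" if "\<bar>s\<bar> \<ge> 1" for s
    using that W_pos[of s] W_neg[of s] by linarith
  then have "of_real (W s / 2) = 1 / complex_of_real s" if "\<bar>s\<bar> \<ge> 1" for s
    using that by (simp only: of_real_divide of_real_1)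
  then show ?thesis
    using g_int g_norm fourier by (intro exI[of _ g] conjI allI impI) (simp_all only:)
qed

text \<open>Replacing t by \<eta> t divides the L1 norm by \<eta> and turns the transform into its
  value at s / \<eta> divided by \<eta>, which is again 1/s.\<close>

lemma exists_reciprocal_kernel:
  assumes "\<eta> > (0::real)"
  shows "\<exists>g::real \<Rightarrow> complex. integrable lborel g \<and> (LINT t|lborel. norm (g t)) \<le> pi / (2 * \<eta>) \<and>
    (\<forall>s. \<bar>s\<bar> \<ge> \<eta> \<longrightarrow> (LINT t|lborel. g t * exp (- \<i> * of_real (s * t))) = 1 / of_real s)"
proof -
  obtain g :: "real \<Rightarrow> complex" where g: "integrable lborel g" "(LINT t|lborel. norm (g t)) \<le> pi / 2"
    "\<And>s. \<bar>s\<bar> \<ge> 1 \<Longrightarrow> (LINT t|lborel. g t * exp (- \<i> * of_real (s * t))) = 1 / of_real s"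
    using exists_reciprocal_kernel_unit by blast
  show ?thesis
  proof (intro exI[of _ "\<lambda>t. g (\<eta> * t)"] conjI allI impI)
    show "integrable lborel (\<lambda>t. g (\<eta> * t))"
      using lborel_integrable_real_affine[OF g(1), of \<eta> 0] assms by simp
    have "(LINT t|lborel. norm (g t)) = \<eta> * (LINT t|lborel. norm (g (\<eta> * t)))"
      using lborel_integral_real_affine[of \<eta> "\<lambda>t. norm (g t)" 0] assms by simp
    then show "(LINT t|lborel. norm (g (\<eta> * t))) \<le> pi / (2 * \<eta>)"
      using g(2) assms by (simp add: field_simps)
    fix s assume s: "\<bar>s\<bar> \<ge> \<eta>"
    let ?h = "\<lambda>t. g t * exp (- \<i> * of_real (s / \<eta> * t))"
    have "(LINT t|lborel. ?h t) = \<eta> *\<^sub>R (LINT t|lborel. ?h (\<eta> * t))"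
      using lborel_integral_real_affine[of \<eta> ?h 0] assms by (simp only: abs_of_pos add_0_left)
    moreover have "\<bar>s / \<eta>\<bar> \<ge> 1"
      using s assms by (simp add: abs_divide)
    ultimately have "\<eta> *\<^sub>R (LINT t|lborel. ?h (\<eta> * t)) = 1 / of_real (s / \<eta>)"
      using g(3)[of "s / \<eta>"] by (simp only:)
    then have "\<eta> *\<^sub>R (LINT t|lborel. g (\<eta> * t) * exp (- \<i> * of_real (s * t))) = 1 / of_real (s / \<eta>)"
      using assms by simp
    then show "(LINT t|lborel. g (\<eta> * t) * exp (- \<i> * of_real (s * t))) = 1 / of_real s"
      using assms s by (auto simp: scaleR_conv_of_real field_simps)
  qed
qed

section \<open>Vector-valued Henstock--Kurzweil integrals\<close>

text \<open>Over any tagged division the Riemann sums of \<open>g\<close> and \<open>gs n\<close>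
  differ by at most the Riemann sum of \<open>h n\<close>, so a gauge that serves
  \<open>gs n\<close> and \<open>h n\<close> also controls \<open>g\<close>. The gauge integral is
  the one in the recursion for \<Omega>_k, whose values lie in a space that is in general not second
  countable.\<close>

lemma integrable_cbox_dominated_approx:
  fixes g :: "real \<Rightarrow> 'b::banach" and gs :: "nat \<Rightarrow> real \<Rightarrow> 'b" and h :: "nat \<Rightarrow> real \<Rightarrow> real"
  assumes gs: "\<And>n. gs n integrable_on cbox a b" and h: "\<And>n. h n integrable_on cbox a b"
    and le: "\<And>n t. norm (g t - gs n t) \<le> h n t"
    and lim: "(\<lambda>n. integral (cbox a b) (h n)) \<longlonglongrightarrow> 0"
  shows "g integrable_on cbox a b"
  unfolding integrable_Cauchy
proof (intro allI impI)
  fix e :: real assume e: "e > 0"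
  then have "eventually (\<lambda>n. integral (cbox a b) (h n) < e / 8) sequentially"
    by (intro order_tendstoD(2)[OF lim]) simp
  then obtain n where n: "integral (cbox a b) (h n) < e / 8"
    by (auto simp: eventually_sequentially)
  have "(h n has_integral integral (cbox a b) (h n)) (cbox a b)"
    using h by (rule integrable_integral)
  from has_integral[THEN iffD1, OF this, rule_format, of "e / 8"] e
  obtain \<gamma>1 where \<gamma>1: "gauge \<gamma>1" "\<And>D. D tagged_division_of cbox a b \<Longrightarrow> \<gamma>1 fine D \<Longrightarrow>
      norm ((\<Sum>(x,K)\<in>D. measure lborel K *\<^sub>R h n x) - integral (cbox a b) (h n)) < e / 8"
    by auto
  have "(gs n has_integral integral (cbox a b) (gs n)) (cbox a b)"
    using gs by (rule integrable_integral)
  from has_integral[THEN iffD1, OF this, rule_format, of "e / 8"] e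
  obtain \<gamma>2 where \<gamma>2: "gauge \<gamma>2" "\<And>D. D tagged_division_of cbox a b \<Longrightarrow> \<gamma>2 fine D \<Longrightarrow>
      norm ((\<Sum>(x,K)\<in>D. measure lborel K *\<^sub>R gs n x) - integral (cbox a b) (gs n)) < e / 8"
    by auto
  \<comment> \<open>The Riemann sum of \<open>h n\<close> is below e/4 (its integral plus the gauge
    error), and that of \<open>gs n\<close> is off by less than e/8; two such deviations stay below
    3/4 e.\<close>
  have near: "norm ((\<Sum>(x,K)\<in>D. measure lborel K *\<^sub>R g x) - integral (cbox a b) (gs n)) < 3 / 8 * e"
    if D: "D tagged_division_of cbox a b" "(\<lambda>x. \<gamma>1 x \<inter> \<gamma>2 x) fine D" for D
  proof -
    have fine: "\<gamma>1 fine D" "\<gamma>2 fine D"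
      using D(2) by (auto simp: fine_Int)
    have "norm ((\<Sum>(x,K)\<in>D. measure lborel K *\<^sub>R g x) - (\<Sum>(x,K)\<in>D. measure lborel K *\<^sub>R gs n x))
        = norm (\<Sum>(x,K)\<in>D. measure lborel K *\<^sub>R (g x - gs n x))"
      by (simp add: sum_subtractf[symmetric] case_prod_unfold scaleR_diff_right)
    also have "\<dots> \<le> (\<Sum>(x,K)\<in>D. measure lborel K *\<^sub>R h n x)"
      unfolding case_prod_unfold
      by (intro sum_norm_le) (auto intro!: mult_left_mono le)
    also have "\<dots> < e / 4"
      using \<gamma>1(2)[OF D(1) fine(1)] n unfolding real_norm_def by linarith
    finally show ?thesis
      using \<gamma>2(2)[OF D(1) fine(2)] norm_diff_triangle_less by fastforce
  qed
  show "\<exists>\<gamma>. gauge \<gamma> \<and> (\<forall>D1 D2. D1 tagged_division_of cbox a b \<and> \<gamma> fine D1 \<and>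
      D2 tagged_division_of cbox a b \<and> \<gamma> fine D2 \<longrightarrow>
      norm ((\<Sum>(x,K)\<in>D1. measure lborel K *\<^sub>R g x) - (\<Sum>(x,K)\<in>D2. measure lborel K *\<^sub>R g x)) < e)"
  proof (intro exI[of _ "\<lambda>x. \<gamma>1 x \<inter> \<gamma>2 x"] conjI allI impI)
    show "gauge (\<lambda>x. \<gamma>1 x \<inter> \<gamma>2 x)"
      using \<gamma>1(1) \<gamma>2(1) by (rule gauge_Int)
    fix D1 D2
    assume D: "D1 tagged_division_of cbox a b \<and> (\<lambda>x. \<gamma>1 x \<inter> \<gamma>2 x) fine D1 \<and>
      D2 tagged_division_of cbox a b \<and> (\<lambda>x. \<gamma>1 x \<inter> \<gamma>2 x) fine D2"
    have "norm ((\<Sum>(x,K)\<in>D1. measure lborel K *\<^sub>R g x) - (\<Sum>(x,K)\<in>D2. measure lborel K *\<^sub>R g x)) < 3 / 8 * e + 3 / 8 * e"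
      using near[of D1] near[of D2] D norm_diff_triangle_less norm_minus_commute
      by (metis (no_types, lifting))
    then show "norm ((\<Sum>(x,K)\<in>D1. measure lborel K *\<^sub>R g x) - (\<Sum>(x,K)\<in>D2. measure lborel K *\<^sub>R g x)) < e"
      using e by simp
  qed
qed

text \<open>The integrals \<open>X n\<close> form a Cauchy sequence because X m - X n is bounded by
  the integrals of \<open>h m\<close> and \<open>h n\<close>. Their limit is the integral of
  \<open>g\<close>: over every box the error against \<open>gs n\<close> is at most the integral of
  \<open>h n\<close> over the whole line, uniformly in the box.\<close>

lemma has_integral_UNIV_dominated_approx:
  fixes g :: "real \<Rightarrow> 'b::banach" and gs :: "nat \<Rightarrow> real \<Rightarrow> 'b" and h :: "nat \<Rightarrow> real \<Rightarrow> real"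
  assumes gs: "\<And>n. (gs n has_integral X n) UNIV" and h: "\<And>n. h n integrable_on UNIV"
    and le: "\<And>n t. norm (g t - gs n t) \<le> h n t"
    and lim: "(\<lambda>n. integral UNIV (h n)) \<longlonglongrightarrow> 0"
  shows "g integrable_on UNIV" and "X \<longlonglongrightarrow> integral UNIV g"
proof -
  have h_nonneg: "0 \<le> h n t" for n t
    using le[of t n] norm_ge_zero order_trans by blast
  have gs_cbox: "gs n integrable_on cbox a b" for n a b
    using gs by (meson has_integral_integrable integrable_on_subcbox subset_UNIV)
  have h_cbox: "h n integrable_on cbox a b" for n a b
    using h by (rule integrable_on_subcbox) simp
  have h_cbox_le: "integral (cbox a b) (h n) \<le> integral UNIV (h n)" for n a b
    using h h_cbox h_nonneg by (intro integral_subset_le) auto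
  have lim_cbox: "(\<lambda>n. integral (cbox a b) (h n)) \<longlonglongrightarrow> 0" for a b
  proof (rule tendsto_sandwich[OF _ _ tendsto_const lim])
    show "\<forall>\<^sub>F n in sequentially. 0 \<le> integral (cbox a b) (h n)"
      by (intro always_eventually allI Henstock_Kurzweil_Integration.integral_nonneg h_cbox h_nonneg)
    show "\<forall>\<^sub>F n in sequentially. integral (cbox a b) (h n) \<le> integral UNIV (h n)"
      by (intro always_eventually allI h_cbox_le)
  qed
  have g_cbox: "g integrable_on cbox a b" for a b
    by (rule integrable_cbox_dominated_approx[OF gs_cbox h_cbox le lim_cbox])
  have close: "norm (integral (cbox a b) g - integral (cbox a b) (gs n)) \<le> integral UNIV (h n)" for a b n
  proof -
    have "norm (integral (cbox a b) (\<lambda>t. g t - gs n t)) \<le> integral (cbox a b) (h n)"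
      using g_cbox gs_cbox h_cbox le by (intro Henstock_Kurzweil_Integration.integral_norm_bound_integral integrable_diff) auto
    then show ?thesis
      using h_cbox_le[of a b n] unfolding Henstock_Kurzweil_Integration.integral_diff[OF g_cbox gs_cbox]
      by (rule order_trans)
  qed
  have X_close: "\<exists>B>0. \<forall>a b. ball 0 B \<subseteq> cbox a b \<longrightarrow> norm (integral (cbox a b) (gs n) - X n) < e"
    if "e > 0" for e :: real and n
    using gs[of n] that unfolding has_integral_alt'[of "gs n"] by simp
  have X_diff: "norm (X m - X n) \<le> integral UNIV (h m) + integral UNIV (h n)" for m n
  proof -
    have "((\<lambda>t. gs m t - gs n t) has_integral (X m - X n)) UNIV"
      by (intro has_integral_diff gs)
    moreover have "norm (gs m t - gs n t) \<le> h m t + h n t" for t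
      using le[of t m] le[of t n] norm_triangle_ineq4[of "g t - gs n t" "g t - gs m t"] by simp
    moreover have "(\<lambda>t. h m t + h n t) integrable_on UNIV"
      by (intro integrable_add h)
    ultimately have "norm (X m - X n) \<le> integral UNIV (\<lambda>t. h m t + h n t)"
      by (metis (no_types, lifting) Henstock_Kurzweil_Integration.integral_norm_bound_integral has_integral_iff)
    then show ?thesis
      by (simp add: Henstock_Kurzweil_Integration.integral_add[OF h h])
  qed
  have "Cauchy X"
  proof (rule CauchyI)
    fix e :: real assume "e > 0"
    then obtain M where M: "\<And>n. n \<ge> M \<Longrightarrow> norm (integral UNIV (h n) - 0) < e / 2"
      using LIMSEQ_D[OF lim, of "e / 2"] by auto
    then have "integral UNIV (h n) < e / 2" if "n \<ge> M" for n
      using that by fastforce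
    then show "\<exists>M. \<forall>m\<ge>M. \<forall>n\<ge>M. norm (X m - X n) < e"
      by (intro exI[of _ M] allI impI) (smt (verit, ccfv_threshold) X_diff field_sum_of_halves)
  qed
  then obtain L where L: "X \<longlonglongrightarrow> L"
    using Cauchy_convergent convergent_def by blast
  have "(g has_integral L) UNIV"
    unfolding has_integral_alt'[of g]
  proof (intro conjI allI impI)
    show "(\<lambda>x. if x \<in> UNIV then g x else 0) integrable_on cbox a b" for a b
      using g_cbox by simp
    fix e :: real assume e: "e > 0"
    obtain n where n: "integral UNIV (h n) < e / 3" "norm (X n - L) < e / 3"
    proof -
      have "eventually (\<lambda>n. integral UNIV (h n) < e / 3) sequentially"
        using e by (intro order_tendstoD(2)[OF lim]) simp
      moreover have "eventually (\<lambda>n. norm (X n - L) < e / 3) sequentially"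
        using e L by (intro order_tendstoD(2)[OF tendsto_norm_zero]) (auto simp: LIM_zero)
      ultimately have "eventually (\<lambda>n. integral UNIV (h n) < e / 3 \<and> norm (X n - L) < e / 3) sequentially"
        by (rule eventually_conj)
      then show ?thesis
        using that by (auto simp: eventually_sequentially)
    qed
    obtain B where B: "B > 0" "\<And>a b. ball 0 B \<subseteq> cbox a b \<Longrightarrow> norm (integral (cbox a b) (gs n) - X n) < e / 3"
      using X_close[of "e / 3" n] e by auto
    show "\<exists>B>0. \<forall>a b. ball 0 B \<subseteq> cbox a b \<longrightarrow>
        norm (integral (cbox a b) (\<lambda>x. if x \<in> UNIV then g x else 0) - L) < e"
    proof (intro exI[of _ B] conjI allI impI B(1))
      fix a b :: real assume ab: "ball 0 B \<subseteq> cbox a b"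
      have "norm (integral (cbox a b) g - L) \<le> norm (integral (cbox a b) g - integral (cbox a b) (gs n))
          + norm (integral (cbox a b) (gs n) - X n) + norm (X n - L)"
        by norm
      also have "\<dots> < e"
        using close[of a b n] B(2)[OF ab] n by linarith
      finally show "norm (integral (cbox a b) (\<lambda>x. if x \<in> UNIV then g x else 0) - L) < e"
        by simp
    qed
  qed
  then show "g integrable_on UNIV" "X \<longlonglongrightarrow> integral UNIV g"
    using L by (auto simp: integral_unique has_integral_integrable)
qed

section \<open>Polynomials in an algebra element\<close>

definition alg_poly :: "real poly \<Rightarrow> 'b::real_algebra_1 \<Rightarrow> 'b"
  where "alg_poly p x = (\<Sum>i\<le>degree p. coeff p i *\<^sub>R x ^ i)"

lemma alg_poly_extend: "degree p \<le> n \<Longrightarrow> alg_poly p x = (\<Sum>i\<le>n. coeff p i *\<^sub>R x ^ i)"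
  unfolding alg_poly_def by (rule sum.mono_neutral_left) (auto simp: coeff_eq_0)

lemma alg_poly_0 [simp]: "alg_poly 0 x = 0"
  by (simp add: alg_poly_def)

lemma alg_poly_pCons: "alg_poly (pCons a p) x = a *\<^sub>R 1 + x * alg_poly p x"
proof -
  have "alg_poly (pCons a p) x = (\<Sum>i\<le>Suc (degree p). coeff (pCons a p) i *\<^sub>R x ^ i)"
    by (rule alg_poly_extend) (simp add: degree_pCons_le)
  also have "\<dots> = a *\<^sub>R 1 + (\<Sum>i\<le>degree p. coeff p i *\<^sub>R x ^ Suc i)"
    by (subst sum.atMost_Suc_shift) simp
  finally show ?thesis
    by (simp add: alg_poly_def sum_distrib_left)
qed

lemma alg_poly_add: "alg_poly (p + q) x = alg_poly p x + alg_poly q x"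
proof -
  have "alg_poly r x = (\<Sum>i\<le>max (degree p) (degree q). coeff r i *\<^sub>R x ^ i)" if "r = p \<or> r = q \<or> r = p + q" for r
    using that degree_add_le_max[of p q] by (intro alg_poly_extend) auto
  then show ?thesis
    by (simp add: scaleR_add_left sum.distrib)
qed

lemma alg_poly_smult: "alg_poly (smult c p) x = c *\<^sub>R alg_poly p x"
  by (cases "c = 0") (simp_all add: alg_poly_def scaleR_sum_right)

lemma alg_poly_mult: "alg_poly (p * q) x = alg_poly p x * alg_poly q x"
  by (induction p) (simp_all add: alg_poly_pCons alg_poly_add alg_poly_smult algebra_simps)

lemma alg_poly_1 [simp]: "alg_poly 1 x = 1"
  by (simp add: one_pCons alg_poly_pCons)

lemma alg_poly_sum: "alg_poly (\<Sum>i\<in>I. p i) x = (\<Sum>i\<in>I. alg_poly (p i) x)"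
  by (induction I rule: infinite_finite_induct) (simp_all add: alg_poly_add)

lemma alg_poly_commute: "y * x = x * y \<Longrightarrow> y * alg_poly p x = alg_poly p x * y"
  by (induction p) (simp_all add: alg_poly_pCons algebra_simps, metis mult.assoc)

text \<open>Bernstein polynomials on [-R, R] are nonnegative there, sum to 1 and concentrate at
  their nodes with variance u (1 - u) / n in the rescaled variable. A node need not lie in S, so it
  is replaced by a nearly closest point of S; for x in S this at most doubles the distance to the
  node, up to \<delta>/2.\<close>

lemma exists_approximate_resolution:
  fixes S :: "real set"
  assumes "S \<noteq> {}" "bounded S" "\<delta> > 0"
  shows "\<exists>n y \<phi>. (\<forall>a\<le>n::nat. y a \<in> S) \<and> (\<Sum>a\<le>n. \<phi> a) = (1::real poly) \<and>
    (\<forall>x\<in>S. (\<forall>a\<le>n. 0 \<le> poly (\<phi> a) x) \<and> (\<Sum>a\<le>n. \<bar>x - y a\<bar> * poly (\<phi> a) x) \<le> \<delta>)"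
proof -
  obtain R where R: "R > 0" "\<And>x. x \<in> S \<Longrightarrow> \<bar>x\<bar> \<le> R"
    using assms(2) unfolding bounded_pos by auto
  \<comment> \<open>Chosen so that 4 R \<epsilon> = \<delta>/4.\<close>
  define \<epsilon> where "\<epsilon> = \<delta> / (16 * R)"
  have \<epsilon>: "\<epsilon> > 0" using assms R by (simp add: \<epsilon>_def)
  \<comment> \<open>Makes the variance term 64 R^2 / (\<delta> n) at most \<delta>/4.\<close>
  obtain n :: nat where n: "real n > 256 * R\<^sup>2 / \<delta>\<^sup>2"
    using reals_Archimedean2 by blast
  moreover have "256 * R\<^sup>2 / \<delta>\<^sup>2 > 0" using assms R by simp
  ultimately have n_pos: "real n > 0" by linarith
  define node where "node a = 2 * R * (real a / real n) - R" for a
  \<comment> \<open>S need not be closed, so the distance may not be attained; hence the slack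
    \<delta>/2.\<close>
  have "\<exists>y\<in>S. \<forall>x\<in>S. \<bar>node a - y\<bar> \<le> \<bar>node a - x\<bar> + \<delta> / 2" for a
  proof -
    have "infdist (node a) S < infdist (node a) S + \<delta> / 2"
      using assms by simp
    then obtain y where "y \<in> S" "dist (node a) y < infdist (node a) S + \<delta> / 2"
      using assms(1) unfolding infdist_notempty[OF assms(1)]
      by (subst (asm) cINF_less_iff) (auto intro: bdd_belowI[of _ 0])
    moreover have "infdist (node a) S \<le> \<bar>node a - x\<bar>" if "x \<in> S" for x
      using infdist_le[OF that, of "node a"] by (simp add: dist_real_def)
    ultimately show ?thesis
      by (intro bexI[of _ y]) (force simp: dist_real_def)+
  qed
  then obtain y where y: "\<And>a. y a \<in> S" "\<And>a x. x \<in> S \<Longrightarrow> \<bar>node a - y a\<bar> \<le> \<bar>node a - x\<bar> + \<delta> / 2"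
    by metis
  define l r where "l = [:1/2, 1 / (2 * R):]" and "r = [:1/2, - (1 / (2 * R)):]"
  define \<phi> where "\<phi> a = smult (real (n choose a)) (l ^ a * r ^ (n - a))" for a
  have "(\<Sum>a\<le>n. \<phi> a) = (l + r) ^ n"
    unfolding binomial_ring \<phi>_def
    by (intro sum.cong refl) (simp add: of_nat_poly)
  also have "l + r = 1"
    by (simp add: l_def r_def one_pCons)
  finally have sum1: "(\<Sum>a\<le>n. \<phi> a) = 1" by simp
  have "(\<Sum>a\<le>n. \<bar>x - y a\<bar> * poly (\<phi> a) x) \<le> \<delta> \<and> (\<forall>a\<le>n. 0 \<le> poly (\<phi> a) x)" if x: "x \<in> S" for x
  proof -
    define u where "u = (x + R) / (2 * R)"
    have u: "0 \<le> u" "u \<le> 1" "x = 2 * R * u - R"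
      using R(2)[OF x] R(1) by (auto simp: u_def field_simps)
    have \<phi>: "poly (\<phi> a) x = Bernstein n a u" for a
    proof -
      have "poly l x = u" "poly r x = 1 - u"
        using R(1) by (simp_all add: l_def r_def u_def field_simps)
      then show ?thesis by (simp add: \<phi>_def Bernstein_def poly_power)
    qed
    have variance: "(\<Sum>a\<le>n. (u - real a / real n)\<^sup>2 * Bernstein n a u) = u * (1 - u) / real n"
    proof -
      have "(\<Sum>a\<le>n. (u - real a / real n)\<^sup>2 * Bernstein n a u) =
          (\<Sum>a\<le>n. u\<^sup>2 * Bernstein n a u + (1 - 2 * n * u) / n\<^sup>2 * (real a * Bernstein n a u)
            + 1 / n\<^sup>2 * (real a * (real a - 1) * Bernstein n a u))"
        using n_pos by (intro sum.cong refl) (simp add: power2_eq_square field_simps)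
      also have "\<dots> = u\<^sup>2 * (\<Sum>a\<le>n. Bernstein n a u) + (1 - 2 * n * u) / n\<^sup>2 * (\<Sum>a\<le>n. real a * Bernstein n a u)
            + 1 / n\<^sup>2 * (\<Sum>a\<le>n. real a * (real a - 1) * Bernstein n a u)"
        by (simp only: sum.distrib sum_distrib_left)
      also have "\<dots> = u\<^sup>2 + (1 - 2 * n * u) / n\<^sup>2 * (n * u) + 1 / n\<^sup>2 * (n * (real n - 1) * u\<^sup>2)"
        by simp
      also have "\<dots> = u * (1 - u) / real n"
        using n_pos by (simp add: power2_eq_square field_simps)
      finally show ?thesis .
    qed
    \<comment> \<open>Trades the mean absolute deviation for the variance, which has a closed
      form.\<close>
    have amgm: "v \<le> \<epsilon> + v\<^sup>2 / \<epsilon>" for v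
    proof (cases "v \<le> \<epsilon>")
      case False
      then have "v * \<epsilon> \<le> v\<^sup>2" using \<epsilon> by (simp add: power2_eq_square)
      then show ?thesis using \<epsilon> by (simp add: field_simps add_increasing)
    qed (use \<epsilon> in \<open>simp add: add_increasing2\<close>)
    have point: "\<bar>x - y a\<bar> \<le> 3 / 4 * \<delta> + 4 * R / \<epsilon> * (u - real a / real n)\<^sup>2" for a
    proof -
      have "x - node a = 2 * R * (u - real a / real n)"
        by (simp add: u(3) node_def algebra_simps)
      then have "\<bar>x - node a\<bar> = 2 * R * \<bar>u - real a / real n\<bar>"
        using R(1) by (simp add: abs_mult)
      moreover have "\<bar>x - y a\<bar> \<le> 2 * \<bar>x - node a\<bar> + \<delta> / 2"
        using y(2)[OF x, of a] abs_triangle_ineq[of "x - node a" "node a - y a"]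
        by (simp add: abs_minus_commute)
      ultimately have "\<bar>x - y a\<bar> \<le> 4 * R * \<bar>u - real a / real n\<bar> + \<delta> / 2"
        by simp
      also have "4 * R * \<bar>u - real a / real n\<bar> \<le> 4 * R * (\<epsilon> + \<bar>u - real a / real n\<bar>\<^sup>2 / \<epsilon>)"
        using R(1) by (intro mult_left_mono amgm) simp
      also have "\<dots> = \<delta> / 4 + 4 * R / \<epsilon> * (u - real a / real n)\<^sup>2"
        using R(1) by (simp add: distrib_left \<epsilon>_def)
      finally show ?thesis by simp
    qed
    have "(\<Sum>a\<le>n. \<bar>x - y a\<bar> * poly (\<phi> a) x)
        \<le> (\<Sum>a\<le>n. (3 / 4 * \<delta> + 4 * R / \<epsilon> * (u - real a / real n)\<^sup>2) * Bernstein n a u)"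
      unfolding \<phi> by (intro sum_mono mult_right_mono point Bernstein_nonneg u)
    also have "\<dots> = 3 / 4 * \<delta> * (\<Sum>a\<le>n. Bernstein n a u)
        + 4 * R / \<epsilon> * (\<Sum>a\<le>n. (u - real a / real n)\<^sup>2 * Bernstein n a u)"
      by (simp only: distrib_right sum.distrib sum_distrib_left mult.assoc)
    also have "\<dots> = 3 / 4 * \<delta> + 4 * R / \<epsilon> * (u * (1 - u) / real n)"
      unfolding variance by simp
    also have "4 * R / \<epsilon> * (u * (1 - u) / real n) \<le> 4 * R / \<epsilon> * (1 / real n)"
      using R(1) \<epsilon> u n_pos by (intro mult_left_mono divide_right_mono mult_le_one) auto
    also have "\<dots> = 64 * R\<^sup>2 / (\<delta> * real n)"
      using R(1) by (simp add: \<epsilon>_def power2_eq_square)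
    also have "\<dots> \<le> \<delta> / 4"
      using n n_pos assms(3) by (simp add: field_simps power2_eq_square)
    finally show ?thesis
      using u(1,2) by (simp add: \<phi> Bernstein_nonneg)
  qed
  then show ?thesis
    using y(1) sum1 by (intro exI[of _ n] exI[of _ y] exI[of _ \<phi>]) auto
qed

section \<open>The Sylvester equation\<close>

text \<open>The algebra is real; \<open>J\<close> acts as multiplication by i, and complex scalars
  are the elements a + bJ. They are not central: moving one past an element requires that the
  element commutes with \<open>J\<close>, so this property is carried along.\<close>

locale complex_unit =
  fixes J :: "'b::{real_normed_algebra_1, banach}"
  assumes J_square: "J * J = -1"
    and norm_complex_unit: "\<And>z. norm (Re z *\<^sub>R 1 + Im z *\<^sub>R J) \<le> cmod z"
begin

definition cemb :: "complex \<Rightarrow> 'b"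
  where "cemb z = Re z *\<^sub>R 1 + Im z *\<^sub>R J"

lemma norm_J: "norm J \<le> 1"
  using norm_complex_unit[of \<i>] by simp

lemma norm_cemb: "norm (cemb z) \<le> cmod z"
  by (simp add: cemb_def norm_complex_unit)

lemma cemb_add: "cemb (w + z) = cemb w + cemb z"
  by (simp add: cemb_def algebra_simps)

lemma cemb_minus: "cemb (- z) = - cemb z"
  by (simp add: cemb_def)

lemma cemb_scaleR: "cemb (r *\<^sub>R z) = r *\<^sub>R cemb z"
  by (simp add: cemb_def algebra_simps)

lemma cemb_mult: "cemb (w * z) = cemb w * cemb z"
  by (simp add: cemb_def algebra_simps J_square)

lemma cemb_1 [simp]: "cemb 1 = 1" and cemb_ii: "cemb \<i> = J"
  by (simp_all add: cemb_def)

lemma cemb_of_real: "cemb (of_real r) = r *\<^sub>R 1"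
  by (simp add: cemb_def)

lemma bounded_linear_cemb: "bounded_linear cemb"
  by (rule bounded_linear_intro[where K = 1]) (simp_all add: cemb_add cemb_scaleR norm_cemb)

lemma cemb_commute: "x * J = J * x \<Longrightarrow> x * cemb z = cemb z * x"
  by (simp add: cemb_def algebra_simps)

end

text \<open>Self-adjointness is reduced to what the estimates use: exp(t J A) is a contraction for
  every real t, hence so is its inverse. Such elements of a Banach algebra are called
  Hermitian.\<close>

locale hermitian_evolution = complex_unit J for J :: "'b::{real_normed_algebra_1, banach}" +
  fixes A :: 'b
  assumes AJ: "A * J = J * A"
    and norm_exp_JA: "\<And>t. norm (exp (t *\<^sub>R (J * A))) \<le> 1"
begin

definition U :: "real \<Rightarrow> 'b"
  where "U t = exp ((- t) *\<^sub>R (J * A))"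

lemma norm_U: "norm (U t) \<le> 1"
  unfolding U_def by (rule norm_exp_JA)

lemma U_inverse: "U t * U (- t) = 1"
proof -
  have "U t * U (- t) = exp ((- t) *\<^sub>R (J * A) + t *\<^sub>R (J * A))"
    unfolding U_def by (subst exp_add_commuting) (simp_all add: algebra_simps)
  then show ?thesis by simp
qed

lemma commute_U:
  assumes "x * A = A * x" "x * J = J * x"
  shows "x * U t = U t * x"
proof -
  have c: "x * ((- t) *\<^sub>R (J * A)) = ((- t) *\<^sub>R (J * A)) * x"
    using assms by (simp add: mult.assoc[symmetric]) (simp add: mult.assoc)
  have "x * y ^ n = y ^ n * x" if "x * y = y * x" for y n
    using that by (induction n) (simp_all, metis mult.assoc)
  with c have "x * (((- t) *\<^sub>R (J * A)) ^ n /\<^sub>R fact n) = (((- t) *\<^sub>R (J * A)) ^ n /\<^sub>R fact n) * x" for n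
    by (metis mult_scaleR_left mult_scaleR_right)
  then show ?thesis
    unfolding U_def exp_def
    by (simp add: suminf_mult[OF summable_exp_generic, symmetric] suminf_mult2[OF summable_exp_generic])
qed

lemma commute_alg_poly: "x * A = A * x \<Longrightarrow> x * alg_poly p A = alg_poly p A * x"
  by (rule alg_poly_commute)

text \<open>Stands for \<open>E\<close> being a spectral projection of \<open>A\<close> onto
  \<open>S\<close>, expressed by the estimate that a functional calculus would give: on the range of
  \<open>E\<close>, a complex polynomial p + iq in \<open>A\<close> is bounded by its supremum over
  \<open>S\<close>.\<close>

definition spectral_bound :: "'b \<Rightarrow> real set \<Rightarrow> bool"
  where "spectral_bound E S \<longleftrightarrow> E * A = A * E \<and> E * J = J * E \<and> S \<noteq> {} \<and> bounded S \<and>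
    (\<forall>p q c. (\<forall>x\<in>S. cmod (Complex (poly p x) (poly q x)) \<le> c) \<longrightarrow>
      norm ((alg_poly p A + J * alg_poly q A) * E) \<le> c)"

text \<open>The sum is a single complex polynomial in \<open>A\<close>, so the triangle inequality
  is applied to its values on \<open>S\<close>, not to operator norms. This makes the bound
  independent of the number of terms.\<close>

lemma spectral_bound_sum:
  assumes E: "spectral_bound E S" and c: "\<And>a. a \<in> I \<Longrightarrow> cmod (c a) \<le> 1"
    and bound: "\<And>x. x \<in> S \<Longrightarrow> (\<Sum>a\<in>I. \<bar>poly (\<pi> a) x\<bar>) \<le> B"
  shows "norm ((\<Sum>a\<in>I. cemb (c a) * alg_poly (\<pi> a) A) * E) \<le> B"
proof -
  define p where "p = (\<Sum>a\<in>I. smult (Re (c a)) (\<pi> a))"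
  define q where "q = (\<Sum>a\<in>I. smult (Im (c a)) (\<pi> a))"
  have "cmod (Complex (poly p x) (poly q x)) \<le> B" if "x \<in> S" for x
  proof -
    have "Complex (poly p x) (poly q x) = (\<Sum>a\<in>I. c a * of_real (poly (\<pi> a) x))"
      by (simp add: p_def q_def poly_sum complex_eq_iff)
    also have "cmod \<dots> \<le> (\<Sum>a\<in>I. \<bar>poly (\<pi> a) x\<bar>)"
      by (rule sum_norm_le) (use c in \<open>auto simp: norm_mult intro: mult_left_le_one_le\<close>)
    also have "\<dots> \<le> B" by (rule bound[OF that])
    finally show ?thesis .
  qed
  then have "norm ((alg_poly p A + J * alg_poly q A) * E) \<le> B"
    using E unfolding spectral_bound_def by blast
  moreover have "alg_poly p A + J * alg_poly q A = (\<Sum>a\<in>I. cemb (c a) * alg_poly (\<pi> a) A)"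
    by (simp add: p_def q_def alg_poly_sum alg_poly_smult cemb_def distrib_right sum.distrib sum_distrib_left)
  ultimately show ?thesis by simp
qed

definition evolution_approx :: "nat \<Rightarrow> (nat \<Rightarrow> real) \<Rightarrow> (nat \<Rightarrow> real poly) \<Rightarrow> real \<Rightarrow> 'b"
  where "evolution_approx n y \<phi> t = (\<Sum>a\<le>n. cemb (cis (- t * y a)) * alg_poly (\<phi> a) A)"

text \<open>The residual of \<open>evolution_approx\<close> in the evolution equation: if R denotes
  the approximation, then R' + J A R is \<open>J\<close> times this element.\<close>

definition evolution_defect :: "nat \<Rightarrow> (nat \<Rightarrow> real) \<Rightarrow> (nat \<Rightarrow> real poly) \<Rightarrow> real \<Rightarrow> 'b"
  where "evolution_defect n y \<phi> t = (\<Sum>a\<le>n. cemb (cis (- t * y a)) * ((A - y a *\<^sub>R 1) * alg_poly (\<phi> a) A))"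

definition resolution :: "real set \<Rightarrow> real \<Rightarrow> nat \<Rightarrow> (nat \<Rightarrow> real) \<Rightarrow> (nat \<Rightarrow> real poly) \<Rightarrow> bool"
  where "resolution S \<delta> n y \<phi> \<longleftrightarrow> (\<forall>a\<le>n. y a \<in> S) \<and> (\<Sum>a\<le>n. \<phi> a) = 1 \<and>
    (\<forall>x\<in>S. (\<forall>a\<le>n. 0 \<le> poly (\<phi> a) x) \<and> (\<Sum>a\<le>n. \<bar>x - y a\<bar> * poly (\<phi> a) x) \<le> \<delta>)"

lemma norm_evolution_approx:
  assumes "spectral_bound E S" "resolution S \<delta> n y \<phi>"
  shows "norm (evolution_approx n y \<phi> t * E) \<le> 1"
  unfolding evolution_approx_def
proof (rule spectral_bound_sum[OF assms(1)])
  fix x assume x: "x \<in> S"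
  then have "(\<Sum>a\<le>n. \<bar>poly (\<phi> a) x\<bar>) = (\<Sum>a\<le>n. poly (\<phi> a) x)"
    using assms(2) by (auto simp: resolution_def intro!: sum.cong)
  also have "\<dots> = poly (\<Sum>a\<le>n. \<phi> a) x"
    by (simp only: poly_sum)
  finally show "(\<Sum>a\<le>n. \<bar>poly (\<phi> a) x\<bar>) \<le> 1"
    using assms(2) by (simp only: resolution_def poly_1 order_refl)
qed simp

lemma norm_evolution_defect:
  assumes "spectral_bound E S" "resolution S \<delta> n y \<phi>"
  shows "norm (evolution_defect n y \<phi> t * E) \<le> \<delta>"
proof -
  have eq: "(A - y a *\<^sub>R 1) * alg_poly (\<phi> a) A = alg_poly ([:- y a, 1:] * \<phi> a) A" for a
    unfolding alg_poly_mult by (simp add: alg_poly_pCons)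
  show ?thesis
    unfolding evolution_defect_def eq
  proof (rule spectral_bound_sum[OF assms(1)])
    fix x assume x: "x \<in> S"
    have "poly ([:- y a, 1:] * \<phi> a) x = (x - y a) * poly (\<phi> a) x" for a
      by (simp add: algebra_simps)
    then have "(\<Sum>a\<le>n. \<bar>poly ([:- y a, 1:] * \<phi> a) x\<bar>) = (\<Sum>a\<le>n. \<bar>x - y a\<bar> * poly (\<phi> a) x)"
      using assms(2) x by (auto simp del: poly_mult mult_pCons_left simp: resolution_def abs_mult intro!: sum.cong)
    then show "(\<Sum>a\<le>n. \<bar>poly ([:- y a, 1:] * \<phi> a) x\<bar>) \<le> \<delta>"
      using assms(2) x by (simp only: resolution_def)
  qed simp
qed

text \<open>Duhamel's argument: with R the approximation and D its defect, exp(s J A) R(s) E has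
  derivative exp(s J A) J D(s) E, of norm at most \<delta>. It equals E at s = 0, and multiplication
  by U(t) undoes the exponential.\<close>

lemma norm_U_minus_evolution_approx:
  assumes E: "spectral_bound E S" and r: "resolution S \<delta> n y \<phi>"
  shows "norm ((U t - evolution_approx n y \<phi> t) * E) \<le> \<bar>t\<bar> * \<delta>"
proof -
  let ?R = "evolution_approx n y \<phi>" and ?D = "evolution_defect n y \<phi>"
  define h where "h s = exp (s *\<^sub>R (J * A)) * ?R s * E" for s
  have cis': "((\<lambda>s. cemb (cis (- s * c))) has_vector_derivative - (c *\<^sub>R (J * cemb (cis (- s * c))))) (at s)" for c s
  proof -
    have "((\<lambda>s. cis (- s * c)) has_vector_derivative (- c) *\<^sub>R (\<i> * cis (- s * c))) (at s)"
      by (auto simp: cis_conv_exp scaleR_conv_of_real mult_ac intro!: derivative_eq_intros has_vector_derivative_real_field)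
    from bounded_linear.has_vector_derivative[OF bounded_linear_cemb this] show ?thesis
      by (simp add: cemb_scaleR cemb_mult cemb_ii cemb_minus)
  qed
  have R': "(?R has_vector_derivative (\<Sum>a\<le>n. - (y a *\<^sub>R (J * cemb (cis (- s * y a)))) * alg_poly (\<phi> a) A)) (at s)" for s
    unfolding evolution_approx_def
    by (intro has_vector_derivative_sum has_vector_derivative_mult_left cis')
  have D: "J * A * ?R s + (\<Sum>a\<le>n. - (y a *\<^sub>R (J * cemb (cis (- s * y a)))) * alg_poly (\<phi> a) A) = J * ?D s" for s
  proof -
    have "A * (cemb z * x) = cemb z * (A * x)" for z x
      by (simp add: mult.assoc[symmetric] cemb_commute[OF AJ])
    then show ?thesis
      by (simp add: evolution_approx_def evolution_defect_def sum_distrib_left algebra_simps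
          flip: sum.distrib sum_subtractf sum_negf)
  qed
  have h': "(h has_vector_derivative exp (s *\<^sub>R (J * A)) * J * ?D s * E) (at s)" for s
  proof -
    have "(h has_vector_derivative
        (exp (s *\<^sub>R (J * A)) * (\<Sum>a\<le>n. - (y a *\<^sub>R (J * cemb (cis (- s * y a)))) * alg_poly (\<phi> a) A)
          + exp (s *\<^sub>R (J * A)) * (J * A) * ?R s) * E) (at s)"
      unfolding h_def
      by (intro has_vector_derivative_mult_left has_vector_derivative_mult R'
          exp_scaleR_has_vector_derivative_right)
    moreover have "exp (s *\<^sub>R (J * A)) * (\<Sum>a\<le>n. - (y a *\<^sub>R (J * cemb (cis (- s * y a)))) * alg_poly (\<phi> a) A)
          + exp (s *\<^sub>R (J * A)) * (J * A) * ?R s = exp (s *\<^sub>R (J * A)) * (J * ?D s)"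
      unfolding D[symmetric] by (simp add: algebra_simps)
    ultimately show ?thesis by (simp add: mult.assoc)
  qed
  have h'_bound: "norm (exp (s *\<^sub>R (J * A)) * J * ?D s * E) \<le> \<delta>" for s
  proof -
    have "norm (exp (s *\<^sub>R (J * A)) * J * (?D s * E)) \<le> (1 * 1) * \<delta>"
      by (intro norm_mult_ineq[THEN order_trans] mult_mono norm_exp_JA norm_J norm_evolution_defect[OF E r]) auto
    then show ?thesis by (simp add: mult.assoc)
  qed
  have "norm (h t - h 0) \<le> \<delta> * norm (t - 0)"
  proof (rule differentiable_bound[of UNIV])
    show "(h has_derivative (\<lambda>u. u *\<^sub>R (exp (s *\<^sub>R (J * A)) * J * ?D s * E))) (at s within UNIV)" for s
      using h'[of s] by (simp add: has_vector_derivative_def)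
    show "onorm (\<lambda>u. u *\<^sub>R (exp (s *\<^sub>R (J * A)) * J * ?D s * E)) \<le> \<delta>" for s
    proof (rule onorm_bound)
      show "0 \<le> \<delta>" using h'_bound[of 0] norm_ge_zero order_trans by blast
      show "norm (u *\<^sub>R (exp (s *\<^sub>R (J * A)) * J * ?D s * E)) \<le> \<delta> * norm u" for u
        using mult_right_mono[OF h'_bound[of s], of "\<bar>u\<bar>"] by (simp add: mult.commute)
    qed
  qed auto
  moreover have "h 0 = E"
  proof -
    have "?R 0 = alg_poly (\<Sum>a\<le>n. \<phi> a) A"
      by (simp add: evolution_approx_def alg_poly_sum)
    then show ?thesis
      using r by (simp add: h_def resolution_def)
  qed
  ultimately have "norm (h t - E) \<le> \<bar>t\<bar> * \<delta>"
    by (simp add: mult.commute)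
  moreover have "(U t - ?R t) * E = - (U t * (h t - E))"
  proof -
    have "U t * exp (t *\<^sub>R (J * A)) = 1"
      using U_inverse[of t] by (simp add: U_def)
    then have "U t * h t = ?R t * E"
      unfolding h_def by (simp add: mult.assoc[symmetric])
    then show ?thesis by (simp add: algebra_simps)
  qed
  ultimately show ?thesis
    using norm_mult_ineq[of "U t" "h t - E"] mult_mono[OF norm_U[of t], of "norm (h t - E)" "\<bar>t\<bar> * \<delta>"] by simp
qed

end

lemma norm_mult3_le:
  fixes x y z :: "'b::real_normed_algebra"
  assumes "norm x \<le> a" "norm y \<le> b" "norm z \<le> c"
  shows "norm (x * y * z) \<le> a * b * c"
proof -
  have nn: "0 \<le> a" "0 \<le> b"
    using assms(1,2) norm_ge_zero order_trans by blast+
  have "norm (x * y * z) \<le> norm (x * y) * norm z"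
    by (rule norm_mult_ineq)
  also have "norm (x * y) \<le> norm x * norm y"
    by (rule norm_mult_ineq)
  also have "norm x * norm y \<le> a * b"
    using assms nn by (intro mult_mono) auto
  also have "a * b * norm z \<le> a * b * c"
    using assms(3) nn by (intro mult_left_mono) auto
  finally show ?thesis
    by (simp add: mult_right_mono)
qed

section \<open>The integral transform and the commutator equation\<close>

context hermitian_evolution
begin

lemma norm_spectral_bound: "spectral_bound E S \<Longrightarrow> norm E \<le> 1"
  unfolding spectral_bound_def
  by (elim conjE allE[of _ 1] allE[of _ 0] allE[of _ "1::real"]) (simp add: cmod_def)

definition twirl :: "(real \<Rightarrow> complex) \<Rightarrow> 'b \<Rightarrow> real \<Rightarrow> 'b"
  where "twirl f Z t = cemb (f t) * (U t * Z * U (- t))"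

lemma norm_twirl_le: "norm (twirl f Z t) \<le> cmod (f t) * norm Z"
proof -
  have "norm (U t * Z * U (- t)) \<le> 1 * norm Z * 1"
    by (intro norm_mult3_le norm_U order_refl)
  then have "norm (cemb (f t)) * norm (U t * Z * U (- t)) \<le> cmod (f t) * norm Z"
    using norm_cemb[of "f t"] by (intro mult_mono) auto
  then show ?thesis
    unfolding twirl_def using norm_mult_ineq order_trans by blast
qed

lemma norm_integral_twirl_le:
  assumes "integrable lborel f" "twirl f Z integrable_on UNIV"
  shows "norm (integral UNIV (twirl f Z)) \<le> (LINT t|lborel. cmod (f t)) * norm Z"
proof -
  have "integrable lborel (\<lambda>t. cmod (f t) * norm Z)"
    using assms(1) by simp
  from Henstock_Kurzweil_Integration.integral_norm_bound_integral[OF assms(2) integrable_on_lborel[OF this]]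
  show ?thesis
    using assms(1) by (simp add: norm_twirl_le integral_lborel)
qed

lemma twirl_mult:
  assumes "C * A = A * C" "C * J = J * C" "D * A = A * D" "D * J = J * D"
  shows "twirl f (C * Z * D) t = C * twirl f Z t * D"
proof -
  have "twirl f (C * Z * D) t = cemb (f t) * (U t * C) * Z * (D * U (- t))"
    by (simp add: twirl_def mult.assoc)
  also have "\<dots> = cemb (f t) * (C * U t) * Z * (U (- t) * D)"
    using assms by (simp only: commute_U)
  also have "\<dots> = (cemb (f t) * C) * U t * Z * U (- t) * D"
    by (simp add: mult.assoc)
  also have "cemb (f t) * C = C * cemb (f t)"
    using assms(2) by (simp add: cemb_commute)
  finally show ?thesis
    by (simp add: twirl_def mult.assoc)
qed

lemma twirl_sum: "twirl f (\<Sum>i\<in>I. Z i) t = (\<Sum>i\<in>I. twirl f (Z i) t)"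
  by (simp add: twirl_def sum_distrib_left sum_distrib_right)

lemma integral_mult_both:
  fixes C D :: 'b
  assumes "g integrable_on S"
  shows "integral S (\<lambda>t. C * g t * D) = C * integral S g * D"
  using integral_linear[OF assms, of "\<lambda>x. C * x * D"]
  by (simp add: o_def bounded_linear_mult_left bounded_linear_mult_right
      bounded_linear_compose[OF bounded_linear_mult_left, unfolded o_def])

lemma integral_twirl_commute_J:
  assumes "Z * J = J * Z" "twirl f Z integrable_on UNIV"
  shows "integral UNIV (twirl f Z) * J = J * integral UNIV (twirl f Z)"
proof -
  have "twirl f Z t * J = J * twirl f Z t" for t
  proof -
    have "twirl f (1 * Z * J) t = 1 * twirl f Z t * J" "twirl f (J * Z * 1) t = J * twirl f Z t * 1"
      by (rule twirl_mult; simp add: AJ)+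
    then show ?thesis
      unfolding mult_1_left mult_1_right assms(1) by (rule trans[OF sym])
  qed
  then show ?thesis
    using integral_mult_both[OF assms(2), of 1 J] integral_mult_both[OF assms(2), of J 1] by simp
qed

text \<open>Each summand is a scalar integral times a fixed element: the phases combine to exp(-i
  (y_a - z_b) t), and the gap keeps y_a - z_b where the transform of \<open>f\<close> is
  prescribed.\<close>

lemma has_integral_double_phase_sum:
  fixes n n' :: nat
  assumes f: "integrable lborel f"
    and f_hat: "\<And>s. \<bar>s\<bar> \<ge> \<eta> \<Longrightarrow> (LINT t|lborel. f t * exp (- \<i> * complex_of_real (s * t))) = 1 / complex_of_real s"
    and gap: "\<And>a b. a \<le> n \<Longrightarrow> b \<le> n' \<Longrightarrow> \<bar>y a - z b\<bar> \<ge> \<eta>"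
  shows "((\<lambda>t. cemb (f t) * (\<Sum>a\<le>n. \<Sum>b\<le>n'. cemb (cis (- t * y a)) * cemb (cis (t * z b)) * M a b))
    has_integral (\<Sum>a\<le>n. \<Sum>b\<le>n'. (1 / (y a - z b)) *\<^sub>R M a b)) UNIV"
proof -
  have "((\<lambda>t. cemb (f t) * (cemb (cis (- t * y a)) * cemb (cis (t * z b)) * M a b))
    has_integral (1 / (y a - z b)) *\<^sub>R M a b) UNIV" if "a \<le> n" "b \<le> n'" for a b
  proof -
    let ?s = "y a - z b"
    have phase: "cis (- t * y a) * cis (t * z b) = exp (- \<i> * of_real (?s * t))" for t
      by (simp add: cis_conv_exp exp_add[symmetric] algebra_simps)
    have "integrable lborel (\<lambda>t. f t * exp (- \<i> * of_real (?s * t)))"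
      using f by (rule Bochner_Integration.integrable_bound) (use f in \<open>auto simp: norm_mult norm_exp_eq_Re\<close>)
    from has_integral_integral_lborel[OF this] f_hat[OF gap[OF that]]
    have "((\<lambda>t. f t * exp (- \<i> * of_real (?s * t))) has_integral 1 / complex_of_real ?s) UNIV"
      by simp
    moreover have "bounded_linear (\<lambda>w. cemb w * M a b)"
      by (rule bounded_linear_compose[OF bounded_linear_mult_left bounded_linear_cemb, unfolded o_def])
    ultimately have "((\<lambda>t. cemb (f t * exp (- \<i> * of_real (?s * t))) * M a b)
        has_integral cemb (1 / complex_of_real ?s) * M a b) UNIV"
      by (rule has_integral_linear[unfolded o_def])
    moreover have "cemb (1 / complex_of_real ?s) * M a b = (1 / ?s) *\<^sub>R M a b"
      using cemb_of_real[of "1 / ?s"] by simp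
    moreover have "cemb (f t * exp (- \<i> * of_real (?s * t))) * M a b
        = cemb (f t) * (cemb (cis (- t * y a)) * cemb (cis (t * z b)) * M a b)" for t
      unfolding phase[symmetric] by (simp only: cemb_mult mult.assoc)
    ultimately show ?thesis by simp
  qed
  then have "((\<lambda>t. \<Sum>a\<le>n. \<Sum>b\<le>n'. cemb (f t) * (cemb (cis (- t * y a)) * cemb (cis (t * z b)) * M a b))
    has_integral (\<Sum>a\<le>n. \<Sum>b\<le>n'. (1 / (y a - z b)) *\<^sub>R M a b)) UNIV"
    by (intro has_integral_sum) auto
  then show ?thesis
    by (simp only: sum_distrib_left)
qed

text \<open>\<open>X k\<close> is the integral with both evolutions replaced by approximations of
  accuracy \<delta> = 1/(k+1). It solves the equation up to an error of order \<delta>, and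
  dominated approximation carries integrability and equation to the limit.\<close>

theorem sylvester_equation:
  assumes E1: "spectral_bound E1 S1" and E2: "spectral_bound E2 S2"
    and gap: "\<And>y z. y \<in> S1 \<Longrightarrow> z \<in> S2 \<Longrightarrow> \<bar>y - z\<bar> \<ge> \<eta>" and \<eta>: "\<eta> > 0"
    and f: "integrable lborel f"
    and f_hat: "\<And>s. \<bar>s\<bar> \<ge> \<eta> \<Longrightarrow> (LINT t|lborel. f t * exp (- \<i> * complex_of_real (s * t))) = 1 / complex_of_real s"
    and Z: "Z = E1 * Z * E2" and ZJ: "Z * J = J * Z"
  shows "twirl f Z integrable_on UNIV"
    and "A * integral UNIV (twirl f Z) - integral UNIV (twirl f Z) * A = Z"
proof -
  define \<delta> where "\<delta> k = 1 / real (Suc k)" for k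
  have \<delta>: "\<delta> k > 0" for k by (simp add: \<delta>_def)
  have "\<exists>n y \<phi>. resolution S \<epsilon> n y \<phi>" if "spectral_bound E S" "\<epsilon> > 0" for E S \<epsilon>
    using exists_approximate_resolution[of S \<epsilon>] that unfolding spectral_bound_def resolution_def by simp
  then have ex: "\<forall>k. \<exists>n y \<phi>. resolution S1 (\<delta> k) n y \<phi>" "\<forall>k. \<exists>n y \<phi>. resolution S2 (\<delta> k) n y \<phi>"
    using E1 E2 \<delta> by blast+
  obtain n1 y1 \<phi>1 where r1: "\<And>k. resolution S1 (\<delta> k) (n1 k) (y1 k) (\<phi>1 k)"
    using ex(1) by metis
  obtain n2 y2 \<phi>2 where r2: "\<And>k. resolution S2 (\<delta> k) (n2 k) (y2 k) (\<phi>2 k)"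
    using ex(2) by metis
  define R1 where "R1 k t = evolution_approx (n1 k) (y1 k) (\<phi>1 k) t" for k t
  define R2 where "R2 k t = evolution_approx (n2 k) (y2 k) (\<phi>2 k) (- t)" for k t
  define D1 where "D1 k t = evolution_defect (n1 k) (y1 k) (\<phi>1 k) t" for k t
  define D2 where "D2 k t = evolution_defect (n2 k) (y2 k) (\<phi>2 k) (- t)" for k t
  define X where "X k = (\<Sum>a\<le>n1 k. \<Sum>b\<le>n2 k. (1 / (y1 k a - y2 k b)) *\<^sub>R
    (alg_poly (\<phi>1 k a) A * Z * alg_poly (\<phi>2 k b) A))" for k
  have gap': "\<bar>y1 k a - y2 k b\<bar> \<ge> \<eta>" if "a \<le> n1 k" "b \<le> n2 k" for k a b
    using r1[of k] r2[of k] that gap by (auto simp: resolution_def)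
  have E2_comm: "E2 * A = A * E2" "E2 * J = J * E2"
    using E2 by (simp_all add: spectral_bound_def)
  have pJ: "alg_poly p A * J = J * alg_poly p A" for p
    by (rule alg_poly_commute[symmetric]) (simp add: AJ)
  have Zc: "Z * (cemb w * x) = cemb w * (Z * x)" and pc: "alg_poly p A * (cemb w * x) = cemb w * (alg_poly p A * x)" for w x p
    using cemb_commute[OF ZJ, of w] cemb_commute[OF pJ, of p w] by (simp_all only: mult.assoc[symmetric])
  have Ac: "A * (cemb w * x) = cemb w * (A * x)" for w x
    using cemb_commute[OF AJ, of w] by (simp only: mult.assoc[symmetric])
  have R_E2: "R2 k t * E2 = E2 * R2 k t" "D2 k t * E2 = E2 * D2 k t" for k t
  proof -
    have "E2 * alg_poly p A = alg_poly p A * E2" for p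
      by (rule commute_alg_poly[OF E2_comm(1)])
    moreover have "E2 * cemb w = cemb w * E2" for w
      by (rule cemb_commute[OF E2_comm(2)])
    moreover have "E2 * (A - c *\<^sub>R 1) = (A - c *\<^sub>R 1) * E2" for c
      by (simp add: algebra_simps E2_comm)
    moreover have prod: "E2 * (x * y) = (x * y) * E2" if "E2 * x = x * E2" "E2 * y = y * E2" for x y
      using that by (metis mult.assoc)
    ultimately have "cemb w * alg_poly p A * E2 = E2 * (cemb w * alg_poly p A)"
      "cemb w * ((A - c *\<^sub>R 1) * alg_poly p A) * E2 = E2 * (cemb w * ((A - c *\<^sub>R 1) * alg_poly p A))" for w p c
      by (simp_all only: prod)
    then show "R2 k t * E2 = E2 * R2 k t" "D2 k t * E2 = E2 * D2 k t"
      by (simp_all only: R2_def D2_def evolution_approx_def evolution_defect_def sum_distrib_left sum_distrib_right)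
  qed
  have nR: "norm (R1 k t * E1) \<le> 1" "norm (E2 * R2 k t) \<le> 1"
    "norm (D1 k t * E1) \<le> \<delta> k" "norm (E2 * D2 k t) \<le> \<delta> k"
    "norm ((U t - R1 k t) * E1) \<le> \<bar>t\<bar> * \<delta> k" "norm (E2 * (U (- t) - R2 k t)) \<le> \<bar>t\<bar> * \<delta> k" for k t
  proof -
    show "norm (R1 k t * E1) \<le> 1" "norm (D1 k t * E1) \<le> \<delta> k" "norm ((U t - R1 k t) * E1) \<le> \<bar>t\<bar> * \<delta> k"
      unfolding R1_def D1_def
      by (rule norm_evolution_approx[OF E1 r1] norm_evolution_defect[OF E1 r1] norm_U_minus_evolution_approx[OF E1 r1])+
    show "norm (E2 * R2 k t) \<le> 1" "norm (E2 * D2 k t) \<le> \<delta> k"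
      unfolding R_E2[symmetric] unfolding R2_def D2_def
      by (rule norm_evolution_approx[OF E2 r2] norm_evolution_defect[OF E2 r2])+
    have "E2 * (U (- t) - R2 k t) = (U (- t) - R2 k t) * E2"
      by (simp add: algebra_simps R_E2 commute_U[OF E2_comm])
    then show "norm (E2 * (U (- t) - R2 k t)) \<le> \<bar>t\<bar> * \<delta> k"
      using norm_U_minus_evolution_approx[OF E2 r2[of k], of "- t"] by (simp add: R2_def)
  qed
  \<comment> \<open>Z = E1 Z E2 allows the projections to be inserted next to Z; the approximations
    are controlled only in their presence.\<close>
  have sandwich: "norm (S * Z * T) \<le> b * norm Z * c"
    if "norm (S * E1) \<le> b" "norm (E2 * T) \<le> c" for S T b c
  proof -
    have "S * Z * T = (S * E1) * Z * (E2 * T)"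
      by (subst Z) (simp add: mult.assoc)
    then show ?thesis
      using norm_mult3_le[OF that(1) order_refl[of "norm Z"] that(2)] by simp
  qed
  have nEU: "norm (E2 * U (- t)) \<le> 1" for t
    using norm_mult_ineq[of E2 "U (- t)"] mult_le_one[OF norm_spectral_bound[OF E2] norm_ge_zero norm_U[of "- t"]]
    by (rule order_trans)
  define g where "g k t = cemb (f t) * (R1 k t * Z * R2 k t)" for k t
  have g_int: "(g k has_integral X k) UNIV" for k
  proof -
    have eq: "R1 k t * Z * R2 k t = (\<Sum>a\<le>n1 k. \<Sum>b\<le>n2 k. cemb (cis (- t * y1 k a)) * cemb (cis (t * y2 k b)) *
        (alg_poly (\<phi>1 k a) A * Z * alg_poly (\<phi>2 k b) A))" for t
      unfolding R1_def R2_def evolution_approx_def sum_product sum_distrib_right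
      by (simp add: mult.assoc sum_distrib_left Zc pc)
    show ?thesis
      unfolding g_def[abs_def] X_def eq by (rule has_integral_double_phase_sum[OF f f_hat gap'])
  qed
  \<comment> \<open>The approximation error grows with |t|, while t f(t) need not be integrable.
    Capping by the trivial bound 2 provides an integrable majorant, so dominated convergence
    applies.\<close>
  define h where "h k t = cmod (f t) * min 2 (2 * \<bar>t\<bar> * \<delta> k) * norm Z" for k t
  have h_bound: "\<bar>h k t\<bar> \<le> cmod (f t) * (2 * norm Z)" for k t
  proof -
    have m: "0 \<le> min 2 (2 * \<bar>t\<bar> * \<delta> k)" "min 2 (2 * \<bar>t\<bar> * \<delta> k) \<le> 2"
      using less_imp_le[OF \<delta>[of k]] by (simp_all add: min_def)
    then have "\<bar>h k t\<bar> = cmod (f t) * (min 2 (2 * \<bar>t\<bar> * \<delta> k) * norm Z)"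
      unfolding h_def by (simp add: abs_mult mult.assoc)
    also have "\<dots> \<le> cmod (f t) * (2 * norm Z)"
      using m by (intro mult_left_mono mult_right_mono) auto
    finally show ?thesis .
  qed
  have h_int: "integrable lborel (h k)" for k
  proof (rule Bochner_Integration.integrable_bound)
    show "integrable lborel (\<lambda>t. cmod (f t) * (2 * norm Z))"
      using f by simp
    show "h k \<in> borel_measurable lborel"
      unfolding h_def using f by measurable
    show "AE t in lborel. norm (h k t) \<le> norm (cmod (f t) * (2 * norm Z))"
      using h_bound by simp
  qed
  have "norm (twirl f Z t - g k t) \<le> h k t" for k t
  proof -
    let ?d = "U t * Z * U (- t) - R1 k t * Z * R2 k t"
    have "norm ?d \<le> 2 * norm Z"
    proof -
      have "norm (U t * Z * U (- t)) \<le> 1 * norm Z * 1"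
        by (intro norm_mult3_le norm_U order_refl)
      moreover have "norm (R1 k t * Z * R2 k t) \<le> 1 * norm Z * 1"
        by (rule sandwich[OF nR(1,2)])
      ultimately show ?thesis
        using norm_triangle_ineq4[of "U t * Z * U (- t)" "R1 k t * Z * R2 k t"] by simp
    qed
    moreover have "norm ?d \<le> (2 * \<bar>t\<bar> * \<delta> k) * norm Z"
    proof -
      have "?d = (U t - R1 k t) * Z * U (- t) + R1 k t * Z * (U (- t) - R2 k t)"
        by (simp add: algebra_simps)
      moreover have "norm ((U t - R1 k t) * Z * U (- t)) \<le> (\<bar>t\<bar> * \<delta> k) * norm Z * 1"
        by (rule sandwich[OF nR(5) nEU])
      moreover have "norm (R1 k t * Z * (U (- t) - R2 k t)) \<le> 1 * norm Z * (\<bar>t\<bar> * \<delta> k)"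
        by (rule sandwich[OF nR(1,6)])
      ultimately show ?thesis
        using norm_triangle_ineq[of "(U t - R1 k t) * Z * U (- t)" "R1 k t * Z * (U (- t) - R2 k t)"]
        by (simp add: algebra_simps)
    qed
    ultimately have "norm ?d \<le> min 2 (2 * \<bar>t\<bar> * \<delta> k) * norm Z"
      by (simp add: min_mult_distrib_right)
    then have "cmod (f t) * norm ?d \<le> h k t"
      unfolding h_def by (simp add: mult.assoc mult_left_mono)
    moreover have "twirl f Z t - g k t = cemb (f t) * ?d"
      by (simp add: twirl_def g_def right_diff_distrib)
    moreover have "norm (cemb (f t) * ?d) \<le> cmod (f t) * norm ?d"
      using norm_mult_ineq mult_right_mono[OF norm_cemb norm_ge_zero] by (rule order_trans)
    ultimately show ?thesis by simp
  qed
  note close = this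
  have "(\<lambda>k. LINT t|lborel. h k t) \<longlonglongrightarrow> (LINT t|(lborel :: real measure). 0)"
  proof (rule integral_dominated_convergence[where w = "\<lambda>t. cmod (f t) * (2 * norm Z)"])
    have \<delta>0: "\<delta> \<longlonglongrightarrow> 0"
      unfolding \<delta>_def using LIMSEQ_inverse_real_of_nat by (simp add: inverse_eq_divide)
    have "(\<lambda>k. h k t) \<longlonglongrightarrow> cmod (f t) * min 2 (2 * \<bar>t\<bar> * 0) * norm Z" for t
      unfolding h_def by (intro tendsto_intros \<delta>0)
    then show "AE t in lborel. (\<lambda>k. h k t) \<longlonglongrightarrow> 0"
      by simp
    show "AE t in lborel. norm (h k t) \<le> cmod (f t) * (2 * norm Z)" for k
      using h_bound by simp
  qed (use f h_int in auto)
  then have h_lim: "(\<lambda>k. integral UNIV (h k)) \<longlonglongrightarrow> 0"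
    by (simp add: integral_lborel[OF h_int])
  note approx = has_integral_UNIV_dominated_approx[OF g_int integrable_on_lborel[OF h_int] close h_lim]
  show "twirl f Z integrable_on UNIV"
    by (rule approx(1))
  \<comment> \<open>In the commutator of \<open>A\<close> with a term of \<open>X k\<close>, write
    \<open>A\<close> as (A - y1) + y1 on the left and as (A - y2) + y2 on the right. The factor y1 -
    y2 cancels the denominator, and these parts sum to Z; the rest is the integral of the
    defects.\<close>
  have defect: "norm (A * X k - X k * A - Z) \<le> \<delta> k * (2 * norm Z * (LINT t|lborel. cmod (f t)))" for k
  proof -
    let ?M = "\<lambda>a b. (A - y1 k a *\<^sub>R 1) * alg_poly (\<phi>1 k a) A * Z * alg_poly (\<phi>2 k b) A
      - alg_poly (\<phi>1 k a) A * Z * ((A - y2 k b *\<^sub>R 1) * alg_poly (\<phi>2 k b) A)"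
    let ?d = "\<lambda>t. cemb (f t) * (D1 k t * Z * R2 k t - R1 k t * Z * D2 k t)"
    have d_eq: "D1 k t * Z * R2 k t - R1 k t * Z * D2 k t =
        (\<Sum>a\<le>n1 k. \<Sum>b\<le>n2 k. cemb (cis (- t * y1 k a)) * cemb (cis (t * y2 k b)) * ?M a b)" for t
    proof -
      have Apc: "(A - c *\<^sub>R 1) * (cemb w * x) = cemb w * ((A - c *\<^sub>R 1) * x)" for c w x
        by (simp add: algebra_simps Ac)
      show ?thesis
        unfolding R1_def R2_def D1_def D2_def evolution_approx_def evolution_defect_def sum_product sum_distrib_right
          right_diff_distrib sum_subtractf
        by (simp add: mult.assoc sum_distrib_left Zc pc Apc)
    qed
    have d_int: "(?d has_integral (\<Sum>a\<le>n1 k. \<Sum>b\<le>n2 k. (1 / (y1 k a - y2 k b)) *\<^sub>R ?M a b)) UNIV"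
      unfolding d_eq by (rule has_integral_double_phase_sum[OF f f_hat gap'])
    moreover have "(\<Sum>a\<le>n1 k. \<Sum>b\<le>n2 k. (1 / (y1 k a - y2 k b)) *\<^sub>R ?M a b) = A * X k - X k * A - Z"
    proof -
      have "Z = alg_poly (\<Sum>a\<le>n1 k. \<phi>1 k a) A * Z * alg_poly (\<Sum>b\<le>n2 k. \<phi>2 k b) A"
        using r1[of k] r2[of k] by (simp add: resolution_def)
      also have "\<dots> = (\<Sum>a\<le>n1 k. \<Sum>b\<le>n2 k. alg_poly (\<phi>1 k a) A * Z * alg_poly (\<phi>2 k b) A)"
        by (simp only: alg_poly_sum sum_distrib_right) (simp only: sum_distrib_left)
      finally have Zs: "Z = \<dots>" .
      have "A * X k - X k * A - Z = (\<Sum>a\<le>n1 k. \<Sum>b\<le>n2 k.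
          A * ((1 / (y1 k a - y2 k b)) *\<^sub>R (alg_poly (\<phi>1 k a) A * Z * alg_poly (\<phi>2 k b) A))
          - ((1 / (y1 k a - y2 k b)) *\<^sub>R (alg_poly (\<phi>1 k a) A * Z * alg_poly (\<phi>2 k b) A)) * A
          - alg_poly (\<phi>1 k a) A * Z * alg_poly (\<phi>2 k b) A)"
        by (subst Zs) (simp only: X_def sum_distrib_left sum_distrib_right sum_subtractf)
      also have "\<dots> = (\<Sum>a\<le>n1 k. \<Sum>b\<le>n2 k. (1 / (y1 k a - y2 k b)) *\<^sub>R ?M a b)"
      proof (intro sum.cong refl)
        fix a b assume "a \<in> {..n1 k}" "b \<in> {..n2 k}"
        then have ne: "y1 k a - y2 k b \<noteq> 0" using gap'[of a k b] \<eta> by auto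
        let ?p = "alg_poly (\<phi>1 k a) A" and ?q = "alg_poly (\<phi>2 k b) A"
        have "?q * A = A * ?q"
          by (rule alg_poly_commute[symmetric]) simp
        then have "?p * Z * ?q * A = ?p * Z * (A * ?q)"
          by (simp add: mult.assoc)
        then have "?M a b = A * (?p * Z * ?q) - (?p * Z * ?q) * A - (y1 k a - y2 k b) *\<^sub>R (?p * Z * ?q)"
          by (simp add: algebra_simps)
        then show "A * ((1 / (y1 k a - y2 k b)) *\<^sub>R (?p * Z * ?q)) - ((1 / (y1 k a - y2 k b)) *\<^sub>R (?p * Z * ?q)) * A
            - ?p * Z * ?q = (1 / (y1 k a - y2 k b)) *\<^sub>R ?M a b"
          using ne by (simp add: scaleR_diff_right)
      qed
      finally show ?thesis by simp
    qed
    ultimately have int: "(?d has_integral (A * X k - X k * A - Z)) UNIV"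
      by simp
    have bound: "norm (?d t) \<le> \<delta> k * (2 * norm Z * cmod (f t))" for t
    proof -
      have "norm (D1 k t * Z * R2 k t) \<le> \<delta> k * norm Z * 1" "norm (R1 k t * Z * D2 k t) \<le> 1 * norm Z * \<delta> k"
        by (rule sandwich[OF nR(3,2)], rule sandwich[OF nR(1,4)])
      then have "norm (D1 k t * Z * R2 k t - R1 k t * Z * D2 k t) \<le> \<delta> k * (2 * norm Z)"
        using norm_triangle_ineq4[of "D1 k t * Z * R2 k t" "R1 k t * Z * D2 k t"] by (simp add: algebra_simps)
      then have "norm (cemb (f t)) * norm (D1 k t * Z * R2 k t - R1 k t * Z * D2 k t) \<le> cmod (f t) * (\<delta> k * (2 * norm Z))"
        using norm_cemb by (intro mult_mono) auto
      then show ?thesis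
        using norm_mult_ineq[of "cemb (f t)" "D1 k t * Z * R2 k t - R1 k t * Z * D2 k t"] by (simp add: mult_ac)
    qed
    have "integrable lborel (\<lambda>t. \<delta> k * (2 * norm Z * cmod (f t)))"
      using f by simp
    from Henstock_Kurzweil_Integration.integral_norm_bound_integral[OF has_integral_integrable[OF int] integrable_on_lborel[OF this]] bound
    have "norm (integral UNIV ?d) \<le> integral UNIV (\<lambda>t. \<delta> k * (2 * norm Z * cmod (f t)))"
      by blast
    also have "\<dots> = \<delta> k * (2 * norm Z * (LINT t|lborel. cmod (f t)))"
      using f by (subst integral_lborel) auto
    finally show ?thesis
      using integral_unique[OF int] by simp
  qed
  have "(\<lambda>k. \<delta> k * (2 * norm Z * (LINT t|lborel. cmod (f t)))) \<longlonglongrightarrow> 0 * (2 * norm Z * (LINT t|lborel. cmod (f t)))"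
    unfolding \<delta>_def using LIMSEQ_inverse_real_of_nat by (intro tendsto_mult_right) (simp add: inverse_eq_divide)
  then have "(\<lambda>k. A * X k - X k * A - Z) \<longlonglongrightarrow> 0"
    unfolding mult_zero_left by (rule Lim_null_comparison[OF always_eventually[OF allI[OF defect]]])
  moreover have "(\<lambda>k. A * X k - X k * A - Z) \<longlonglongrightarrow> A * integral UNIV (twirl f Z) - integral UNIV (twirl f Z) * A - Z"
    by (intro tendsto_intros approx(2))
  ultimately have "A * integral UNIV (twirl f Z) - integral UNIV (twirl f Z) * A - Z = 0"
    using LIMSEQ_unique by blast
  then show "A * integral UNIV (twirl f Z) - integral UNIV (twirl f Z) * A = Z"
    by simp
qed

end

section \<open>The Bloch expansion\<close>

text \<open>The Neumann series v of d = 1 - w satisfies v = 1 + v d = 1 + d v, which gives the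
  inverse and the norm bound together.\<close>

lemma norm_lt_one_imp_invertible:
  fixes w :: "'b::{real_normed_algebra_1, banach}"
  assumes "norm (1 - w) < 1"
  shows "\<exists>v. v * w = 1 \<and> w * v = 1 \<and> norm v \<le> 1 / (1 - norm (1 - w))"
proof -
  define d where "d = 1 - w"
  have sm: "summable (\<lambda>n. d ^ n)"
  proof (rule summable_norm_cancel, rule summable_comparison_test)
    show "\<exists>N. \<forall>n\<ge>N. norm (norm (d ^ n)) \<le> norm d ^ n"
      by (auto simp: norm_power_ineq)
    show "summable (\<lambda>n. norm d ^ n)"
      using assms by (simp add: d_def summable_geometric)
  qed
  define v where "v = (\<Sum>n. d ^ n)"
  have v1: "v = 1 + v * d"
    using suminf_split_head[OF sm] suminf_mult2[OF sm, of d] by (simp add: v_def power_commutes algebra_simps)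
  have v2: "v = 1 + d * v"
    using suminf_split_head[OF sm] suminf_mult[OF sm, of d] by (simp add: v_def algebra_simps)
  have "v * w = 1" "w * v = 1"
    using v1 v2 by (simp_all add: d_def algebra_simps)
  moreover have "norm v \<le> 1 / (1 - norm d)"
  proof -
    have "norm v \<le> 1 + norm v * norm d"
      by (subst v1) (use norm_triangle_ineq[of 1 "v * d"] norm_mult_ineq[of v d] in simp)
    then show ?thesis
      using assms by (simp add: d_def field_simps)
  qed
  ultimately show ?thesis
    unfolding d_def by blast
qed

lemma exp_conjugate:
  fixes v w x :: "'b::{real_normed_algebra_1, banach}"
  assumes "v * w = 1" "w * v = 1"
  shows "exp (v * x * w) = v * exp x * w"
proof -
  have pow: "(v * x * w) ^ n = v * x ^ n * w" for n
  proof (induction n)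
    case (Suc n)
    have "(v * x * w) ^ Suc n = v * x * (w * v) * x ^ n * w"
      unfolding power_Suc Suc by (simp add: mult.assoc)
    then show ?case
      by (simp add: assms mult.assoc)
  qed (simp add: assms)
  have "bounded_linear (\<lambda>y. v * y * w)"
    by (rule bounded_linear_compose[OF bounded_linear_mult_left bounded_linear_mult_right, unfolded o_def])
  from bounded_linear.suminf[OF this summable_exp_generic[of x]]
  show ?thesis
    by (simp add: exp_def pow)
qed

text \<open>The majorant \<open>2 / (1 + r)\<close> is the generating function of the Catalan numbers at \<open>y\<close>,
  the smaller solution of \<open>x = 1 + y * x\<^sup>2\<close>.\<close>

lemma catalan_majorant:
  fixes a :: "nat \<Rightarrow> real"
  assumes a0: "a 0 = 1" and nonneg: "\<And>n. 0 \<le> a n"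
    and rec: "\<And>n. a (Suc n) \<le> y * (\<Sum>i\<le>n. a i * a (n - i))"
    and y: "0 \<le> y" "4 * y < 1"
  shows "summable a" and "(\<Sum>n. a (Suc n)) \<le> 2 / (1 + sqrt (1 - 4 * y)) - 1"
proof -
  define r where "r = sqrt (1 - 4 * y)"
  define x where "x = 2 / (1 + r)"
  have r: "r > 0" "r\<^sup>2 = 1 - 4 * y"
    using y by (simp_all add: r_def)
  have x: "x = 1 + y * x\<^sup>2"
  proof -
    have "y = (1 - r\<^sup>2) / 4" using r(2) by simp
    then show ?thesis
      using r(1) by (simp add: x_def divide_simps) (simp add: power2_eq_square algebra_simps)
  qed
  have x0: "x \<ge> 0" using r by (simp add: x_def)
  \<comment> \<open>The partial sums satisfy s_(n+1) \<le> 1 + y s_n^2 \<le> 1 + y x^2 = x by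
    induction; the triangle i + j \<le> n of the convolutions lies in the square over which s_n^2
    sums.\<close>
  have bound: "(\<Sum>j\<le>n. a j) \<le> x" for n
  proof (induction n)
    case 0
    have "y * x\<^sup>2 \<ge> 0" using y by simp
    then show ?case using x a0 by simp
  next
    case (Suc n)
    have "(\<Sum>j\<le>Suc n. a j) = 1 + (\<Sum>j\<le>n. a (Suc j))"
      by (subst sum.atMost_Suc_shift) (simp add: a0)
    also have "(\<Sum>j\<le>n. a (Suc j)) \<le> y * (\<Sum>j\<le>n. \<Sum>i\<le>j. a i * a (j - i))"
      by (subst sum_distrib_left, intro sum_mono rec)
    also have "(\<Sum>j\<le>n. \<Sum>i\<le>j. a i * a (j - i)) = (\<Sum>(i, j)\<in>{(i, j). i + j \<le> n}. a i * a j)"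
      by (rule sum.triangle_reindex_eq[symmetric])
    also have "\<dots> \<le> (\<Sum>(i, j)\<in>{..n} \<times> {..n}. a i * a j)"
      by (rule sum_mono2) (auto simp: nonneg)
    also have "\<dots> = (\<Sum>j\<le>n. a j) * (\<Sum>j\<le>n. a j)"
      by (simp add: sum_product sum.cartesian_product)
    also have "\<dots> \<le> x * x"
      using Suc x0 nonneg by (intro mult_mono) (auto intro: sum_nonneg)
    finally show ?case
      using x y by (simp add: power2_eq_square mult_left_mono)
  qed
  have bound': "sum a {..<n} \<le> x" for n
    by (rule order_trans[OF sum_mono2 bound[of n]]) (auto simp: nonneg)
  show sm: "summable a"
    by (rule summableI_nonneg_bounded[OF nonneg bound'])
  have "suminf a \<le> x"
    by (rule suminf_le_const[OF sm bound'])
  then show "(\<Sum>n. a (Suc n)) \<le> 2 / (1 + sqrt (1 - 4 * y)) - 1"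
    using suminf_split_head[OF sm] a0 by (simp add: x_def r_def)
qed

text \<open>What remains of the Hilbert space setting: \<open>P_commutant\<close> places the
  projections in the bicommutant of \<open>A\<close>, \<open>pinching\<close> is their orthogonality
  in norm form, and \<open>norm_exp_JH\<close> is the self-adjointness of the full
  Hamiltonian.\<close>

locale bloch = hermitian_evolution J A for J A :: "'b::{real_normed_algebra_1, banach}" +
  fixes V :: 'b and m :: nat and P :: "nat \<Rightarrow> 'b" and S :: "nat \<Rightarrow> real set"
    and f :: "real \<Rightarrow> complex" and \<gamma> \<eta> :: real
  assumes VJ: "V * J = J * V"
    and P_spectral: "\<And>k. k < m \<Longrightarrow> spectral_bound (P k) (S k)"
    and P_idem: "\<And>k. k < m \<Longrightarrow> P k * P k = P k"
    and P_orth: "\<And>k l. k < m \<Longrightarrow> l < m \<Longrightarrow> k \<noteq> l \<Longrightarrow> P k * P l = 0"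
    and P_sum: "(\<Sum>k<m. P k) = 1"
    and P_commutant: "\<And>k X. k < m \<Longrightarrow> X * A = A * X \<Longrightarrow> X * P k = P k * X"
    and pinching: "\<And>X. norm (\<Sum>k<m. P k * X * P k) \<le> norm X"
    and gap: "\<And>k l y z. k < m \<Longrightarrow> l < m \<Longrightarrow> k \<noteq> l \<Longrightarrow> y \<in> S k \<Longrightarrow> z \<in> S l \<Longrightarrow> \<bar>y - z\<bar> \<ge> \<eta>"
    and eta_pos: "\<eta> > 0"
    and f_L1: "integrable lborel f"
    and f_hat: "\<And>s. \<bar>s\<bar> \<ge> \<eta> \<Longrightarrow>
      (LINT t|lborel. f t * exp (- \<i> * complex_of_real (s * t))) = 1 / complex_of_real s"
    and gamma_pos: "\<gamma> > 0" and gamma_large: "\<gamma> > 4 * pi * norm V / \<eta>"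
    and norm_exp_JH: "\<And>t. norm (exp (t *\<^sub>R (J * (\<gamma> *\<^sub>R A + V)))) \<le> 1"
begin

lemma P_comm: "k < m \<Longrightarrow> P k * A = A * P k" "k < m \<Longrightarrow> P k * J = J * P k"
  using P_spectral by (simp_all add: spectral_bound_def)

lemma norm_P: "k < m \<Longrightarrow> norm (P k) \<le> 1"
  using P_spectral norm_spectral_bound by blast

lemma block_decomposition: "X = (\<Sum>k<m. \<Sum>l<m. P k * X * P l)"
proof -
  have "X = (\<Sum>k<m. P k) * X * (\<Sum>l<m. P l)"
    by (simp add: P_sum)
  then show ?thesis
    by (simp only: sum_distrib_right) (simp only: sum_distrib_left)
qed

lemma P_kronecker: "k < m \<Longrightarrow> l < m \<Longrightarrow> P k * P l = (if k = l then P k else 0)"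
  by (simp add: P_idem P_orth)

section \<open>Off-diagonal solutions of the commutator equation\<close>

text \<open>The diagonal blocks of \<open>Z\<close> vanish, and for every other block the two parts
  of the spectrum are \<eta> apart, so the block solutions add up. The projections commute with
  \<open>A\<close> and \<open>J\<close> and therefore pass through the integral, which stays
  off-diagonal.\<close>

lemma off_diagonal_sylvester:
  assumes g: "integrable lborel g"
    and g_hat: "\<And>s. \<bar>s\<bar> \<ge> \<eta> \<Longrightarrow>
      (LINT t|lborel. g t * exp (- \<i> * complex_of_real (s * t))) = 1 / complex_of_real s"
    and ZJ: "Z * J = J * Z" and off: "\<And>k. k < m \<Longrightarrow> P k * Z * P k = 0"
  shows "twirl g Z integrable_on UNIV"
    and "A * integral UNIV (twirl g Z) - integral UNIV (twirl g Z) * A = Z"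
    and "\<And>k. k < m \<Longrightarrow> P k * integral UNIV (twirl g Z) * P k = 0"
proof -
  have block: "twirl g (P k * Z * P l) integrable_on UNIV \<and>
      A * integral UNIV (twirl g (P k * Z * P l)) - integral UNIV (twirl g (P k * Z * P l)) * A = P k * Z * P l"
    if k: "k < m" and l: "l < m" for k l
  proof (cases "k = l")
    case True
    with off[OF k] have "P k * Z * P l = 0" by simp
    moreover have "twirl g 0 = (\<lambda>t. 0)"
      by (simp add: twirl_def fun_eq_iff)
    ultimately show ?thesis by (simp add: integrable_0)
  next
    case False
    have "P k * Z * P l = P k * (P k * Z * P l) * P l"
      using P_idem[OF k] P_idem[OF l] by (metis mult.assoc)
    moreover have "P k * Z * P l * J = J * (P k * Z * P l)"
      using P_comm[OF k] P_comm[OF l] ZJ by (metis mult.assoc)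
    ultimately show ?thesis
      using sylvester_equation[OF P_spectral[OF k] P_spectral[OF l] gap[OF k l False] eta_pos g g_hat] by blast
  qed
  have eq: "twirl g Z = (\<lambda>t. \<Sum>k<m. \<Sum>l<m. twirl g (P k * Z * P l) t)"
    by (rule ext, subst block_decomposition[of Z]) (simp only: twirl_sum)
  show int: "twirl g Z integrable_on UNIV"
    unfolding eq using block by (intro integrable_sum) auto
  have "integral UNIV (twirl g Z) = (\<Sum>k<m. \<Sum>l<m. integral UNIV (twirl g (P k * Z * P l)))"
  proof -
    have "integral UNIV (twirl g Z) = (\<Sum>k<m. integral UNIV (\<lambda>t. \<Sum>l<m. twirl g (P k * Z * P l) t))"
      unfolding eq using block by (intro Henstock_Kurzweil_Integration.integral_sum integrable_sum) auto
    also have "\<dots> = (\<Sum>k<m. \<Sum>l<m. integral UNIV (twirl g (P k * Z * P l)))"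
      using block by (intro sum.cong refl Henstock_Kurzweil_Integration.integral_sum) auto
    finally show ?thesis .
  qed
  then have "A * integral UNIV (twirl g Z) - integral UNIV (twirl g Z) * A =
      (\<Sum>k<m. \<Sum>l<m. A * integral UNIV (twirl g (P k * Z * P l)) - integral UNIV (twirl g (P k * Z * P l)) * A)"
    by (simp only: sum_distrib_left sum_distrib_right sum_subtractf)
  also have "\<dots> = (\<Sum>k<m. \<Sum>l<m. P k * Z * P l)"
    using block by (intro sum.cong refl) auto
  finally show "A * integral UNIV (twirl g Z) - integral UNIV (twirl g Z) * A = Z"
    using block_decomposition[of Z] by simp
  fix k assume k: "k < m"
  have "P k * twirl g Z t * P k = 0" for t
    using twirl_mult[OF P_comm[OF k] P_comm[OF k], of g Z t] off[OF k] by (simp add: twirl_def)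
  then show "P k * integral UNIV (twirl g Z) * P k = 0"
    using integral_mult_both[OF int, of "P k" "P k"] by simp
qed

text \<open>Source of uniqueness: by \<open>P_commutant\<close>, an element commuting with
  \<open>A\<close> commutes with every projection, so only its diagonal blocks can survive.\<close>

lemma off_diagonal_commutant_trivial:
  assumes "D * A = A * D" and off: "\<And>k. k < m \<Longrightarrow> P k * D * P k = 0"
  shows "D = 0"
proof -
  have "P k * D * P l = 0" if "k < m" "l < m" for k l
  proof (cases "k = l")
    case False
    have "P k * D * P l = D * (P k * P l)"
      using P_commutant[OF that(1) assms(1)] by (simp add: mult.assoc[symmetric])
    then show ?thesis using P_orth[OF that False] by simp
  qed (use off that in auto)
  then show ?thesis
    by (subst block_decomposition) simp
qed

lemma norm_off_diagonal_solution:
  assumes ZJ: "Z * J = J * Z" and off: "\<And>k. k < m \<Longrightarrow> P k * Z * P k = 0"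
  shows "norm (integral UNIV (twirl f Z)) \<le> pi / (2 * \<eta>) * norm Z"
proof -
  obtain g :: "real \<Rightarrow> complex" where g: "integrable lborel g" "(LINT t|lborel. cmod (g t)) \<le> pi / (2 * \<eta>)"
    "\<And>s. \<bar>s\<bar> \<ge> \<eta> \<Longrightarrow> (LINT t|lborel. g t * exp (- \<i> * complex_of_real (s * t))) = 1 / complex_of_real s"
    using exists_reciprocal_kernel[OF eta_pos] by blast
  note F = off_diagonal_sylvester[OF f_L1 f_hat ZJ off, simplified]
    and G = off_diagonal_sylvester[OF g(1,3) ZJ off, simplified]
  have "integral UNIV (twirl f Z) - integral UNIV (twirl g Z) = 0"
  proof (rule off_diagonal_commutant_trivial)
    show "(integral UNIV (twirl f Z) - integral UNIV (twirl g Z)) * A = A * (integral UNIV (twirl f Z) - integral UNIV (twirl g Z))"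
      using F(2) G(2) by (simp add: algebra_simps)
    show "P k * (integral UNIV (twirl f Z) - integral UNIV (twirl g Z)) * P k = 0" if "k < m" for k
      using F(3)[OF that] G(3)[OF that] by (simp add: algebra_simps)
  qed
  then have "norm (integral UNIV (twirl f Z)) \<le> (LINT t|lborel. cmod (g t)) * norm Z"
    using norm_integral_twirl_le[OF g(1) G(1)] by simp
  also have "\<dots> \<le> pi / (2 * \<eta>) * norm Z"
    using g(2) by (intro mult_right_mono) auto
  finally show ?thesis .
qed

section \<open>The perturbation terms of a single block\<close>

text \<open>\<open>wave k j\<close> is \<open>\<Omega>\<^sub>k\<^sup>(\<^sup>j\<^sup>)\<close> and \<open>wave_source k j\<close> is \<open>Y\<^sub>k\<^sup>(\<^sup>j\<^sup>+\<^sup>1\<^sup>)\<close>.\<close>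

fun wave :: "nat \<Rightarrow> nat \<Rightarrow> 'b" where
  "wave k 0 = P k"
| "wave k (Suc j) = integral UNIV (twirl f ((1 - P k) *
    (- (V * wave k j) + (\<Sum>i\<in>{1..j}. wave k i * V * wave k (j - i))) * P k))"

definition wave_source :: "nat \<Rightarrow> nat \<Rightarrow> 'b"
  where "wave_source k j = - (V * wave k j) + (\<Sum>i\<in>{1..j}. wave k i * V * wave k (j - i))"

declare wave.simps(2) [simp del]

lemma wave_Suc: "wave k (Suc j) = integral UNIV (twirl f ((1 - P k) * wave_source k j * P k))"
  by (simp add: wave.simps(2) wave_source_def)

lemma P_off_diagonal_block:
  assumes "k < m" "l < m"
  shows "P l * ((1 - P k) * Y * P k) * P l = 0"
proof (cases "k = l")
  case True
  have "P k * (1 - P k) = 0"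
    using P_idem[OF assms(1)] by (simp add: right_diff_distrib)
  then show ?thesis using True by (simp add: mult.assoc[symmetric])
next
  case False
  then show ?thesis using P_orth[OF assms False] by (simp add: mult.assoc)
qed

lemma commute_J_mult: "x * J = J * x \<Longrightarrow> y * J = J * y \<Longrightarrow> x * y * J = J * (x * y)"
  by (metis mult.assoc)

lemma source_commute_J:
  assumes "k < m" "\<And>i. i \<le> j \<Longrightarrow> wave k i * J = J * wave k i"
  shows "(1 - P k) * wave_source k j * P k * J = J * ((1 - P k) * wave_source k j * P k)"
proof -
  have "(\<Sum>i\<in>{1..j}. wave k i * V * wave k (j - i)) * J = J * (\<Sum>i\<in>{1..j}. wave k i * V * wave k (j - i))"
    unfolding sum_distrib_left sum_distrib_right
    by (intro sum.cong refl commute_J_mult assms VJ) auto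
  moreover have "V * wave k j * J = J * (V * wave k j)"
    by (intro commute_J_mult assms VJ order_refl)
  ultimately have "wave_source k j * J = J * wave_source k j"
    by (simp add: wave_source_def left_diff_distrib right_diff_distrib)
  moreover have "(1 - P k) * J = J * (1 - P k)"
    using P_comm(2)[OF assms(1)] by (simp add: algebra_simps)
  ultimately show ?thesis
    using P_comm(2)[OF assms(1)] by (intro commute_J_mult)
qed

text \<open>The induction is strong because the source of one order involves all lower orders.
  Commuting with \<open>J\<close> is also a premise for the next integral to exist.\<close>

lemma wave_commute_J: "k < m \<Longrightarrow> wave k j * J = J * wave k j"
proof (induction j rule: less_induct)
  case (less j)
  show ?case
  proof (cases j)
    case 0
    then show ?thesis using P_comm(2)[OF less.prems] by simp
  next
    case (Suc i)
    have ZJ: "(1 - P k) * wave_source k i * P k * J = J * ((1 - P k) * wave_source k i * P k)"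
      using less Suc by (intro source_commute_J) auto
    show ?thesis
      unfolding Suc wave_Suc
      by (intro integral_twirl_commute_J ZJ off_diagonal_sylvester(1)[OF f_L1 f_hat ZJ]
          P_off_diagonal_block[OF less.prems])
  qed
qed

lemma source_J: "k < m \<Longrightarrow> (1 - P k) * wave_source k j * P k * J = J * ((1 - P k) * wave_source k j * P k)"
  by (intro source_commute_J wave_commute_J)

lemma wave_integrable: "k < m \<Longrightarrow> twirl f ((1 - P k) * wave_source k j * P k) integrable_on UNIV"
  by (rule off_diagonal_sylvester(1)[OF f_L1 f_hat source_J]) (auto intro: P_off_diagonal_block)

lemma wave_commutator: "k < m \<Longrightarrow> A * wave k (Suc j) - wave k (Suc j) * A = (1 - P k) * wave_source k j * P k"
  unfolding wave_Suc
  by (rule off_diagonal_sylvester(2)[OF f_L1 f_hat source_J]) (auto intro: P_off_diagonal_block)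

lemma wave_P: "k < m \<Longrightarrow> wave k j * P k = wave k j"
proof (cases j)
  case (Suc i)
  assume k: "k < m"
  let ?Z = "(1 - P k) * wave_source k i * P k"
  have eq: "twirl f ?Z t * P k = twirl f ?Z t" for t
  proof -
    have "twirl f (1 * ?Z * P k) t = 1 * twirl f ?Z t * P k"
      by (rule twirl_mult) (simp_all add: P_comm[OF k])
    moreover have "1 * ?Z * P k = ?Z"
      by (simp add: mult.assoc P_idem[OF k])
    ultimately show ?thesis by simp
  qed
  have "wave k j * P k = 1 * integral UNIV (twirl f ?Z) * P k"
    by (simp add: Suc wave_Suc)
  also have "\<dots> = integral UNIV (\<lambda>t. 1 * twirl f ?Z t * P k)"
    by (rule integral_mult_both[OF wave_integrable[OF k], symmetric])
  also have "\<dots> = wave k j"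
    by (simp add: eq Suc wave_Suc)
  finally show ?thesis .
qed (simp add: P_idem)

text \<open>Intermediate normalisation: the source of a correction takes values in the complement of
  the block, and \<open>P k\<close> passes through the integral.\<close>

lemma P_wave_Suc: "k < m \<Longrightarrow> P k * wave k (Suc j) = 0"
proof -
  assume k: "k < m"
  let ?Z = "(1 - P k) * wave_source k j * P k"
  have "P k * twirl f ?Z t = 0" for t
  proof -
    have "twirl f (P k * ?Z * 1) t = P k * twirl f ?Z t * 1"
      by (rule twirl_mult) (simp_all add: P_comm[OF k])
    moreover have "P k * (1 - P k) = 0"
      using P_idem[OF k] by (simp add: right_diff_distrib)
    then have "P k * ?Z * 1 = 0"
      by (simp add: mult.assoc[symmetric])
    ultimately show ?thesis by (simp add: twirl_def)
  qed
  then show ?thesis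
    using integral_mult_both[OF wave_integrable[OF k, of j], where C = "P k" and D = 1] by (simp add: wave_Suc)
qed

lemma wave_P_other: "k < m \<Longrightarrow> l < m \<Longrightarrow> k \<noteq> l \<Longrightarrow> wave k j * P l = 0"
  using wave_P[of k j] P_orth[of k l] by (metis mult.assoc mult_zero_right)

text \<open>The factor 1 - P k is absorbed: it fixes the products with i \<ge> 1, whose range avoids
  the block, and its effect on the term -V \<Omega> is the missing summand i = 0. Only the full
  convolution becomes a product of series after summation.\<close>

lemma wave_equation:
  assumes k: "k < m"
  shows "A * wave k (Suc j) - wave k (Suc j) * A = - (V * wave k j) + (\<Sum>i\<le>j. wave k i * V * wave k (j - i))"
proof -
  have "(1 - P k) * (wave k i * V * wave k (j - i)) * P k = wave k i * V * wave k (j - i)" if "i \<in> {1..j}" for i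
  proof -
    obtain i' where "i = Suc i'" using \<open>i \<in> {1..j}\<close> by (cases i) auto
    then have "(1 - P k) * wave k i = wave k i"
      using P_wave_Suc[OF k] by (simp add: left_diff_distrib)
    then show ?thesis
      using wave_P[OF k] by (metis mult.assoc)
  qed
  then have "(1 - P k) * (\<Sum>i\<in>{1..j}. wave k i * V * wave k (j - i)) * P k = (\<Sum>i\<in>{1..j}. wave k i * V * wave k (j - i))"
    by (simp add: sum_distrib_left sum_distrib_right)
  moreover have "(1 - P k) * (V * wave k j) * P k = V * wave k j - P k * V * wave k j"
    using wave_P[OF k, of j] by (simp add: algebra_simps)
  moreover have "(\<Sum>i\<le>j. wave k i * V * wave k (j - i)) = P k * V * wave k j + (\<Sum>i\<in>{1..j}. wave k i * V * wave k (j - i))"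
    by (simp add: atMost_atLeast0 sum.atLeast_Suc_atMost)
  moreover have "(1 - P k) * wave_source k j * P k = - ((1 - P k) * (V * wave k j) * P k)
      + (1 - P k) * (\<Sum>i\<in>{1..j}. wave k i * V * wave k (j - i)) * P k"
    unfolding wave_source_def by (simp only: distrib_left distrib_right mult_minus_left mult_minus_right)
  ultimately show ?thesis
    using wave_commutator[OF k, of j] by (simp only: minus_diff_eq) simp
qed

section \<open>Norm recursion for the terms summed over the blocks\<close>

text \<open>Summing over the blocks before taking norms keeps all bounds independent of
  \<open>m\<close>; a single block is recovered by multiplying with \<open>P k\<close> from the
  right.\<close>

definition total_wave :: "nat \<Rightarrow> 'b"
  where "total_wave j = (\<Sum>k<m. wave k j)"

lemma total_wave_0: "total_wave 0 = 1"
  by (simp add: total_wave_def P_sum)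

lemma total_wave_P: "k < m \<Longrightarrow> total_wave j * P k = wave k j"
proof -
  assume k: "k < m"
  have "total_wave j * P k = (\<Sum>l<m. if l = k then wave k j else 0)"
    unfolding total_wave_def sum_distrib_right
    using k by (intro sum.cong) (auto simp: wave_P wave_P_other)
  then show ?thesis using k by simp
qed

lemma norm_wave_le: "k < m \<Longrightarrow> norm (wave k j) \<le> norm (total_wave j)"
  using norm_mult_ineq[of "total_wave j" "P k"] mult_left_le[OF norm_P[of k] norm_ge_zero[of "total_wave j"]]
  by (simp add: total_wave_P)

text \<open>The sources are collected in one element Y, with Y P k the contribution of block k. The
  summed right-hand side is Y minus its pinching, which costs a factor 2 and turns pi / (2 \<eta>)
  into pi / \<eta>.\<close>

lemma norm_total_wave_Suc:
  "norm (total_wave (Suc j)) \<le> pi / \<eta> * norm V * (\<Sum>i\<le>j. norm (total_wave i) * norm (total_wave (j - i)))"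
proof -
  define Y where "Y = (\<Sum>k<m. wave_source k j * P k)"
  define Z where "Z = (\<Sum>k<m. (1 - P k) * wave_source k j * P k)"
  have Y_P: "Y * P k = wave_source k j * P k" if "k < m" for k
  proof -
    have "Y * P k = (\<Sum>l<m. if l = k then wave_source k j * P k else 0)"
      unfolding Y_def sum_distrib_right
      using that by (intro sum.cong) (auto simp: mult.assoc P_kronecker)
    then show ?thesis using that by simp
  qed
  have Z_Y: "Z = Y - (\<Sum>k<m. P k * Y * P k)"
    by (simp add: Z_def Y_P[simplified] mult.assoc left_diff_distrib sum_subtractf Y_def[symmetric])
  have "norm Z \<le> norm Y + norm (\<Sum>k<m. P k * Y * P k)"
    unfolding Z_Y by (rule norm_triangle_ineq4)
  with pinching[of Y] have norm_Z: "norm Z \<le> 2 * norm Y" by simp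
  \<comment> \<open>Summed over k, the products of two blocks around V factor into the full term of
    order i times a pinching, so each convolution term is bounded by one product of norms.\<close>
  have Y_eq: "Y = - (V * total_wave j) + (\<Sum>i\<in>{1..j}. total_wave i * (\<Sum>k<m. P k * (V * total_wave (j - i)) * P k))"
  proof -
    have "wave_source k j * P k = - (V * wave k j) + (\<Sum>i\<in>{1..j}. total_wave i * (P k * (V * total_wave (j - i)) * P k))"
      if k: "k < m" for k
    proof -
      have "total_wave i * (P k * (V * total_wave (j - i)) * P k) = wave k i * V * wave k (j - i)" for i
        using total_wave_P[OF k, of i] total_wave_P[OF k, of "j - i"] by (metis mult.assoc)
      moreover have "wave k i * V * wave k (j - i) * P k = wave k i * V * wave k (j - i)" for i
        by (simp add: mult.assoc wave_P[OF k])
      ultimately show ?thesis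
        by (simp add: wave_source_def left_diff_distrib sum_distrib_right wave_P[OF k] mult.assoc[of V])
    qed
    then have "Y = (\<Sum>k<m. - (V * wave k j) + (\<Sum>i\<in>{1..j}. total_wave i * (P k * (V * total_wave (j - i)) * P k)))"
      unfolding Y_def by (intro sum.cong) auto
    also have "\<dots> = - (V * total_wave j) + (\<Sum>i\<in>{1..j}. \<Sum>k<m. total_wave i * (P k * (V * total_wave (j - i)) * P k))"
      unfolding sum.distrib sum.swap[of _ "{1..j}"] by (simp add: total_wave_def sum_distrib_left sum_negf)
    finally show ?thesis
      by (simp only: sum_distrib_left)
  qed
  have "norm Y \<le> norm (V * total_wave j) + (\<Sum>i\<in>{1..j}. norm (total_wave i * (\<Sum>k<m. P k * (V * total_wave (j - i)) * P k)))"
    unfolding Y_eq by (rule norm_triangle_mono) (simp_all add: norm_sum)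
  also have "\<dots> \<le> norm V * norm (total_wave j) + (\<Sum>i\<in>{1..j}. norm V * (norm (total_wave i) * norm (total_wave (j - i))))"
  proof (intro add_mono sum_mono norm_mult_ineq)
    fix i
    have "norm (total_wave i * (\<Sum>k<m. P k * (V * total_wave (j - i)) * P k)) \<le> norm (total_wave i) * norm (V * total_wave (j - i))"
      using norm_mult_ineq mult_left_mono[OF pinching norm_ge_zero] by (rule order_trans)
    also have "\<dots> \<le> norm (total_wave i) * (norm V * norm (total_wave (j - i)))"
      by (intro mult_left_mono norm_mult_ineq norm_ge_zero)
    finally show "norm (total_wave i * (\<Sum>k<m. P k * (V * total_wave (j - i)) * P k)) \<le> norm V * (norm (total_wave i) * norm (total_wave (j - i)))"
      by (simp add: mult_ac)
  qed
  \<comment> \<open>The term -V \<Omega> joins the convolution as i = 0, because the term of order 0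
    is 1 and has norm 1.\<close>
  also have "\<dots> = norm V * (\<Sum>i\<le>j. norm (total_wave i) * norm (total_wave (j - i)))"
    by (simp add: atMost_atLeast0 sum.atLeast_Suc_atMost total_wave_0 distrib_left sum_distrib_left)
  finally have norm_Y: "norm Y \<le> norm V * (\<Sum>i\<le>j. norm (total_wave i) * norm (total_wave (j - i)))" .
  have ZJ: "Z * J = J * Z"
    unfolding Z_def sum_distrib_left sum_distrib_right by (intro sum.cong refl source_J) simp
  have off: "P l * Z * P l = 0" if "l < m" for l
    unfolding Z_def sum_distrib_left sum_distrib_right
    by (intro sum.neutral ballI P_off_diagonal_block that) simp
  have "total_wave (Suc j) = (\<Sum>k<m. integral UNIV (twirl f ((1 - P k) * wave_source k j * P k)))"
    by (simp add: total_wave_def wave_Suc)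
  also have "\<dots> = integral UNIV (\<lambda>t. \<Sum>k<m. twirl f ((1 - P k) * wave_source k j * P k) t)"
    by (rule Henstock_Kurzweil_Integration.integral_sum[symmetric]) (auto intro: wave_integrable)
  also have "\<dots> = integral UNIV (twirl f Z)"
    unfolding Z_def twirl_sum[symmetric] ..
  finally have "norm (total_wave (Suc j)) \<le> pi / (2 * \<eta>) * norm Z"
    using norm_off_diagonal_solution[OF ZJ off] by simp
  also have "\<dots> \<le> pi / (2 * \<eta>) * (2 * (norm V * (\<Sum>i\<le>j. norm (total_wave i) * norm (total_wave (j - i)))))"
    using norm_Z norm_Y eta_pos by (intro mult_left_mono) auto
  finally show ?thesis
    by (simp add: mult_ac)
qed


section \<open>Summed wave operators and the Bloch Hamiltonian\<close>

definition H :: 'b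
  where "H = \<gamma> *\<^sub>R A + V"

definition wave_op :: "nat \<Rightarrow> 'b"
  where "wave_op k = (\<Sum>j. (1 / \<gamma> ^ j) *\<^sub>R wave k j)"

definition total_wave_op :: 'b
  where "total_wave_op = (\<Sum>k<m. wave_op k)"

definition bloch_hamiltonian :: 'b
  where "bloch_hamiltonian = (\<Sum>k<m. P k * H * wave_op k)"

definition coupling :: real
  where "coupling = pi * (norm V / (\<gamma> * \<eta>))"

lemma coupling_bounds: "0 \<le> coupling" "4 * coupling < 1"
proof -
  show "0 \<le> coupling" using gamma_pos eta_pos by (simp add: coupling_def)
  have "4 * pi * norm V < \<gamma> * \<eta>"
    using gamma_large eta_pos by (simp add: pos_divide_less_eq)
  then show "4 * coupling < 1"
    using gamma_pos eta_pos by (simp add: coupling_def pos_divide_less_eq)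
qed

text \<open>The norms divided by \<gamma>^j satisfy the Catalan recursion: the additional power of
  \<gamma> at order j + 1 is absorbed into \<open>coupling\<close>.\<close>

lemma total_wave_series:
  "summable (\<lambda>j. norm ((1 / \<gamma> ^ j) *\<^sub>R total_wave j))"
  "(\<Sum>j. norm ((1 / \<gamma> ^ Suc j) *\<^sub>R total_wave (Suc j))) \<le> 2 / (1 + sqrt (1 - 4 * coupling)) - 1"
proof -
  let ?a = "\<lambda>j. norm ((1 / \<gamma> ^ j) *\<^sub>R total_wave j)"
  have a: "?a j = norm (total_wave j) / \<gamma> ^ j" for j
    using gamma_pos by simp
  have "?a (Suc n) \<le> coupling * (\<Sum>i\<le>n. ?a i * ?a (n - i))" for n
  proof -
    have pow: "\<gamma> ^ i * \<gamma> ^ (n - i) = \<gamma> ^ n" if "i \<le> n" for i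
      using that by (simp flip: power_add)
    have "?a (Suc n) \<le> pi / \<eta> * norm V * (\<Sum>i\<le>n. norm (total_wave i) * norm (total_wave (n - i))) / \<gamma> ^ Suc n"
      unfolding a using gamma_pos norm_total_wave_Suc by (intro divide_right_mono) auto
    also have "\<dots> = coupling * ((\<Sum>i\<le>n. norm (total_wave i) * norm (total_wave (n - i))) / \<gamma> ^ n)"
      by (simp add: coupling_def mult_ac)
    also have "(\<Sum>i\<le>n. norm (total_wave i) * norm (total_wave (n - i))) / \<gamma> ^ n = (\<Sum>i\<le>n. ?a i * ?a (n - i))"
      unfolding a sum_divide_distrib by (intro sum.cong refl) (simp add: pow)
    finally show ?thesis .
  qed
  from catalan_majorant[of ?a, OF _ _ this coupling_bounds]
  show "summable ?a" "(\<Sum>j. ?a (Suc j)) \<le> 2 / (1 + sqrt (1 - 4 * coupling)) - 1"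
    by (simp_all add: total_wave_0)
qed

lemma summable_norm_wave: "k < m \<Longrightarrow> summable (\<lambda>j. norm ((1 / \<gamma> ^ j) *\<^sub>R wave k j))"
  by (rule summable_comparison_test[OF _ total_wave_series(1)])
    (use gamma_pos in \<open>auto simp: norm_wave_le divide_right_mono\<close>)

lemma summable_wave: "k < m \<Longrightarrow> summable (\<lambda>j. (1 / \<gamma> ^ j) *\<^sub>R wave k j)"
  by (rule summable_norm_cancel[OF summable_norm_wave])

lemma wave_op_P: "k < m \<Longrightarrow> wave_op k * P k = wave_op k"
  unfolding wave_op_def by (subst suminf_mult2[OF summable_wave]) (simp_all add: wave_P)

lemma wave_op_P_other: "k < m \<Longrightarrow> l < m \<Longrightarrow> k \<noteq> l \<Longrightarrow> wave_op k * P l = 0"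
  using wave_op_P[of k] P_orth[of k l] by (metis mult.assoc mult_zero_right)

lemma P_wave_op: "k < m \<Longrightarrow> P k * wave_op k = P k"
proof -
  assume k: "k < m"
  have "P k * ((1 / \<gamma> ^ j) *\<^sub>R wave k j) = (if j = 0 then P k else 0)" for j
    using P_wave_Suc[OF k] P_idem[OF k] by (cases j) simp_all
  then have "P k * wave_op k = (\<Sum>j. if j = 0 then P k else 0)"
    unfolding wave_op_def by (simp add: suminf_mult[OF summable_wave[OF k], symmetric])
  also have "\<dots> = P k"
    using suminf_finite[of "{0}" "\<lambda>j. if j = 0 then P k else 0"] by simp
  finally show ?thesis .
qed

text \<open>The equations of all orders, divided by \<gamma>^j, are added: the shift by one order on
  the left accounts for the factor \<gamma>, and the convolution is a Cauchy product of absolutely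
  convergent series.\<close>

lemma wave_op_riccati:
  assumes k: "k < m"
  shows "\<gamma> *\<^sub>R (A * wave_op k - wave_op k * A) = wave_op k * V * wave_op k - V * wave_op k"
proof -
  define b where "b j = (1 / \<gamma> ^ j) *\<^sub>R wave k j" for j
  have b_sum: "b sums wave_op k"
    unfolding b_def wave_op_def using summable_wave[OF k] by (rule summable_sums)
  have b_norm: "summable (\<lambda>j. norm (b j))"
    unfolding b_def by (rule summable_norm_wave[OF k])
  \<comment> \<open>The shifted series lacks the term P k of order 0, which commutes with
    \<open>A\<close> and so does not affect the commutator.\<close>
  have "(\<lambda>j. b (Suc j)) sums (wave_op k - P k)"
    using sums_Suc_iff[of b "wave_op k - P k"] b_sum by (simp add: b_def)
  then have ser: "(\<lambda>j. \<gamma> *\<^sub>R (A * b (Suc j) - b (Suc j) * A)) sums (\<gamma> *\<^sub>R (A * (wave_op k - P k) - (wave_op k - P k) * A))"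
    by (intro sums_scaleR_right sums_diff sums_mult sums_mult2)
  have step: "\<gamma> *\<^sub>R (A * b (Suc j) - b (Suc j) * A) = (\<Sum>i\<le>j. (b i * V) * b (j - i)) - V * b j" for j
  proof -
    have "\<gamma> *\<^sub>R (A * b (Suc j) - b (Suc j) * A) = (1 / \<gamma> ^ j) *\<^sub>R (A * wave k (Suc j) - wave k (Suc j) * A)"
      using gamma_pos by (simp add: b_def scaleR_diff_right)
    also have "\<dots> = (\<Sum>i\<le>j. (1 / \<gamma> ^ j) *\<^sub>R (wave k i * V * wave k (j - i))) - V * b j"
      unfolding wave_equation[OF k] by (simp add: b_def scaleR_diff_right scaleR_sum_right)
    also have "(1 / \<gamma> ^ j) *\<^sub>R (wave k i * V * wave k (j - i)) = (b i * V) * b (j - i)" if "i \<le> j" for i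
      using that by (simp add: b_def flip: power_add)
    then have "(\<Sum>i\<le>j. (1 / \<gamma> ^ j) *\<^sub>R (wave k i * V * wave k (j - i))) = (\<Sum>i\<le>j. (b i * V) * b (j - i))"
      by (intro sum.cong) auto
    finally show ?thesis .
  qed
  have lhs: "(\<lambda>j. (\<Sum>i\<le>j. (b i * V) * b (j - i)) - V * b j) sums (\<gamma> *\<^sub>R (A * wave_op k - wave_op k * A))"
  proof -
    have "A * (wave_op k - P k) - (wave_op k - P k) * A = A * wave_op k - wave_op k * A"
      using P_comm(1)[OF k] by (simp add: algebra_simps)
    then show ?thesis
      using ser step by (simp only:)
  qed
  have "summable (\<lambda>j. norm (b j * V))"
    by (rule summable_comparison_test[OF _ summable_mult2[OF b_norm, of "norm V"]]) (auto simp: norm_mult_ineq)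
  from Cauchy_product_sums[OF this b_norm]
  have "(\<lambda>j. \<Sum>i\<le>j. (b i * V) * b (j - i)) sums (wave_op k * V * wave_op k)"
    using sums_unique[OF b_sum] sums_unique[OF sums_mult2[OF b_sum, of V]] by simp
  from sums_diff[OF this sums_mult[OF b_sum, of V]]
  have "(\<lambda>j. (\<Sum>i\<le>j. (b i * V) * b (j - i)) - V * b j) sums (wave_op k * V * wave_op k - V * wave_op k)" .
  with lhs show ?thesis
    by (rule sums_unique2)
qed

text \<open>The Bloch equation. By \<Omega>_k P k = \<Omega>_k and P k \<Omega>_k = P k, the
  operator \<Omega>_k is an oblique projection with \<Omega>_k A \<Omega>_k = \<Omega>_k A; the
  Riccati equation then says that its range is invariant under \<open>H\<close>.\<close>

lemma H_wave_op: "k < m \<Longrightarrow> H * wave_op k = wave_op k * H * wave_op k"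
proof -
  assume k: "k < m"
  have "wave_op k * A * wave_op k = wave_op k * (P k * A) * wave_op k"
    using wave_op_P[OF k] by (simp add: mult.assoc[symmetric])
  also have "\<dots> = wave_op k * A * (P k * wave_op k)"
    using P_comm(1)[OF k] by (simp add: mult.assoc)
  also have "\<dots> = wave_op k * (P k * A)"
    using P_wave_op[OF k] P_comm(1)[OF k] by (simp add: mult.assoc)
  also have "\<dots> = wave_op k * A"
    using wave_op_P[OF k] by (simp add: mult.assoc[symmetric])
  finally have "wave_op k * A * wave_op k = wave_op k * A" .
  then show ?thesis
    using wave_op_riccati[OF k] by (simp add: H_def algebra_simps)
qed

lemma total_wave_op_P: "k < m \<Longrightarrow> total_wave_op * P k = wave_op k"
proof -
  assume k: "k < m"
  have "total_wave_op * P k = (\<Sum>l<m. if l = k then wave_op k else 0)"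
    unfolding total_wave_op_def sum_distrib_right
    using k by (intro sum.cong) (auto simp: wave_op_P wave_op_P_other)
  then show ?thesis using k by simp
qed

text \<open>Blockwise, \<Omega> P k = \<Omega>_k turns the summand P k H \<Omega>_k into \<Omega>_k
  H \<Omega>_k, which is H \<Omega>_k by the Bloch equation.\<close>

lemma intertwining: "H * total_wave_op = total_wave_op * bloch_hamiltonian"
proof -
  have "total_wave_op * (P k * H * wave_op k) = H * wave_op k" if "k < m" for k
    using total_wave_op_P[OF that] H_wave_op[OF that] by (simp add: mult.assoc[symmetric])
  then have "total_wave_op * bloch_hamiltonian = (\<Sum>k<m. H * wave_op k)"
    unfolding bloch_hamiltonian_def sum_distrib_left by (intro sum.cong) auto
  then show ?thesis
    by (simp add: total_wave_op_def sum_distrib_left)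
qed

lemma bloch_hamiltonian_commute: "k < m \<Longrightarrow> bloch_hamiltonian * P k = P k * bloch_hamiltonian"
proof -
  assume k: "k < m"
  have "bloch_hamiltonian * P k = (\<Sum>l<m. if l = k then P k * H * wave_op k else 0)"
    unfolding bloch_hamiltonian_def sum_distrib_right
    using k by (intro sum.cong) (auto simp: mult.assoc wave_op_P wave_op_P_other)
  moreover have "P k * bloch_hamiltonian = (\<Sum>l<m. if l = k then P k * H * wave_op k else 0)"
    unfolding bloch_hamiltonian_def sum_distrib_left
    using k by (intro sum.cong) (auto simp: mult.assoc[symmetric] P_kronecker)
  ultimately show ?thesis by simp
qed

lemma norm_total_wave_op_minus_1: "norm (1 - total_wave_op) \<le> 2 / (1 + sqrt (1 - 4 * coupling)) - 1"
proof -
  let ?b = "\<lambda>j. (1 / \<gamma> ^ j) *\<^sub>R total_wave j"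
  have sm: "summable ?b"
    by (rule summable_norm_cancel[OF total_wave_series(1)])
  have "total_wave_op = (\<Sum>j. ?b j)"
    unfolding total_wave_op_def wave_op_def total_wave_def scaleR_sum_right
    by (rule suminf_sum[symmetric]) (simp add: summable_wave)
  also have "\<dots> = 1 + (\<Sum>j. ?b (Suc j))"
    using suminf_split_head[OF sm] by (simp add: total_wave_0)
  finally have "norm (1 - total_wave_op) = norm (\<Sum>j. ?b (Suc j))"
    by simp
  also have "\<dots> \<le> (\<Sum>j. norm (?b (Suc j)))"
    by (rule summable_norm) (use total_wave_series(1) in \<open>simp only: summable_Suc_iff[of "\<lambda>j. norm (?b j)"]\<close>)
  also have "\<dots> \<le> 2 / (1 + sqrt (1 - 4 * coupling)) - 1"
    by (rule total_wave_series(2))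
  finally show ?thesis .
qed

lemma total_wave_op_J: "total_wave_op * J = J * total_wave_op"
proof -
  have "wave_op k * J = J * wave_op k" if "k < m" for k
    unfolding wave_op_def suminf_mult2[OF summable_wave[OF that]] suminf_mult[OF summable_wave[OF that], symmetric]
    by (simp add: wave_commute_J[OF that])
  then show ?thesis
    by (simp add: total_wave_op_def sum_distrib_left sum_distrib_right)
qed

theorem bloch_theorem:
  obtains W' where "total_wave_op * W' = 1" "W' * total_wave_op = 1"
    "bloch_hamiltonian = W' * H * total_wave_op"
    "\<And>t. norm (exp ((- t) *\<^sub>R (J * H)) - exp ((- t) *\<^sub>R (J * bloch_hamiltonian)))
      \<le> 1 / sqrt (1 - 4 * pi * (norm V / (\<gamma> * \<eta>))) - 1"
proof -
  let ?W = total_wave_op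
  define r where "r = sqrt (1 - 4 * coupling)"
  have r: "r > 0" using coupling_bounds by (simp add: r_def)
  define d where "d = norm (1 - ?W)"
  have d: "0 \<le> d" "d \<le> 2 / (1 + r) - 1"
    using norm_total_wave_op_minus_1 by (simp_all add: d_def r_def)
  have lt1: "2 / (1 + r) - 1 < 1" using r by (simp add: field_simps)
  with d have "norm (1 - ?W) < 1" by (simp add: d_def)
  then obtain W' where W': "W' * ?W = 1" "?W * W' = 1" "norm W' \<le> 1 / (1 - d)"
    using norm_lt_one_imp_invertible unfolding d_def by blast
  have HB: "bloch_hamiltonian = W' * H * ?W"
  proof -
    have "W' * H * ?W = W' * (?W * bloch_hamiltonian)"
      by (simp add: mult.assoc intertwining)
    then show ?thesis by (simp add: mult.assoc[symmetric] W')
  qed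
  \<comment> \<open>Needed to move the factor \<open>J\<close> of the exponent inside the
    conjugation.\<close>
  have W'J: "W' * J = J * W'"
  proof -
    have "W' * J = W' * (J * ?W) * W'" by (simp add: mult.assoc W')
    also have "\<dots> = (W' * ?W) * J * W'" by (simp only: total_wave_op_J[symmetric] mult.assoc)
    finally show ?thesis by (simp add: W')
  qed
  have "norm (exp ((- t) *\<^sub>R (J * H)) - exp ((- t) *\<^sub>R (J * bloch_hamiltonian))) \<le> 1 / r - 1" for t
  proof -
    let ?e = "exp ((- t) *\<^sub>R (J * H))"
    have "(- t) *\<^sub>R (J * bloch_hamiltonian) = (- t) *\<^sub>R ((J * W') * H * ?W)"
      by (simp add: HB mult.assoc)
    also have "\<dots> = W' * ((- t) *\<^sub>R (J * H)) * ?W"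
      by (simp add: W'J[symmetric] mult.assoc)
    finally have "exp ((- t) *\<^sub>R (J * bloch_hamiltonian)) = W' * ?e * ?W"
      by (simp only: exp_conjugate[OF W'(1,2)])
    then have "?e - exp ((- t) *\<^sub>R (J * bloch_hamiltonian)) = W' * ?W * ?e - W' * ?e * ?W"
      by (simp add: W')
    also have "\<dots> = W' * (?e * (1 - ?W) - (1 - ?W) * ?e)"
      by (simp add: algebra_simps)
    finally have eq: "?e - exp ((- t) *\<^sub>R (J * bloch_hamiltonian)) = W' * (?e * (1 - ?W) - (1 - ?W) * ?e)" .
    have ne: "norm ?e \<le> 1" using norm_exp_JH[of "- t"] by (simp add: H_def)
    have "norm (?e * (1 - ?W)) \<le> d" "norm ((1 - ?W) * ?e) \<le> d"
      using norm_mult_ineq[of ?e "1 - ?W"] norm_mult_ineq[of "1 - ?W" ?e]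
        mult_right_mono[OF ne norm_ge_zero[of "1 - ?W"]] mult_left_mono[OF ne norm_ge_zero[of "1 - ?W"]]
      by (simp_all add: d_def)
    then have "norm (?e * (1 - ?W) - (1 - ?W) * ?e) \<le> 2 * d"
      using norm_triangle_ineq4[of "?e * (1 - ?W)" "(1 - ?W) * ?e"] by simp
    then have "norm W' * norm (?e * (1 - ?W) - (1 - ?W) * ?e) \<le> 1 / (1 - d) * (2 * d)"
      using W'(3) d lt1 by (intro mult_mono) auto
    then have "norm (?e - exp ((- t) *\<^sub>R (J * bloch_hamiltonian))) \<le> 2 * d / (1 - d)"
      unfolding eq using norm_mult_ineq order_trans by fastforce
    also have "\<dots> \<le> 2 * (2 / (1 + r) - 1) / (1 - (2 / (1 + r) - 1))"
      using d lt1 by (intro frac_le) auto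
    also have "\<dots> = 1 / r - 1"
      using r by (simp add: divide_simps)
    finally show ?thesis .
  qed
  moreover have "4 * coupling = 4 * pi * (norm V / (\<gamma> * \<eta>))"
    by (simp add: coupling_def)
  ultimately show thesis
    using that[OF W'(2,1) HB] by (simp add: r_def)
qed

end

section \<open>Self-adjoint operators and their spectral projections\<close>

lemma blinfun_eq_iff: "A = B \<longleftrightarrow> (\<forall>x. blinfun_apply A x = blinfun_apply B x)"
  by (auto intro: blinfun_eqI)

lemma oper_sum: "oper (\<Sum>i\<in>I. x i) = (\<Sum>i\<in>I. oper (x i))"
  by (rule linear_sum[OF bounded_linear.linear[OF bounded_linear_oper]])

lemma scal_sum: "scal (\<Sum>i\<in>I. x i) = (\<Sum>i\<in>I. scal (x i))"
  by (rule linear_sum[OF bounded_linear.linear[OF bounded_linear_scal]])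

lemma oper_alg_poly: "oper (alg_poly p x) = op_poly p (oper x)"
  by (simp add: alg_poly_def op_poly_def oper_sum)

lemma scal_alg_poly: "scal (alg_poly p (Bop (of_real c) B)) = of_real (poly p c)"
  by (simp add: alg_poly_def scal_sum poly_altdef) (simp add: scaleR_conv_of_real)

lemma op_poly_conv_bop: "op_poly p A = oper (alg_poly p (Bop 0 A))"
  by (simp add: oper_alg_poly)

lemma op_poly_pCons: "op_poly (pCons a p) A = a *\<^sub>R id_blinfun + (A o\<^sub>L op_poly p A)"
  by (simp add: op_poly_conv_bop alg_poly_pCons)

lemma op_poly_0 [simp]: "op_poly 0 A = 0"
  by (simp add: op_poly_conv_bop)

lemma op_poly_add: "op_poly (p + q) A = op_poly p A + op_poly q A"
  by (simp add: op_poly_conv_bop alg_poly_add)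

lemma op_poly_sum: "op_poly (\<Sum>i\<in>I. p i) A = (\<Sum>i\<in>I. op_poly (p i) A)"
  by (simp add: op_poly_conv_bop alg_poly_sum oper_sum)

lemma op_poly_smult: "op_poly (smult c p) A = c *\<^sub>R op_poly p A"
  by (simp add: op_poly_conv_bop alg_poly_smult)

lemma op_poly_mult: "op_poly (p * q) A = op_poly p A o\<^sub>L op_poly q A"
  by (simp add: op_poly_conv_bop alg_poly_mult)

lemma op_poly_commute:
  assumes "X o\<^sub>L A = A o\<^sub>L X"
  shows "X o\<^sub>L op_poly p A = op_poly p A o\<^sub>L X"
proof -
  have "Bop 0 X * Bop 0 A = Bop 0 A * Bop 0 X"
    using assms by (simp add: bop_eq_iff)
  from arg_cong[OF alg_poly_commute[OF this, of p], of oper] show ?thesis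
    by (simp add: op_poly_conv_bop)
qed

lemma op_poly_commute_apply:
  "X o\<^sub>L A = A o\<^sub>L X \<Longrightarrow> X (op_poly p A x) = op_poly p A (X x)"
  using op_poly_commute[of X A p] by (metis blinfun_apply_blinfun_compose)

text \<open>Lifted with scalar part 1, the operator has the same distance from 1 in the algebra,
  where the Neumann series is at hand.\<close>

lemma op_invertible_if_near_id:
  fixes T :: "'a::{real_inner, complete_space} \<Rightarrow>\<^sub>L 'a"
  assumes "norm (id_blinfun - T) < 1"
  shows "op_invertible T"
proof -
  have "norm (1 - Bop 1 T) < 1"
    using assms by (simp add: norm_bop_def)
  then obtain v where "v * Bop 1 T = 1" "Bop 1 T * v = 1"
    using norm_lt_one_imp_invertible by blast
  then have "oper v o\<^sub>L T = id_blinfun" "T o\<^sub>L oper v = id_blinfun"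
    by (simp_all add: bop_eq_iff)
  then show ?thesis
    unfolding op_invertible_def by blast
qed

lemma op_invertible_scaleR_cancel:
  assumes "op_invertible (s *\<^sub>R T)"
  shows "op_invertible T"
proof -
  obtain B where B: "(s *\<^sub>R T) o\<^sub>L B = id_blinfun" "B o\<^sub>L (s *\<^sub>R T) = id_blinfun"
    using assms unfolding op_invertible_def by blast
  have "T o\<^sub>L (s *\<^sub>R B) = id_blinfun" "(s *\<^sub>R B) o\<^sub>L T = id_blinfun"
    using B by (simp_all add: blinfun_eq_iff blinfun.bilinear_simps)
  then show ?thesis
    unfolding op_invertible_def by blast
qed

section \<open>Complex structure, spectrum and evolution of self-adjoint operators\<close>

lemma complex_structure_apply:
  assumes "complex_structure J"
  shows "J (J x) = - x" and "inner (J x) (J y) = inner x y" and "inner (J x) y = - inner x (J y)"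
    and "inner x (J x) = 0" and "norm (J x) = norm x"
proof -
  have "(J o\<^sub>L J) x = (- id_blinfun) x" for x
    using assms by (simp only: complex_structure_def)
  then show JJ: "J (J x) = - x" for x
    by (simp add: blinfun.minus_left)
  show iso: "inner (J x) (J y) = inner x y" for x y
    using assms by (simp add: complex_structure_def)
  show skew: "inner (J x) y = - inner x (J y)" for x y
    using iso[of x "J y"] by (simp add: JJ)
  show "inner x (J x) = 0"
    using skew[of x x] by (simp add: inner_commute)
  show "norm (J x) = norm x"
    by (simp add: norm_eq_sqrt_inner iso)
qed

lemma selfadjoint_apply:
  assumes "selfadjoint_op J A"
  shows "inner (A x) y = inner x (A y)" and "A (J x) = J (A x)"
proof -
  show "inner (A x) y = inner x (A y)"
    using assms by (simp add: selfadjoint_op_def)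
  have "(A o\<^sub>L J) x = (J o\<^sub>L A) x"
    using assms by (simp only: selfadjoint_op_def clinear_op_def)
  then show "A (J x) = J (A x)" by simp
qed

text \<open>\<open>J\<close> composed with \<open>A\<close> is skew-adjoint. Real spectrum, norm
  conservation and the vanishing of cross terms all rest on this.\<close>

lemma selfadjoint_skew:
  assumes "complex_structure J" "selfadjoint_op J A"
  shows "inner (J (A x)) x = 0"
  using complex_structure_apply(3)[OF assms(1), of "A x" x] selfadjoint_apply[OF assms(2)]
  by (simp add: inner_commute)

lemma selfadjoint_op_add_scaleR:
  "selfadjoint_op J A \<Longrightarrow> selfadjoint_op J B \<Longrightarrow> selfadjoint_op J (c *\<^sub>R A + B)"
  unfolding selfadjoint_op_def clinear_op_def
  by (auto simp: blinfun.bilinear_simps inner_add_left inner_add_right blinfun_eq_iff)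

text \<open>For suitable s the map x - s T x is a strict contraction, so s T is within distance less
  than 1 of the identity. The sign of b is free because s carries it.\<close>

lemma coercive_imp_invertible:
  fixes T :: "'a::{real_inner, complete_space} \<Rightarrow>\<^sub>L 'a"
  assumes b: "b \<noteq> 0" and T: "\<And>x. inner (T x) x = b * (norm x)\<^sup>2"
  shows "op_invertible T"
proof -
  define K where "K = norm T + \<bar>b\<bar>"
  have K: "K > 0" "\<bar>b\<bar> \<le> K" "norm T \<le> K"
    using b by (simp_all add: K_def add_nonneg_pos)
  \<comment> \<open>The minimiser of 1 - 2 s b + s^2 K^2; the minimum is 1 - q.\<close>
  define s where "s = b / K\<^sup>2"
  have s: "s \<noteq> 0" using b K by (simp add: s_def)
  define q where "q = b\<^sup>2 / K\<^sup>2"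
  have q: "0 < q" "q \<le> 1"
    using b K by (auto simp: q_def power2_le_iff_abs_le)
  have "norm (id_blinfun - s *\<^sub>R T) \<le> sqrt (1 - q)"
  proof (rule norm_blinfun_bound)
    fix x
    have "(norm ((id_blinfun - s *\<^sub>R T) x))\<^sup>2 = (norm x)\<^sup>2 - 2 * s * inner (T x) x + s\<^sup>2 * (norm (T x))\<^sup>2"
      unfolding power2_norm_eq_inner
      by (simp add: blinfun.bilinear_simps inner_diff_left inner_diff_right inner_commute power2_eq_square algebra_simps)
    also have "2 * s * inner (T x) x = 2 * q * (norm x)\<^sup>2"
      by (simp add: T s_def q_def power2_eq_square)
    also have "s\<^sup>2 * (norm (T x))\<^sup>2 \<le> s\<^sup>2 * (K * norm x)\<^sup>2"
      using norm_blinfun[of T x] mult_right_mono[OF K(3) norm_ge_zero[of x]]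
      by (intro mult_left_mono power_mono) auto
    also have "s\<^sup>2 * (K * norm x)\<^sup>2 = q * (norm x)\<^sup>2"
      using K by (simp add: s_def q_def power_mult_distrib power_divide power2_eq_square)
    finally have "(norm ((id_blinfun - s *\<^sub>R T) x))\<^sup>2 \<le> (1 - q) * (norm x)\<^sup>2"
      by (simp add: algebra_simps)
    also have "\<dots> = (sqrt (1 - q) * norm x)\<^sup>2"
      using q by (simp add: power_mult_distrib)
    finally show "norm ((id_blinfun - s *\<^sub>R T) x) \<le> sqrt (1 - q) * norm x"
      by (rule power2_le_imp_le) (use q in simp)
  qed (use q in simp)
  also have "sqrt (1 - q) < 1" using q by simp
  finally show ?thesis
    by (rule op_invertible_scaleR_cancel[OF op_invertible_if_near_id])
qed

text \<open>The quadratic form of J (A - z) is Im z times the squared norm, because J A is skew. Off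
  the real axis J (A - z) is therefore invertible, and with \<open>J\<close> also A - z.\<close>

lemma cspec_real:
  fixes A :: "'a::{real_inner, complete_space} \<Rightarrow>\<^sub>L 'a"
  assumes J: "complex_structure J" and A: "selfadjoint_op J A" and z: "z \<in> cspec J A"
  shows "Im z = 0"
proof (rule ccontr)
  assume b: "Im z \<noteq> 0"
  define M where "M = A - cscale J z id_blinfun"
  have "inner ((J o\<^sub>L M) x) x = Im z * (norm x)\<^sup>2" for x
    using selfadjoint_skew[OF J A, of x] complex_structure_apply[OF J]
    by (simp add: M_def cscale_def blinfun.bilinear_simps inner_diff_left inner_add_left power2_norm_eq_inner)
  from coercive_imp_invertible[OF b this] obtain B where B: "(J o\<^sub>L M) o\<^sub>L B = id_blinfun" "B o\<^sub>L (J o\<^sub>L M) = id_blinfun"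
    unfolding op_invertible_def by blast
  have "M o\<^sub>L (B o\<^sub>L J) = id_blinfun"
  proof (rule blinfun_eqI)
    fix x
    have "((J o\<^sub>L M) o\<^sub>L B) (J x) = id_blinfun (J x)" using B(1) by simp
    then have "J (J (M (B (J x)))) = J (J x)" by simp
    then show "(M o\<^sub>L (B o\<^sub>L J)) x = id_blinfun x"
      using complex_structure_apply(1)[OF J] by simp
  qed
  moreover have "(B o\<^sub>L J) o\<^sub>L M = id_blinfun"
    using B(2) by (simp add: blinfun_eq_iff)
  ultimately have "op_invertible M"
    unfolding op_invertible_def by blast
  then show False
    using z by (simp add: cspec_def M_def)
qed

lemma cspec_bounded:
  fixes A :: "'a::{real_inner, complete_space} \<Rightarrow>\<^sub>L 'a"
  assumes J: "complex_structure J" and A: "selfadjoint_op J A" and z: "z \<in> cspec J A"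
  shows "\<bar>Re z\<bar> \<le> norm A"
proof (rule ccontr)
  assume "\<not> \<bar>Re z\<bar> \<le> norm A"
  then have a: "norm A < \<bar>Re z\<bar>" "Re z \<noteq> 0" by auto
  define M where "M = A - cscale J z id_blinfun"
  have M: "M = A - Re z *\<^sub>R id_blinfun"
    using cspec_real[OF J A z] by (simp add: M_def cscale_def)
  have "id_blinfun - (- 1 / Re z) *\<^sub>R M = (1 / Re z) *\<^sub>R A"
    using a by (simp add: M blinfun_eq_iff blinfun.bilinear_simps algebra_simps)
  then have "norm (id_blinfun - (- 1 / Re z) *\<^sub>R M) < 1"
    using a by simp
  then have "op_invertible M"
    by (rule op_invertible_scaleR_cancel[OF op_invertible_if_near_id])
  then show False
    using z by (simp add: cspec_def M_def)
qed

lemma norm_complex_structure_scalar: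
  assumes "complex_structure J"
  shows "norm (Re z *\<^sub>R id_blinfun + Im z *\<^sub>R J) \<le> cmod z"
proof (rule norm_blinfun_bound)
  fix x
  have "(norm ((Re z *\<^sub>R id_blinfun + Im z *\<^sub>R J) x))\<^sup>2 = (cmod z * norm x)\<^sup>2"
    using complex_structure_apply(2,4)[OF assms]
    by (simp add: power2_norm_eq_inner blinfun.bilinear_simps inner_add_left inner_add_right
        inner_commute[of "J x" x] power_mult_distrib cmod_power2 algebra_simps)
      (simp add: inner_complex_def power2_eq_square algebra_simps)
  then show "norm ((Re z *\<^sub>R id_blinfun + Im z *\<^sub>R J) x) \<le> cmod z * norm x"
    by (simp add: power2_eq_iff_nonneg)
qed simp

text \<open>Along the evolution the squared norm has derivative 0, its generator being skew; the
  exponential is in fact isometric.\<close>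

lemma norm_evol_generator_le_1:
  fixes A :: "'a::{real_inner, complete_space} \<Rightarrow>\<^sub>L 'a"
  assumes J: "complex_structure J" and A: "selfadjoint_op J A"
  shows "norm (op_exp (t *\<^sub>R (J o\<^sub>L A))) \<le> 1"
proof (rule norm_blinfun_bound)
  fix x
  define X where "X = Bop 0 (J o\<^sub>L A)"
  define u where "u s = oper (exp (s *\<^sub>R X)) x" for s
  have bl: "bounded_linear (\<lambda>Y::'a bop. oper Y x)"
    by (rule bounded_linear_compose[OF blinfun.bounded_linear_left bounded_linear_oper, unfolded o_def])
  have u': "(u has_vector_derivative J (A (u s))) (at s)" for s
    using bounded_linear.has_vector_derivative[OF bl exp_scaleR_has_vector_derivative_left[of X s]]
    by (simp add: u_def[abs_def] X_def)
  have "((\<lambda>s. inner (u s) (u s)) has_real_derivative 0) (at s)" for s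
  proof -
    have "((\<lambda>s. inner (u s) (u s)) has_vector_derivative (inner (u s) (J (A (u s))) + inner (J (A (u s))) (u s))) (at s)"
      by (rule bounded_bilinear.has_vector_derivative[OF bounded_bilinear_inner u' u'])
    moreover have "inner (J (A (u s))) (u s) = 0"
      by (rule selfadjoint_skew[OF J A])
    ultimately show ?thesis
      by (simp add: has_real_derivative_iff_has_vector_derivative inner_commute)
  qed
  then have "inner (u t) (u t) = inner (u 0) (u 0)"
    using DERIV_isconst_all by blast
  then have "norm (u t) = norm x"
    by (simp add: norm_eq_sqrt_inner u_def)
  then show "norm (op_exp (t *\<^sub>R (J o\<^sub>L A)) x) \<le> 1 * norm x"
    by (simp add: u_def oper_exp X_def)
qed simp

section \<open>Polynomials in a self-adjoint operator\<close>

lemma op_poly_selfadjoint: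
  fixes A :: "'a::real_inner \<Rightarrow>\<^sub>L 'a"
  assumes "\<And>x y. inner (A x) y = inner x (A y)"
  shows "inner (op_poly p A x) y = inner x (op_poly p A y)"
proof (induction p arbitrary: x y)
  case (pCons a p)
  have "A (op_poly p A y) = op_poly p A (A y)" for y
    by (rule op_poly_commute_apply) simp
  with pCons show ?case
    by (simp add: op_poly_pCons blinfun.bilinear_simps inner_add_left inner_add_right assms)
qed simp

lemma norm_square_selfadjoint:
  fixes B :: "'a::real_inner \<Rightarrow>\<^sub>L 'a"
  assumes "\<And>x y. inner (B x) y = inner x (B y)"
  shows "(norm B)\<^sup>2 \<le> norm (B o\<^sub>L B)"
proof -
  have "norm B \<le> sqrt (norm (B o\<^sub>L B))"
  proof (rule norm_blinfun_bound)
    fix x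
    have "(norm (B x))\<^sup>2 = inner ((B o\<^sub>L B) x) x"
      by (simp add: power2_norm_eq_inner assms)
    also have "\<dots> \<le> norm ((B o\<^sub>L B) x) * norm x"
      by (rule norm_cauchy_schwarz)
    also have "\<dots> \<le> norm (B o\<^sub>L B) * norm x * norm x"
      by (intro mult_right_mono norm_blinfun norm_ge_zero)
    also have "\<dots> = (sqrt (norm (B o\<^sub>L B)) * norm x)\<^sup>2"
      by (simp add: power_mult_distrib power2_eq_square)
    finally show "norm (B x) \<le> sqrt (norm (B o\<^sub>L B)) * norm x"
      by (rule power2_le_imp_le) simp
  qed simp
  from power_mono[OF this, of 2] show ?thesis by simp
qed

text \<open>Iterates the C*-inequality \<open>norm_square_selfadjoint\<close> by repeated squaring,
  so that the decay of powers of p on the spectrum can be played off against the norm of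
  p(A).\<close>

lemma norm_op_poly_power_ge:
  fixes A :: "'a::real_inner \<Rightarrow>\<^sub>L 'a"
  assumes "\<And>x y. inner (A x) y = inner x (A y)"
  shows "norm (op_poly p A) ^ (2 ^ n) \<le> norm (op_poly (p ^ (2 ^ n)) A)"
proof (induction n)
  case (Suc n)
  have "norm (op_poly p A) ^ (2 ^ Suc n) = (norm (op_poly p A) ^ (2 ^ n))\<^sup>2"
    by (simp add: power_mult[symmetric] mult.commute)
  also have "\<dots> \<le> (norm (op_poly (p ^ (2 ^ n)) A))\<^sup>2"
    using Suc by (intro power_mono) auto
  also have "\<dots> \<le> norm (op_poly (p ^ (2 ^ n)) A o\<^sub>L op_poly (p ^ (2 ^ n)) A)"
    by (rule norm_square_selfadjoint) (rule op_poly_selfadjoint[OF assms])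
  also have "\<dots> = norm (op_poly (p ^ (2 ^ Suc n)) A)"
    by (simp only: op_poly_mult[symmetric]) (simp add: power_add[symmetric] mult_2)
  finally show ?case .
qed simp

lemma exists_poly_approx_on_interval:
  fixes F :: "real \<Rightarrow> real"
  assumes "continuous_on {-R..R} F" "e > 0"
  shows "\<exists>p. \<forall>x\<in>{-R..R}. \<bar>poly p x - F x\<bar> \<le> e"
proof -
  obtain g where g: "real_polynomial_function g" "\<And>x. x \<in> {-R..R} \<Longrightarrow> \<bar>F x - g x\<bar> < e"
    using Stone_Weierstrass_real_polynomial_function[OF compact_Icc assms] by auto
  then obtain a n where "g = (\<lambda>x. \<Sum>i\<le>n. a i * x ^ i)"
    using real_polynomial_function_iff_sum by blast
  then have "poly (\<Sum>i\<le>n. monom (a i) i) x = g x" for x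
    by (simp add: poly_sum poly_monom)
  with g(2) show ?thesis
    by (intro exI[of _ "\<Sum>i\<le>n. monom (a i) i"]) (fastforce simp: abs_minus_commute)
qed

text \<open>Replaces the supremum in \<open>spectral_projection\<close> by pointwise bounds. A
  nonempty spectrum and the bound \<open>e n\<close> give the real-valued supremum its
  meaning.\<close>

lemma spectral_projection_limit:
  assumes sp: "spectral_projection J A S P" and ne: "cspec J A \<noteq> {}"
    and bound: "\<And>n z. z \<in> cspec J A \<Longrightarrow> \<bar>poly (p n) (Re z) - indicator S z\<bar> \<le> e n"
    and e: "e \<longlonglongrightarrow> 0"
  shows "(\<lambda>n. op_poly (p n) A) \<longlonglongrightarrow> P"
proof -
  let ?g = "\<lambda>n z. \<bar>poly (p n) (Re z) - indicator S z\<bar>"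
  have "(\<lambda>n. SUP z\<in>cspec J A. ?g n z) \<longlonglongrightarrow> 0"
  proof (rule tendsto_sandwich[OF _ _ tendsto_const e])
    have bdd: "bdd_above (?g n ` cspec J A)" for n
      using bound by (auto intro!: bdd_aboveI[of _ "e n"])
    obtain z where z: "z \<in> cspec J A" using ne by blast
    show "\<forall>\<^sub>F n in sequentially. 0 \<le> (SUP z\<in>cspec J A. ?g n z)"
      using cSUP_upper2[OF bdd z] by (intro always_eventually allI) auto
    show "\<forall>\<^sub>F n in sequentially. (SUP z\<in>cspec J A. ?g n z) \<le> e n"
      using ne bound by (intro always_eventually allI cSUP_least) auto
  qed
  then show ?thesis
    using sp unfolding spectral_projection_def by blast
qed

section \<open>Spectral projections of separated parts\<close>

locale spectral_decomposition =
  fixes J A :: "'a::{real_inner, complete_space} \<Rightarrow>\<^sub>L 'a" and m :: nat and \<sigma> :: "nat \<Rightarrow> complex set"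
    and P :: "nat \<Rightarrow> 'a \<Rightarrow>\<^sub>L 'a" and \<eta> :: real
  assumes J: "complex_structure J" and A: "selfadjoint_op J A"
    and decomp: "(\<Union>k<m. \<sigma> k) = cspec J A"
    and disj: "\<And>k l. k < m \<Longrightarrow> l < m \<Longrightarrow> k \<noteq> l \<Longrightarrow> \<sigma> k \<inter> \<sigma> l = {}"
    and nonempty: "\<And>k. k < m \<Longrightarrow> \<sigma> k \<noteq> {}" and m_pos: "0 < m"
    and gap: "\<And>k l y z. k < m \<Longrightarrow> l < m \<Longrightarrow> k \<noteq> l \<Longrightarrow> y \<in> \<sigma> k \<Longrightarrow> z \<in> \<sigma> l \<Longrightarrow> \<eta> \<le> dist y z"
    and eta_pos: "\<eta> > 0"
    and P: "\<And>k. k < m \<Longrightarrow> spectral_projection J A (\<sigma> k) (P k)"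
begin

lemma sigma_subset: "k < m \<Longrightarrow> z \<in> \<sigma> k \<Longrightarrow> z \<in> cspec J A"
  using decomp by blast

lemma cspec_nonempty: "cspec J A \<noteq> {}"
  using nonempty[OF m_pos] sigma_subset[OF m_pos] by blast

lemma real_gap:
  assumes "k < m" "l < m" "k \<noteq> l" "y \<in> \<sigma> k" "z \<in> \<sigma> l"
  shows "\<eta> \<le> \<bar>Re y - Re z\<bar>"
proof -
  have "Im y = 0" "Im z = 0"
    using assms sigma_subset cspec_real[OF J A] by blast+
  then have "dist y z = \<bar>Re y - Re z\<bar>"
    by (simp add: dist_norm cmod_def)
  then show ?thesis
    using gap[OF assms] by simp
qed

lemma sym: "inner (A x) y = inner x (A y)"
  by (rule selfadjoint_apply(1)[OF A])

text \<open>The tent function 1 - dist(x, \<sigma>_k) / \<eta>, cut off at 0, is continuous and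
  agrees with the indicator on the spectrum, since the other parts are at least \<eta> away. The
  spectrum lies in a compact interval, where Weierstrass approximation applies.\<close>

lemma exists_indicator_approx:
  assumes k: "k < m" and "e > 0"
  shows "\<exists>r. \<forall>z\<in>cspec J A. \<bar>poly r (Re z) - indicator (\<sigma> k) z\<bar> \<le> e"
proof -
  define F where "F x = max 0 (1 - infdist x (Re ` \<sigma> k) / \<eta>)" for x
  have "continuous_on {- norm A..norm A} F"
    unfolding F_def using eta_pos by (intro continuous_intros) auto
  then obtain r where r: "\<And>x. x \<in> {- norm A..norm A} \<Longrightarrow> \<bar>poly r x - F x\<bar> \<le> e"
    using exists_poly_approx_on_interval assms(2) by blast
  have "F (Re z) = indicator (\<sigma> k) z" if z: "z \<in> cspec J A" for z
  proof (cases "z \<in> \<sigma> k")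
    case True
    then have "infdist (Re z) (Re ` \<sigma> k) = 0" by simp
    then show ?thesis using True by (simp add: F_def)
  next
    case False
    then obtain l where l: "l < m" "z \<in> \<sigma> l" "l \<noteq> k" using z decomp by blast
    have "\<eta> \<le> infdist (Re z) (Re ` \<sigma> k)"
      unfolding infdist_def using nonempty[OF k] real_gap[OF l(1) k l(3,2)]
      by (auto intro!: cINF_greatest simp: dist_real_def)
    then show ?thesis using False eta_pos by (simp add: F_def)
  qed
  moreover have "Re z \<in> {- norm A..norm A}" if "z \<in> cspec J A" for z
    using cspec_bounded[OF J A that] by auto
  ultimately show ?thesis
    using r by metis
qed

definition ind_poly :: "nat \<Rightarrow> nat \<Rightarrow> real poly"
  where "ind_poly k n = (SOME r. \<forall>z\<in>cspec J A. \<bar>poly r (Re z) - indicator (\<sigma> k) z\<bar> \<le> 1 / real (Suc n))"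

lemma ind_poly: "k < m \<Longrightarrow> z \<in> cspec J A \<Longrightarrow> \<bar>poly (ind_poly k n) (Re z) - indicator (\<sigma> k) z\<bar> \<le> 1 / real (Suc n)"
  using someI_ex[OF exists_indicator_approx[of k "1 / real (Suc n)"]] unfolding ind_poly_def by simp

lemma inverse_Suc_tendsto: "(\<lambda>n. 1 / real (Suc n)) \<longlonglongrightarrow> 0"
  using LIMSEQ_inverse_real_of_nat by (simp add: inverse_eq_divide)

lemma ind_poly_tendsto: "k < m \<Longrightarrow> (\<lambda>n. op_poly (ind_poly k n) A) \<longlonglongrightarrow> P k"
  by (rule spectral_projection_limit[OF P cspec_nonempty ind_poly inverse_Suc_tendsto])

text \<open>Adding to an approximation of the indicator a sequence of polynomials that is uniformly
  small on the spectrum does not change the limit, so such a sequence tends to zero at \<open>A\<close>;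
  powers of \<open>p / d\<close> with \<open>d\<close> between the two norms would contradict this.\<close>

lemma norm_op_poly_le:
  assumes c: "\<And>z. z \<in> cspec J A \<Longrightarrow> \<bar>poly p (Re z)\<bar> \<le> c"
  shows "norm (op_poly p A) \<le> c"
proof (rule ccontr)
  assume "\<not> norm (op_poly p A) \<le> c"
  then obtain d where d: "c < d" "d < norm (op_poly p A)"
    using dense by (metis not_le)
  have "0 \<le> c"
    using cspec_nonempty c by (metis abs_ge_zero all_not_in_conv order_trans)
  with d have d0: "d > 0" by simp
  \<comment> \<open>The exponents 2^n match the repeated squaring of
    \<open>norm_op_poly_power_ge\<close>: on the spectrum the values decay because c < d, while the
    norms at \<open>A\<close> stay at least 1 because d is below the norm of p(A).\<close>
  define q where "q n = smult (1 / d ^ (2 ^ n)) (p ^ (2 ^ n))" for n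
  have q_small: "\<bar>poly (q n) (Re z)\<bar> \<le> (c / d) ^ n" if z: "z \<in> cspec J A" for n z
  proof -
    have "\<bar>poly (q n) (Re z)\<bar> = (\<bar>poly p (Re z)\<bar> / d) ^ (2 ^ n)"
      using d0 by (simp add: q_def poly_power power_divide abs_mult power_abs)
    also have "\<dots> \<le> (c / d) ^ (2 ^ n)"
      using d0 c[OF z] by (intro power_mono divide_right_mono) auto
    also have "\<dots> \<le> (c / d) ^ n"
      using d d0 \<open>0 \<le> c\<close> by (intro power_decreasing) (auto intro: less_imp_le[OF less_exp])
    finally show ?thesis .
  qed
  have "(\<lambda>n. op_poly (ind_poly 0 n + q n) A) \<longlonglongrightarrow> P 0"
  proof (rule spectral_projection_limit[OF P[OF m_pos] cspec_nonempty])
    show "\<bar>poly (ind_poly 0 n + q n) (Re z) - indicator (\<sigma> 0) z\<bar> \<le> 1 / real (Suc n) + (c / d) ^ n"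
      if "z \<in> cspec J A" for n z
      using ind_poly[OF m_pos that, of n] q_small[OF that, of n] by simp
    have "(\<lambda>n. (c / d) ^ n) \<longlonglongrightarrow> 0"
      using d d0 \<open>0 \<le> c\<close> by (intro LIMSEQ_realpow_zero) auto
    from tendsto_add[OF inverse_Suc_tendsto this]
    show "(\<lambda>n. 1 / real (Suc n) + (c / d) ^ n) \<longlonglongrightarrow> 0" by simp
  qed
  from tendsto_diff[OF this ind_poly_tendsto[OF m_pos]]
  have "(\<lambda>n. op_poly (q n) A) \<longlonglongrightarrow> 0"
    by (simp add: op_poly_add)
  then have "(\<lambda>n. norm (op_poly (q n) A)) \<longlonglongrightarrow> 0"
    by (rule tendsto_norm_zero)
  moreover have "1 \<le> norm (op_poly (q n) A)" for n
  proof -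
    have "1 \<le> (norm (op_poly p A) / d) ^ (2 ^ n)"
      using d d0 by (intro one_le_power) simp
    also have "\<dots> = norm (op_poly p A) ^ (2 ^ n) / d ^ (2 ^ n)"
      by (simp add: power_divide)
    also have "\<dots> \<le> norm (op_poly (p ^ (2 ^ n)) A) / d ^ (2 ^ n)"
      using d0 norm_op_poly_power_ge[of A p n, OF sym] by (intro divide_right_mono) auto
    also have "\<dots> = norm (op_poly (q n) A)"
      using d0 by (simp add: q_def op_poly_smult)
    finally show ?thesis .
  qed
  ultimately have "(1::real) \<le> 0"
    by (intro LIMSEQ_le_const[of _ 0 1]) auto
  then show False by simp
qed

lemma op_poly_tendsto_0:
  assumes "\<And>n z. z \<in> cspec J A \<Longrightarrow> \<bar>poly (p n) (Re z)\<bar> \<le> e n" "e \<longlonglongrightarrow> 0"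
  shows "(\<lambda>n. op_poly (p n) A) \<longlonglongrightarrow> 0"
  by (rule Lim_null_comparison[OF always_eventually assms(2)]) (intro allI norm_op_poly_le assms(1))

lemma ind_poly_bounds:
  assumes "k < m" "z \<in> cspec J A"
  shows "z \<in> \<sigma> k \<Longrightarrow> \<bar>poly (ind_poly k n) (Re z) - 1\<bar> \<le> 1 / real (Suc n)"
    and "z \<notin> \<sigma> k \<Longrightarrow> \<bar>poly (ind_poly k n) (Re z)\<bar> \<le> 1 / real (Suc n)"
    and "\<bar>poly (ind_poly k n) (Re z)\<bar> \<le> 1 + 1 / real (Suc n)"
    and "\<bar>poly (ind_poly k n) (Re z)\<bar> \<le> 2"
proof -
  let ?r = "poly (ind_poly k n) (Re z)" and ?e = "1 / real (Suc n)"
  have e: "0 \<le> ?e" "?e \<le> 1" by simp_all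
  note b = ind_poly[OF assms, of n]
  show "\<bar>?r - 1\<bar> \<le> ?e" if "z \<in> \<sigma> k" using b that by simp
  show "\<bar>?r\<bar> \<le> ?e" if "z \<notin> \<sigma> k" using b that by simp
  show r: "\<bar>?r\<bar> \<le> 1 + ?e"
  proof (cases "z \<in> \<sigma> k")
    case True
    then have "\<bar>?r - 1\<bar> \<le> ?e" using b by simp
    then show ?thesis by linarith
  next
    case False
    then have "\<bar>?r\<bar> \<le> ?e" using b by simp
    then show ?thesis by linarith
  qed
  show "\<bar>?r\<bar> \<le> 2" using r e(2) by linarith
qed

lemma tendsto_blinfun_compose:
  fixes X Y :: "nat \<Rightarrow> 'a \<Rightarrow>\<^sub>L 'a"
  shows "X \<longlonglongrightarrow> B \<Longrightarrow> Y \<longlonglongrightarrow> C \<Longrightarrow> (\<lambda>n. X n o\<^sub>L Y n) \<longlonglongrightarrow> (B o\<^sub>L C)"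
  by (rule bounded_bilinear.tendsto[OF bounded_bilinear_blinfun_compose])

lemma P_commute:
  assumes "k < m" "X o\<^sub>L A = A o\<^sub>L X"
  shows "X o\<^sub>L P k = P k o\<^sub>L X"
proof (rule LIMSEQ_unique)
  show "(\<lambda>n. X o\<^sub>L op_poly (ind_poly k n) A) \<longlonglongrightarrow> (X o\<^sub>L P k)"
    by (intro tendsto_blinfun_compose tendsto_const ind_poly_tendsto assms)
  show "(\<lambda>n. X o\<^sub>L op_poly (ind_poly k n) A) \<longlonglongrightarrow> (P k o\<^sub>L X)"
    unfolding op_poly_commute[OF assms(2)]
    by (intro tendsto_blinfun_compose tendsto_const ind_poly_tendsto assms)
qed

lemma P_selfadjoint: "k < m \<Longrightarrow> inner (P k x) y = inner x (P k y)"
proof (rule LIMSEQ_unique)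
  assume k: "k < m"
  have lim: "(\<lambda>n. op_poly (ind_poly k n) A x) \<longlonglongrightarrow> P k x" for x
    by (rule bounded_linear.tendsto[OF blinfun.bounded_linear_left ind_poly_tendsto[OF k]])
  show "(\<lambda>n. inner (op_poly (ind_poly k n) A x) y) \<longlonglongrightarrow> inner (P k x) y"
    by (intro tendsto_inner lim tendsto_const)
  show "(\<lambda>n. inner (op_poly (ind_poly k n) A x) y) \<longlonglongrightarrow> inner x (P k y)"
    unfolding op_poly_selfadjoint[of A, OF sym] by (intro tendsto_inner lim tendsto_const)
qed

text \<open>An indicator is its own square, so the squared approximants have the same limit P k. The
  3 in the error bounds |r + 1| for |r| \<le> 2.\<close>

lemma P_idem: "k < m \<Longrightarrow> P k o\<^sub>L P k = P k"
proof (rule LIMSEQ_unique)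
  assume k: "k < m"
  show "(\<lambda>n. op_poly (ind_poly k n * ind_poly k n) A) \<longlonglongrightarrow> (P k o\<^sub>L P k)"
    unfolding op_poly_mult by (intro tendsto_blinfun_compose ind_poly_tendsto k)
  show "(\<lambda>n. op_poly (ind_poly k n * ind_poly k n) A) \<longlonglongrightarrow> P k"
  proof (rule spectral_projection_limit[OF P[OF k] cspec_nonempty])
    fix n z assume z: "z \<in> cspec J A"
    let ?r = "poly (ind_poly k n) (Re z)" and ?e = "1 / real (Suc n)"
    have e: "0 \<le> ?e" "?e \<le> 1" by simp_all
    have "\<bar>?r * ?r - indicator (\<sigma> k) z\<bar> \<le> ?e * 3"
    proof (cases "z \<in> \<sigma> k")
      case True
      have "?r * ?r - 1 = (?r - 1) * (?r + 1)" by (simp add: algebra_simps)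
      moreover have "\<bar>?r - 1\<bar> * \<bar>?r + 1\<bar> \<le> ?e * 3"
        using ind_poly_bounds(1,4)[OF k z, of n] True by (intro mult_mono) auto
      ultimately show ?thesis using True by (simp add: abs_mult)
    next
      case False
      have "\<bar>?r\<bar> * \<bar>?r\<bar> \<le> ?e * 3"
        using ind_poly_bounds(2,4)[OF k z, of n] False by (intro mult_mono) auto
      then show ?thesis using False by (simp add: abs_mult)
    qed
    then show "\<bar>poly (ind_poly k n * ind_poly k n) (Re z) - indicator (\<sigma> k) z\<bar> \<le> ?e * 3" by simp
  next
    show "(\<lambda>n. 1 / real (Suc n) * 3) \<longlonglongrightarrow> 0"
      using tendsto_mult_right[OF inverse_Suc_tendsto, of 3] by simp
  qed
qed

text \<open>By disjointness one of the two approximants is near 0 at every point of the spectrum,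
  while the other is at most 2.\<close>

lemma P_orth: "k < m \<Longrightarrow> l < m \<Longrightarrow> k \<noteq> l \<Longrightarrow> P k o\<^sub>L P l = 0"
proof (rule LIMSEQ_unique)
  assume k: "k < m" and l: "l < m" and ne: "k \<noteq> l"
  show "(\<lambda>n. op_poly (ind_poly k n * ind_poly l n) A) \<longlonglongrightarrow> (P k o\<^sub>L P l)"
    unfolding op_poly_mult by (intro tendsto_blinfun_compose ind_poly_tendsto k l)
  show "(\<lambda>n. op_poly (ind_poly k n * ind_poly l n) A) \<longlonglongrightarrow> 0"
  proof (rule op_poly_tendsto_0)
    fix n z assume z: "z \<in> cspec J A"
    let ?r = "\<lambda>k. poly (ind_poly k n) (Re z)" and ?e = "1 / real (Suc n)"
    have e: "0 \<le> ?e" "?e \<le> 1" by simp_all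
    have "z \<notin> \<sigma> k \<or> z \<notin> \<sigma> l"
      using disj[OF k l ne] by blast
    then have "\<bar>?r k\<bar> * \<bar>?r l\<bar> \<le> ?e * 2"
    proof
      assume "z \<notin> \<sigma> k"
      then show ?thesis
        using ind_poly_bounds(2)[OF k z, of n] ind_poly_bounds(4)[OF l z, of n] by (intro mult_mono) auto
    next
      assume "z \<notin> \<sigma> l"
      then have "\<bar>?r l\<bar> * \<bar>?r k\<bar> \<le> ?e * 2"
        using ind_poly_bounds(2)[OF l z, of n] ind_poly_bounds(4)[OF k z, of n] by (intro mult_mono) auto
      then show ?thesis by (simp add: mult.commute)
    qed
    then show "\<bar>poly (ind_poly k n * ind_poly l n) (Re z)\<bar> \<le> ?e * 2"
      by (simp add: abs_mult)
  next
    show "(\<lambda>n. 1 / real (Suc n) * 2) \<longlonglongrightarrow> 0"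
      using tendsto_mult_right[OF inverse_Suc_tendsto, of 2] by simp
  qed
qed

lemma P_sum: "(\<Sum>k<m. P k) = id_blinfun"
proof -
  have "(\<lambda>n. op_poly ((\<Sum>k<m. ind_poly k n) + [:-1:]) A) \<longlonglongrightarrow> 0"
  proof (rule op_poly_tendsto_0)
    fix n z assume z: "z \<in> cspec J A"
    then obtain l where l: "l < m" "z \<in> \<sigma> l" using decomp by blast
    have "indicator (\<sigma> k) z = (if k = l then 1 else 0 :: real)" if "k < m" for k
      using l that disj[OF that l(1)] by (auto simp: indicator_def)
    then have "(\<Sum>k<m. indicator (\<sigma> k) z) = (\<Sum>k<m. if k = l then 1 else 0 :: real)"
      by (intro sum.cong) auto
    then have one: "(\<Sum>k<m. indicator (\<sigma> k) z) = (1::real)"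
      using l by simp
    have "poly ((\<Sum>k<m. ind_poly k n) + [:-1:]) (Re z) = (\<Sum>k<m. poly (ind_poly k n) (Re z) - indicator (\<sigma> k) z)"
      by (simp add: poly_sum sum_subtractf one)
    also have "\<bar>\<dots>\<bar> \<le> (\<Sum>k<m. 1 / real (Suc n))"
      by (rule order_trans[OF sum_abs sum_mono]) (use ind_poly z in auto)
    finally show "\<bar>poly ((\<Sum>k<m. ind_poly k n) + [:-1:]) (Re z)\<bar> \<le> real m * (1 / real (Suc n))"
      by simp
  next
    show "(\<lambda>n. real m * (1 / real (Suc n))) \<longlonglongrightarrow> 0"
      using tendsto_mult_left[OF inverse_Suc_tendsto, of "real m"] by simp
  qed
  moreover have "(\<lambda>n. op_poly ((\<Sum>k<m. ind_poly k n) + [:-1:]) A) \<longlonglongrightarrow> (\<Sum>k<m. P k) + op_poly [:-1:] A"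
    unfolding op_poly_add op_poly_sum by (intro tendsto_intros ind_poly_tendsto) auto
  ultimately have "(\<Sum>k<m. P k) + op_poly [:-1:] A = 0"
    using LIMSEQ_unique by blast
  then show ?thesis
    by (simp add: op_poly_pCons)
qed

text \<open>In the squared norm of (p + iq)(A) x the cross term vanishes, because J (pq)(A) is skew.
  What remains is the quadratic form of the real polynomial p^2 + q^2, covered by
  \<open>norm_op_poly_le\<close>.\<close>

lemma norm_op_poly_complex_le:
  assumes c: "\<And>z. z \<in> cspec J A \<Longrightarrow> (poly p (Re z))\<^sup>2 + (poly q (Re z))\<^sup>2 \<le> c\<^sup>2" and "0 \<le> c"
  shows "norm (op_poly p A + (J o\<^sub>L op_poly q A)) \<le> c"
proof (rule norm_blinfun_bound[OF \<open>0 \<le> c\<close>])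
  fix x
  let ?p = "op_poly p A" and ?q = "op_poly q A"
  note sa = op_poly_selfadjoint[of A, OF sym]
  have JA: "J o\<^sub>L A = A o\<^sub>L J"
    using A by (simp add: selfadjoint_op_def clinear_op_def)
  have "selfadjoint_op J (op_poly (p * q) A)"
    unfolding selfadjoint_op_def clinear_op_def using sa op_poly_commute[OF JA] by simp
  then have "inner (J (op_poly (p * q) A x)) x = 0"
    by (rule selfadjoint_skew[OF J])
  then have cross: "inner (?p x) (J (?q x)) = 0"
    by (simp add: op_poly_mult sa op_poly_commute_apply[OF JA] inner_commute)
  have "(norm ((?p + (J o\<^sub>L ?q)) x))\<^sup>2 = inner (?p x) (?p x) + inner (?q x) (?q x)"
    by (simp add: power2_norm_eq_inner blinfun.bilinear_simps inner_add_left inner_add_right cross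
        inner_commute[of "J (?q x)"] complex_structure_apply(2)[OF J])
  also have "\<dots> = inner (op_poly (p * p + q * q) A x) x"
    by (simp add: op_poly_add op_poly_mult blinfun.bilinear_simps inner_add_left sa)
  also have "\<dots> \<le> norm (op_poly (p * p + q * q) A x) * norm x"
    by (rule norm_cauchy_schwarz)
  also have "\<dots> \<le> norm (op_poly (p * p + q * q) A) * norm x * norm x"
    by (intro mult_right_mono norm_blinfun norm_ge_zero)
  also have "\<dots> \<le> c\<^sup>2 * norm x * norm x"
    using c by (intro mult_right_mono norm_op_poly_le norm_ge_zero) (simp add: power2_eq_square)
  also have "\<dots> = (c * norm x)\<^sup>2"
    by (simp add: power2_eq_square)
  finally show "norm ((?p + (J o\<^sub>L ?q)) x) \<le> c * norm x"
    by (rule power2_le_imp_le) (simp add: \<open>0 \<le> c\<close>)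
qed

text \<open>With an approximant in place of \<open>P k\<close>, the estimate runs over the whole
  spectrum: on \<sigma>_k the values are at most c (1 + 1/(n+1)), elsewhere at most M/(n+1), with M
  a bound on an interval containing the spectrum. Letting n grow leaves c.\<close>

lemma norm_op_poly_complex_P_le:
  assumes k: "k < m" and c: "\<And>z. z \<in> \<sigma> k \<Longrightarrow> cmod (Complex (poly p (Re z)) (poly q (Re z))) \<le> c"
  shows "norm ((op_poly p A + (J o\<^sub>L op_poly q A)) o\<^sub>L P k) \<le> c"
proof -
  define w where "w x = cmod (Complex (poly p x) (poly q x))" for x
  have "0 \<le> c"
    using c nonempty[OF k] by (metis ex_in_conv norm_ge_zero order_trans)
  have "continuous_on {- norm A..norm A} w"
    unfolding w_def complex_norm by (intro continuous_intros)
  then have "bounded (w ` {- norm A..norm A})"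
    by (intro compact_imp_bounded compact_continuous_image compact_Icc)
  then obtain M where M: "M > 0" "\<And>x. x \<in> {- norm A..norm A} \<Longrightarrow> w x \<le> M"
    unfolding bounded_pos by (auto simp: w_def)
  let ?e = "\<lambda>n. 1 / real (Suc n)"
  have "norm (op_poly (p * ind_poly k n) A + (J o\<^sub>L op_poly (q * ind_poly k n) A)) \<le> c * (1 + ?e n) + M * ?e n" for n
  proof (rule norm_op_poly_complex_le)
    show nn: "0 \<le> c * (1 + ?e n) + M * ?e n"
      using M(1) \<open>0 \<le> c\<close> by (intro add_nonneg_nonneg mult_nonneg_nonneg) auto
    fix z assume z: "z \<in> cspec J A"
    let ?r = "poly (ind_poly k n) (Re z)"
    have "w (Re z) * \<bar>?r\<bar> \<le> c * (1 + ?e n) + M * ?e n"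
    proof (cases "z \<in> \<sigma> k")
      case True
      have "w (Re z) * \<bar>?r\<bar> \<le> c * (1 + ?e n)"
        using c[OF True] ind_poly_bounds(3)[OF k z, of n] \<open>0 \<le> c\<close> by (intro mult_mono) (auto simp: w_def)
      moreover have "0 \<le> M * ?e n" using M(1) by simp
      ultimately show ?thesis by linarith
    next
      case False
      have "w (Re z) * \<bar>?r\<bar> \<le> M * ?e n"
        using M(1) M(2)[of "Re z"] ind_poly_bounds(2)[OF k z False, of n] cspec_bounded[OF J A z]
        by (intro mult_mono) (auto simp: abs_le_iff)
      moreover have "0 \<le> c * (1 + ?e n)" using \<open>0 \<le> c\<close> by simp
      ultimately show ?thesis by linarith
    qed
    then have "(w (Re z) * \<bar>?r\<bar>)\<^sup>2 \<le> (c * (1 + ?e n) + M * ?e n)\<^sup>2"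
      by (intro power_mono) (auto simp: w_def)
    then show "(poly (p * ind_poly k n) (Re z))\<^sup>2 + (poly (q * ind_poly k n) (Re z))\<^sup>2 \<le> (c * (1 + ?e n) + M * ?e n)\<^sup>2"
      by (simp add: w_def cmod_power2 power_mult_distrib distrib_right)
  qed
  moreover have "(\<lambda>n. norm (op_poly (p * ind_poly k n) A + (J o\<^sub>L op_poly (q * ind_poly k n) A)))
      \<longlonglongrightarrow> norm ((op_poly p A + (J o\<^sub>L op_poly q A)) o\<^sub>L P k)"
  proof -
    have "op_poly (p * r) A + (J o\<^sub>L op_poly (q * r) A) = (op_poly p A + (J o\<^sub>L op_poly q A)) o\<^sub>L op_poly r A" for r
      by (rule blinfun_eqI) (simp add: op_poly_mult blinfun.bilinear_simps)
    then show ?thesis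
      by (simp only:) (intro tendsto_norm tendsto_blinfun_compose tendsto_const ind_poly_tendsto k)
  qed
  moreover have "(\<lambda>n. c * (1 + ?e n) + M * ?e n) \<longlonglongrightarrow> c * (1 + 0) + M * 0"
    by (intro tendsto_intros inverse_Suc_tendsto)
  ultimately have "norm ((op_poly p A + (J o\<^sub>L op_poly q A)) o\<^sub>L P k) \<le> c * (1 + 0) + M * 0"
    by (intro LIMSEQ_le) auto
  then show ?thesis by simp
qed

lemma P_apply: "k < m \<Longrightarrow> l < m \<Longrightarrow> P k (P l x) = (if k = l then P k x else 0)"
  using P_idem[of k] P_orth[of k l] by (metis blinfun_apply_blinfun_compose zero_blinfun.rep_eq)

lemma norm_square_sum_P:
  assumes "\<And>k. k < m \<Longrightarrow> P k (u k) = u k"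
  shows "(norm (\<Sum>k<m. u k))\<^sup>2 = (\<Sum>k<m. (norm (u k))\<^sup>2)"
proof (rule norm_sum_Pythagorean)
  show "pairwise (\<lambda>i j. orthogonal (u i) (u j)) {..<m}"
    unfolding pairwise_def orthogonal_def
  proof (intro ballI impI)
    fix i j assume ij: "i \<in> {..<m}" "j \<in> {..<m}" "i \<noteq> j"
    have "inner (u i) (u j) = inner (P i (u i)) (P j (u j))"
      using assms ij by simp
    also have "\<dots> = inner (u i) (P i (P j (u j)))"
      using ij by (simp add: P_selfadjoint)
    finally show "inner (u i) (u j) = 0"
      using ij by (simp add: P_apply)
  qed
qed simp

text \<open>The blocks act on orthogonal components and have orthogonal ranges, so Pythagoras before
  and after X gives the bound with no dependence on the number of blocks.\<close>

lemma norm_pinching_le: "norm (\<Sum>k<m. P k o\<^sub>L X o\<^sub>L P k) \<le> norm X"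
proof (rule norm_blinfun_bound)
  fix x
  have Px: "(\<Sum>k<m. P k x) = x"
    using arg_cong[OF P_sum, of "\<lambda>Y. blinfun_apply Y x"] by (simp add: blinfun.sum_left)
  have norm_P: "norm (P k y) \<le> norm y" if "k < m" for k y
  proof -
    have "(norm (P k y))\<^sup>2 = inner (P k y) y"
      using that by (simp add: power2_norm_eq_inner P_selfadjoint P_apply)
    also have "\<dots> \<le> norm (P k y) * norm y" by (rule norm_cauchy_schwarz)
    finally show ?thesis
      by (cases "P k y = 0") (auto simp: power2_eq_square)
  qed
  have "(norm ((\<Sum>k<m. P k o\<^sub>L X o\<^sub>L P k) x))\<^sup>2 = (norm (\<Sum>k<m. P k (X (P k x))))\<^sup>2"
    by (simp add: blinfun.sum_left)
  also have "\<dots> = (\<Sum>k<m. (norm (P k (X (P k x))))\<^sup>2)"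
    by (rule norm_square_sum_P) (simp add: P_apply)
  also have "\<dots> \<le> (\<Sum>k<m. (norm X * norm (P k x))\<^sup>2)"
    using norm_P norm_blinfun order_trans by (intro sum_mono power_mono) (auto, blast)
  also have "\<dots> = (norm X)\<^sup>2 * (norm (\<Sum>k<m. P k x))\<^sup>2"
    by (subst norm_square_sum_P) (simp_all add: P_apply power_mult_distrib sum_distrib_left)
  also have "\<dots> = (norm X * norm x)\<^sup>2"
    by (simp add: Px power_mult_distrib)
  finally show "norm ((\<Sum>k<m. P k o\<^sub>L X o\<^sub>L P k) x) \<le> norm X * norm x"
    by (rule power2_le_imp_le) simp
qed simp

end

section \<open>Transfer from the algebra to operators\<close>

theorem theorem1:
  fixes J H0 V :: "'a::{real_inner, complete_space} \<Rightarrow>\<^sub>L 'a"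
    and \<gamma> \<eta> :: real and m :: nat
    and \<sigma> :: "nat \<Rightarrow> complex set" and P :: "nat \<Rightarrow> ('a \<Rightarrow>\<^sub>L 'a)"
    and f :: "real \<Rightarrow> complex"
  assumes J: "complex_structure J"
    and H0: "selfadjoint_op J H0" and V: "selfadjoint_op J V"
    and gamma_pos: "\<gamma> > 0"
    and m: "m \<ge> 2"
    and decomp: "(\<Union>k<m. \<sigma> k) = cspec J H0"
    and disj: "\<And>k l. k < m \<Longrightarrow> l < m \<Longrightarrow> k \<noteq> l \<Longrightarrow> \<sigma> k \<inter> \<sigma> l = {}"
    and eta_def: "\<eta> = Min {setdist (\<sigma> k) (\<sigma> l) | k l. k < m \<and> l < m \<and> k \<noteq> l}"
    and eta_pos: "\<eta> > 0"
    and P: "\<And>k. k < m \<Longrightarrow> spectral_projection J H0 (\<sigma> k) (P k)"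
    and f_L1: "integrable lborel f"
    and f_hat: "\<And>s. \<bar>s\<bar> \<ge> \<eta> \<Longrightarrow>
        (LINT t|lborel. f t * exp (- \<i> * complex_of_real (s * t))) = 1 / complex_of_real s"
    and gamma_large: "\<gamma> > 4 * pi * norm V / \<eta>"
  shows
    "let H = \<gamma> *\<^sub>R H0 + V;
         \<Omega>k = (\<lambda>k. \<Sum>j. (1 / \<gamma> ^ j) *\<^sub>R omega_term J H0 V f (P k) j);
         \<Omega> = (\<Sum>k<m. \<Omega>k k);
         HB = (\<Sum>k<m. P k o\<^sub>L H o\<^sub>L \<Omega>k k)
     in (\<forall>k<m. summable (\<lambda>j. (1 / \<gamma> ^ j) *\<^sub>R omega_term J H0 V f (P k) j))
      \<and> op_invertible \<Omega>
      \<and> (\<exists>\<Omega>inv. \<Omega> o\<^sub>L \<Omega>inv = id_blinfun \<and> \<Omega>inv o\<^sub>L \<Omega> = id_blinfun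
                 \<and> HB = \<Omega>inv o\<^sub>L H o\<^sub>L \<Omega>)
      \<and> (\<forall>k<m. HB o\<^sub>L P k = P k o\<^sub>L HB)
      \<and> (\<forall>t::real. norm (evol J H t - evol J HB t)
             \<le> 1 / sqrt (1 - 4 * pi * (norm V / (\<gamma> * \<eta>))) - 1)"
proof -
  have eta_le: "\<eta> \<le> setdist (\<sigma> k) (\<sigma> l)" if "k < m" "l < m" "k \<noteq> l" for k l
  proof -
    let ?D = "{setdist (\<sigma> k) (\<sigma> l) | k l. k < m \<and> l < m \<and> k \<noteq> l}"
    have "?D \<subseteq> (\<lambda>(k, l). setdist (\<sigma> k) (\<sigma> l)) ` ({..<m} \<times> {..<m})"
      by auto
    then have "finite ?D"
      by (rule finite_subset) auto
    then show ?thesis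
      unfolding eta_def using that by (intro Min_le) auto
  qed
  \<comment> \<open>\<open>setdist\<close> to the empty set is 0, so \<eta> > 0 excludes empty
    parts; m \<ge> 2 supplies a second index to compare with.\<close>
  have nonempty: "\<sigma> k \<noteq> {}" if "k < m" for k
  proof
    assume empty: "\<sigma> k = {}"
    define l :: nat where "l = (if k = 0 then 1 else 0)"
    have "l < m" "k \<noteq> l"
      using m by (auto simp: l_def)
    from eta_le[OF that this] eta_pos show False
      by (simp add: empty)
  qed
  have gap: "\<eta> \<le> dist y z" if "k < m" "l < m" "k \<noteq> l" "y \<in> \<sigma> k" "z \<in> \<sigma> l" for k l y z
    using eta_le[OF that(1-3)] setdist_le_dist[OF that(4,5)] by (rule order_trans)
  interpret sd: spectral_decomposition J H0 m \<sigma> P \<eta>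
    using m by unfold_locales (simp_all add: J H0 decomp disj nonempty eta_pos P gap)
  obtain z0 where z0: "z0 \<in> \<sigma> 0"
    using nonempty[of 0] m by auto
  \<comment> \<open>The extra summand \<open>\<complex>\<close> is made part of the spectral subspace of \<open>\<sigma> 0\<close>, with \<open>Re z0\<close> as the value of \<open>H0\<close> on it,
    so that all relations between \<open>H0\<close> and the projections persist.\<close>
  define Jb Ab Vb where "Jb = Bop \<i> J" and "Ab = Bop (of_real (Re z0)) H0" and "Vb = Bop 0 V"
  define Pb where "Pb k = Bop (if k = 0 then 1 else 0) (P k)" for k :: nat
  note bop_defs = Jb_def Ab_def Vb_def Pb_def
  have HJ: "H0 o\<^sub>L J = J o\<^sub>L H0" "V o\<^sub>L J = J o\<^sub>L V"
    using H0 V by (simp_all add: selfadjoint_op_def clinear_op_def)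
  interpret he: hermitian_evolution Jb Ab
  proof unfold_locales
    show "Jb * Jb = - 1"
      using J by (simp add: bop_eq_iff bop_defs complex_structure_def)
    show "norm (Re z *\<^sub>R 1 + Im z *\<^sub>R Jb) \<le> cmod z" for z
    proof -
      have "scal (Re z *\<^sub>R 1 + Im z *\<^sub>R Jb) = z"
        by (simp add: bop_defs complex_eq_iff)
      then show ?thesis
        using norm_complex_structure_scalar[OF J, of z] by (simp add: norm_bop_def[of "_ + _"] bop_defs)
    qed
    show "Ab * Jb = Jb * Ab"
      using HJ by (simp add: bop_eq_iff bop_defs)
    show "norm (exp (t *\<^sub>R (Jb * Ab))) \<le> 1" for t
      using norm_evol_generator_le_1[OF J H0, of t]
      by (simp add: norm_bop_def scal_exp oper_exp bop_defs norm_exp_eq_Re)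
  qed
  have spectral: "he.spectral_bound (Pb k) (Re ` \<sigma> k)" if k: "k < m" for k
    unfolding he.spectral_bound_def
  proof (intro conjI allI impI)
    show "Pb k * Ab = Ab * Pb k"
      using sd.P_commute[OF k, of H0] by (simp add: bop_eq_iff bop_defs)
    show "Pb k * Jb = Jb * Pb k"
      using sd.P_commute[OF k, of J] HJ by (simp add: bop_eq_iff bop_defs)
    show "Re ` \<sigma> k \<noteq> {}" using nonempty[OF k] by simp
    show "bounded (Re ` \<sigma> k)"
      unfolding bounded_iff using cspec_bounded[OF J H0 sd.sigma_subset[OF k]] by auto
    fix p q c assume c: "\<forall>x\<in>Re ` \<sigma> k. cmod (Complex (poly p x) (poly q x)) \<le> c"
    have "norm ((op_poly p H0 + (J o\<^sub>L op_poly q H0)) o\<^sub>L P k) \<le> c"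
      using c by (intro sd.norm_op_poly_complex_P_le[OF k]) auto
    \<comment> \<open>The scalar component: for k = 0 the value of p + iq at \<open>Re z0\<close>, a
      point where the bound c holds, and 0 for the other blocks.\<close>
    moreover have "cmod ((of_real (poly p (Re z0)) + \<i> * of_real (poly q (Re z0))) * (if k = 0 then 1 else 0)) \<le> c"
    proof (cases "k = 0")
      case True
      have "of_real (poly p (Re z0)) + \<i> * of_real (poly q (Re z0)) = Complex (poly p (Re z0)) (poly q (Re z0))"
        by (simp add: complex_eq_iff)
      then show ?thesis using True c z0 by auto
    next
      case False
      obtain w where "w \<in> \<sigma> k" using nonempty[OF k] by auto
      then have "0 \<le> c" using c norm_ge_zero order_trans by blast
      then show ?thesis using False by simp
    qed
    ultimately show "norm ((alg_poly p Ab + Jb * alg_poly q Ab) * Pb k) \<le> c"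
      by (simp add: norm_bop_def bop_defs scal_alg_poly oper_alg_poly)
  qed
  have norm_Vb: "norm Vb = norm V"
    by (simp add: norm_bop_def Vb_def)
  interpret bl: bloch Jb Ab Vb m Pb "\<lambda>k. Re ` \<sigma> k" f \<gamma> \<eta>
  proof unfold_locales
    show "Vb * Jb = Jb * Vb"
      using HJ by (simp add: bop_eq_iff bop_defs)
    show "Pb k * Pb k = Pb k" if "k < m" for k
      using sd.P_idem[OF that] by (simp add: bop_eq_iff bop_defs)
    show "Pb k * Pb l = 0" if "k < m" "l < m" "k \<noteq> l" for k l
      using sd.P_orth[OF that] that(3) by (simp add: bop_eq_iff bop_defs)
    show "(\<Sum>k<m. Pb k) = 1"
      using sd.P_sum m by (simp add: bop_eq_iff bop_defs scal_sum oper_sum)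
    show "X * Pb k = Pb k * X" if "k < m" "X * Ab = Ab * X" for k X
      using sd.P_commute[OF that(1), of "oper X"] that(2) by (simp add: bop_eq_iff bop_defs mult.commute)
    show "norm (\<Sum>k<m. Pb k * X * Pb k) \<le> norm X" for X
    proof -
      have "scal (\<Sum>k<m. Pb k * X * Pb k) = (\<Sum>k<m. if k = 0 then scal X else 0)"
        unfolding scal_sum by (intro sum.cong) (auto simp: Pb_def)
      then have "scal (\<Sum>k<m. Pb k * X * Pb k) = scal X"
        using m by simp
      moreover have "norm (oper (\<Sum>k<m. Pb k * X * Pb k)) \<le> norm (oper X)"
        using sd.norm_pinching_le[of "oper X"] by (simp add: oper_sum Pb_def)
      ultimately show ?thesis
        by (auto simp: norm_bop_def)
    qed
    show "\<eta> \<le> \<bar>y - z\<bar>" if "k < m" "l < m" "k \<noteq> l" "y \<in> Re ` \<sigma> k" "z \<in> Re ` \<sigma> l" for k l y z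
      using that sd.real_gap[OF that(1-3)] by auto
    show "norm (exp (t *\<^sub>R (Jb * (\<gamma> *\<^sub>R Ab + Vb)))) \<le> 1" for t
      using norm_evol_generator_le_1[OF J selfadjoint_op_add_scaleR[OF H0 V], of t \<gamma>]
      by (simp add: norm_bop_def scal_exp oper_exp bop_defs norm_exp_eq_Re)
  qed (use spectral eta_pos f_L1 f_hat gamma_pos gamma_large norm_Vb in auto)
  have comp: "oper Jb = J" "oper Ab = H0" "oper Vb = V" "oper (Pb k) = P k" for k
    by (simp_all add: bop_defs)
  \<comment> \<open>The bounded linear map \<open>oper\<close> commutes with the gauge integral of
    an integrable function. Existence of the integrals in the algebra thus ensures that
    \<open>omega_term\<close> is never a default value here.\<close>
  have wave: "oper (bl.wave k j) = omega_term J H0 V f (P k) j" if k: "k < m" for k j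
  proof (induction j rule: less_induct)
    case (less j)
    show ?case
    proof (cases j)
      case 0
      then show ?thesis by (simp add: comp)
    next
      case (Suc i)
      let ?Z = "(1 - Pb k) * bl.wave_source k i * Pb k"
      have src: "oper (bl.wave_source k i) = - (V o\<^sub>L omega_term J H0 V f (P k) i)
          + (\<Sum>l\<in>{1..i}. omega_term J H0 V f (P k) l o\<^sub>L V o\<^sub>L omega_term J H0 V f (P k) (i - l))"
        using less Suc by (simp add: bl.wave_source_def oper_sum comp)
      have U: "oper (he.U t) = evol J H0 t" for t
        by (simp add: he.U_def evol_def oper_exp comp)
      have conj: "oper (he.twirl f ((1 - Pb k) * S * Pb k) t) = cscale J (f t)
          (evol J H0 t o\<^sub>L (id_blinfun - P k) o\<^sub>L oper S o\<^sub>L P k o\<^sub>L evol J H0 (- t))" for S t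
        by (rule blinfun_eqI)
          (simp add: he.twirl_def he.cemb_def cscale_def U comp blinfun.add_left blinfun.scaleR_left)
      have "oper (bl.wave k j) = integral UNIV (\<lambda>t. oper (he.twirl f ?Z t))"
        using integral_linear[OF bl.wave_integrable[OF k, of i] bounded_linear_oper]
        by (simp add: Suc bl.wave_Suc o_def)
      also have "\<dots> = omega_term J H0 V f (P k) j"
        unfolding Suc omega_term.simps src[symmetric] conj ..
      finally show ?thesis .
    qed
  qed
  define H where "H = \<gamma> *\<^sub>R H0 + V"
  define \<Omega>k where "\<Omega>k k = (\<Sum>j. (1 / \<gamma> ^ j) *\<^sub>R omega_term J H0 V f (P k) j)" for k
  define \<Omega> where "\<Omega> = (\<Sum>k<m. \<Omega>k k)"
  define HB where "HB = (\<Sum>k<m. P k o\<^sub>L H o\<^sub>L \<Omega>k k)"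
  have H: "oper bl.H = H"
    by (simp add: bl.H_def H_def comp)
  have summable: "summable (\<lambda>j. (1 / \<gamma> ^ j) *\<^sub>R omega_term J H0 V f (P k) j)" if "k < m" for k
    using bounded_linear.summable[OF bounded_linear_oper bl.summable_wave[OF that]]
    by (simp add: wave[OF that])
  have \<Omega>k: "oper (bl.wave_op k) = \<Omega>k k" if "k < m" for k
    using bounded_linear.suminf[OF bounded_linear_oper bl.summable_wave[OF that]]
    by (simp add: bl.wave_op_def \<Omega>k_def wave[OF that])
  have \<Omega>: "oper bl.total_wave_op = \<Omega>"
    by (simp add: bl.total_wave_op_def \<Omega>_def oper_sum \<Omega>k)
  have HB: "oper bl.bloch_hamiltonian = HB"
    by (simp add: bl.bloch_hamiltonian_def HB_def oper_sum \<Omega>k H comp)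
  obtain W where W: "bl.total_wave_op * W = 1" "W * bl.total_wave_op = 1"
    "bl.bloch_hamiltonian = W * bl.H * bl.total_wave_op"
    and bound: "\<And>t. norm (exp ((- t) *\<^sub>R (Jb * bl.H)) - exp ((- t) *\<^sub>R (Jb * bl.bloch_hamiltonian)))
      \<le> 1 / sqrt (1 - 4 * pi * (norm Vb / (\<gamma> * \<eta>))) - 1"
    using bl.bloch_theorem by blast
  have inv: "\<Omega> o\<^sub>L oper W = id_blinfun" "oper W o\<^sub>L \<Omega> = id_blinfun" "HB = oper W o\<^sub>L H o\<^sub>L \<Omega>"
    using W[THEN arg_cong[of _ _ oper]] by (simp_all add: \<Omega> HB H)
  have comm: "HB o\<^sub>L P k = P k o\<^sub>L HB" if "k < m" for k
    using arg_cong[OF bl.bloch_hamiltonian_commute[OF that], of oper] by (simp add: HB comp)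
  have evol: "evol J H t = oper (exp ((- t) *\<^sub>R (Jb * bl.H)))"
    "evol J HB t = oper (exp ((- t) *\<^sub>R (Jb * bl.bloch_hamiltonian)))" for t
    by (simp_all add: evol_def oper_exp H HB comp)
  have "norm (evol J H t - evol J HB t) \<le> 1 / sqrt (1 - 4 * pi * (norm V / (\<gamma> * \<eta>))) - 1" for t
    using order_trans[OF norm_oper_le bound[of t]] by (simp add: evol norm_Vb)
  then show ?thesis
    unfolding Let_def H_def[symmetric] \<Omega>k_def[symmetric] \<Omega>_def[symmetric] HB_def[symmetric] op_invertible_def
    using summable inv comm by blast
qed

end
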